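(* Let $n \ge 1$, let $J$ be a set, and for each $\mu \in J$ let $A(\mu) \in \mathbb{R}^{n \times n}$ and $c(\mu) \in \mathbb{R}^n$. Consider the family of Filippov systems on $\mathbb{R}^n$ $$\dot{x} = F_\mu(x) = \begin{cases} A(\mu) x, & x_1 < 0, \\ c(\mu), & x_1 > 0. \end{cases}$$ Let $\tilde\mu \in J$ and suppose $\mathbf{0}$ is exponentially stable for $\dot{x} = F_{\tilde\mu}(x)$. Then there exists $\delta > 0$ such that for every $\mu \in J$, if $\|A(\mu) - A(\tilde\mu)\| < \delta$ (using the induced matrix norm) and $\|c(\mu) - c(\tilde\mu)\| < \delta$, then $\mathbf{0}$ is also exponentially stable for $\dot{x} = F_\mu(x)$.
   Context: $\|\cdot\|$ is a norm on $\mathbb{R}^n$, with the induced operator norm on matrices; $\mathbf{0}$ is the origin, $x_1$ denotes the first component of $x$, and $B_\delta(x) = \{y \in \mathbb{R}^n : \|x-y\| < \delta\}$. For a system $\dot{x} = F(x)$ with $F(x) = A x$ for $x_1<0$ and $F(x) = c$ for $x_1 > 0$, define the set-valued function $\mathcal{F}(x) = \bigcap_{\delta>0} \mathrm{co}[F(B_\delta(x) \setminus \{x_1 = 0\})]$, where $\mathrm{co}[U]$ is the smallest closed convex set containing $U$; explicitly $$\mathcal{F}(x) = \begin{cases} \{A x\}, & x_1 < 0, \\ \{(1-\lambda) A x + \lambda c : 0 \le \lambda \le 1\}, & x_1 = 0, \\ \{c\}, & x_1 > 0. \end{cases}$$ An absolutely continuous function $\phi : [a,b] \to \mathbb{R}^n$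 is a Filippov solution if $\dot\phi(t) \in \mathcal{F}(\phi(t))$ for almost all $t \in [a,b]$; on an unbounded interval, a Filippov solution is a function whose restriction to each compact subinterval is a Filippov solution. A point $x^*$ is an equilibrium if the constant function $\phi(t) = x^*$ is a Filippov solution for all $t \in \mathbb{R}$. An equilibrium $x^*$ is exponentially stable if there exist $\alpha \ge 1$, $\beta > 0$ and $\delta > 0$ such that every Filippov solution $\phi(t)$ with $\phi(0) \in B_\delta(x^* )$ has $\|\phi(t) - x^*\| \le \alpha e^{-\beta t}\|\phi(0) - x^*\|$ for all $t \ge 0$. (Here solutions are understood to be maximally extended forward in time, and the requirement includes that they are defined for all $t \ge 0$.) *)

theory Defs
  imports "HOL-Analysis.Analysis"
begin

text \<open>
  The type \<^typ>\<open>real^'n\<close> carries the Euclidean norm; an arbitrary norm on it is therefore a function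
  satisfying the norm axioms (nonnegativity follows from them).
\<close>

definition is_norm :: "(real^'n \<Rightarrow> real) \<Rightarrow> bool" where
  "is_norm N \<longleftrightarrow>
     (\<forall>x. N x = 0 \<longleftrightarrow> x = 0) \<and>
     (\<forall>r x. N (r *\<^sub>R x) = \<bar>r\<bar> * N x) \<and>
     (\<forall>x y. N (x + y) \<le> N x + N y)"

text \<open>As in \<^const>\<open>onorm\<close>, the vector \<open>x = 0\<close> contributes \<open>0 / 0 = 0\<close>.\<close>

definition induced_norm :: "(real^'n \<Rightarrow> real) \<Rightarrow> real^'n^'n \<Rightarrow> real" where
  "induced_norm N B = (SUP x. N (B *v x) / N x)"

definition norm_ball :: "(real^'n \<Rightarrow> real) \<Rightarrow> real^'n \<Rightarrow> real \<Rightarrow> (real^'n) set" where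
  "norm_ball N x \<delta> = {y. N (x - y) < \<delta>}"

text \<open>
  The index \<open>k\<close> is the one of the component called \<open>x\<^sub>1\<close>. The vector field is undefined on
  \<open>x $ k = 0\<close>; the value it gets there is irrelevant, because \<open>filippov_map\<close> removes this hyperplane.
\<close>

definition pw_field :: "'n \<Rightarrow> real^'n^'n \<Rightarrow> real^'n \<Rightarrow> real^'n \<Rightarrow> real^'n" where
  "pw_field k A c x = (if x $ k < 0 then A *v x else c)"

definition filippov_map ::
    "(real^'n \<Rightarrow> real) \<Rightarrow> 'n \<Rightarrow> (real^'n \<Rightarrow> real^'n) \<Rightarrow> real^'n \<Rightarrow> (real^'n) set" where
  "filippov_map N k F x =
     (\<Inter>\<delta>\<in>{0<..}. (\<lambda>S. closed S \<and> convex S) hull (F ` (norm_ball N x \<delta> - {y. y $ k = 0})))"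

definition abs_continuous_on :: "real \<Rightarrow> real \<Rightarrow> (real \<Rightarrow> 'a::metric_space) \<Rightarrow> bool" where
  "abs_continuous_on a b f \<longleftrightarrow>
     (\<forall>\<epsilon>>0. \<exists>\<delta>>0. \<forall>m::nat. \<forall>u v :: nat \<Rightarrow> real.
        (\<forall>i<m. a \<le> u i \<and> u i \<le> v i \<and> v i \<le> b) \<and>
        disjoint_family_on (\<lambda>i. {u i<..<v i}) {..<m} \<and>
        (\<Sum>i<m. v i - u i) < \<delta>
        \<longrightarrow> (\<Sum>i<m. dist (f (u i)) (f (v i))) < \<epsilon>)"

definition filippov_solution_compact ::
    "(real^'n \<Rightarrow> (real^'n) set) \<Rightarrow> real \<Rightarrow> real \<Rightarrow> (real \<Rightarrow> real^'n) \<Rightarrow> bool" where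
  "filippov_solution_compact G a b \<phi> \<longleftrightarrow>
     abs_continuous_on a b \<phi> \<and>
     (AE t\<in>{a..b} in lebesgue.
        \<exists>v\<in>G (\<phi> t). (\<phi> has_vector_derivative v) (at t within {a..b}))"

definition filippov_solution ::
    "(real^'n \<Rightarrow> (real^'n) set) \<Rightarrow> real set \<Rightarrow> (real \<Rightarrow> real^'n) \<Rightarrow> bool" where
  "filippov_solution G I \<phi> \<longleftrightarrow>
     is_interval I \<and> (\<forall>a b. a \<le> b \<and> {a..b} \<subseteq> I \<longrightarrow> filippov_solution_compact G a b \<phi>)"

definition is_equilibrium :: "(real^'n \<Rightarrow> (real^'n) set) \<Rightarrow> real^'n \<Rightarrow> bool" where
  "is_equilibrium G p \<longleftrightarrow> filippov_solution G UNIV (\<lambda>t. p)"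

text \<open>
  Functions are total, so the domain \<open>I\<close> of a solution is carried along. Forward solutions live on
  intervals \<open>{0}\<close>, \<open>[0, T]\<close>, \<open>[0, T)\<close> or \<open>[0, \<infinity>)\<close>; since \<open>{0}\<close> is admitted, every initial point has
  a maximal forward solution, and nonexistence of solutions would violate stability.
\<close>

definition forward_solution ::
    "(real^'n \<Rightarrow> (real^'n) set) \<Rightarrow> real set \<Rightarrow> (real \<Rightarrow> real^'n) \<Rightarrow> bool" where
  "forward_solution G I \<phi> \<longleftrightarrow> 0 \<in> I \<and> I \<subseteq> {0..} \<and> filippov_solution G I \<phi>"

definition maximal_forward_solution ::
    "(real^'n \<Rightarrow> (real^'n) set) \<Rightarrow> real set \<Rightarrow> (real \<Rightarrow> real^'n) \<Rightarrow> bool" where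
  "maximal_forward_solution G I \<phi> \<longleftrightarrow>
     forward_solution G I \<phi> \<and>
     \<not> (\<exists>I' \<psi>. I \<subset> I' \<and> forward_solution G I' \<psi> \<and> (\<forall>t\<in>I. \<psi> t = \<phi> t))"

definition exponentially_stable ::
    "(real^'n \<Rightarrow> real) \<Rightarrow> (real^'n \<Rightarrow> (real^'n) set) \<Rightarrow> real^'n \<Rightarrow> bool" where
  "exponentially_stable N G p \<longleftrightarrow>
     is_equilibrium G p \<and>
     (\<exists>\<alpha>\<ge>1. \<exists>\<beta>>0. \<exists>\<delta>>0. \<forall>I \<phi>.
        maximal_forward_solution G I \<phi> \<and> \<phi> 0 \<in> norm_ball N p \<delta> \<longrightarrow>
          I = {0..} \<and>
          (\<forall>t\<ge>0. N (\<phi> t - p) \<le> \<alpha> * exp (- \<beta> * t) * N (\<phi> 0 - p)))"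

end

theory Submission
  imports Defs
begin

text \<open>
  Write \<open>x\<^sub>k\<close> for the component that switches the field, \<open>|x|\<close> for the Euclidean norm, and let
  \<open>\<phi>\<close> and \<open>\<psi>\<close> be solutions of the stable system \<open>(A, c)\<close> and of a perturbed one \<open>(A', c')\<close> with
  the same initial point. The heart of the proof is the estimate
  \<open>|\<phi> t - \<psi> t| \<le> C(t) \<cdot> \<epsilon> \<cdot> sup |\<psi>|\<close> for \<open>\<epsilon>\<close>-close systems (\<open>filippov_solution_comparison\<close>):
  the error is small \<^emph>\<open>relative\<close> to the size of the solution. Given it, choose \<open>T\<close> so large that
  every \<open>\<phi>\<close> has shrunk to a quarter at time \<open>T\<close>, and then \<open>\<epsilon>\<close> so small that every \<open>\<psi>\<close> has
  shrunk to a half (\<open>perturbed_contraction\<close>). Iterating over the periods of length \<open>T\<close> gives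
  exponential decay of \<open>\<psi>\<close> (\<open>geometric_decay\<close>).

  The estimate rests on \<open>c\<^sub>k < 0\<close>, which stability forces: for \<open>c\<^sub>k \<ge> 0\<close> the ray \<open>x + t c\<close> starting
  on the right never comes back (\<open>exponentially_stable_imp_inward\<close>). Velocities are
  \<open>(1 - p) A x + p c\<close> with a weight \<open>p\<close> that is \<open>0\<close> on the left and \<open>1\<close> on the right. Up to
  Lipschitz terms the velocities of \<open>\<phi>\<close> and \<open>\<psi>\<close> differ by \<open>(p - q) (c - A \<phi>)\<close>, where \<open>p\<close> and
  \<open>q\<close> are their weights. The weight is monotone in \<open>x\<^sub>k\<close> and \<open>(c - A \<phi>)\<^sub>k\<close> is negative near the
  origin, so this difference always pulls \<open>\<phi>\<^sub>k\<close> and \<open>\<psi>\<^sub>k\<close> together, at a rate proportional to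
  \<open>|p - q|\<close>. In \<open>|\<phi> - \<psi>| + K |\<phi>\<^sub>k - \<psi>\<^sub>k|\<close> with \<open>K\<close> large this gain outweighs the jump in the
  other components, and Gronwall's inequality applies although the field is discontinuous.

  One obstacle remains: \<open>c' - c\<close> does not become small as \<open>x\<close> approaches \<open>0\<close>. But it only acts
  with weight \<open>q\<close>, and since \<open>\<psi>\<^sub>k\<close> decreases at a rate of at least a multiple of \<open>q\<close>, up to
  \<open>O(|\<psi>|)\<close>, the integral of \<open>q\<close> is itself \<open>O(sup |\<psi>|)\<close>. Adding a small multiple of \<open>\<psi>\<^sub>k\<close> to
  the function above accounts for this.

  Stability also demands that maximal solutions do not stop. A bounded one extends
  continuously to the end of its interval and can be continued from there
  (\<open>maximal_bounded_solution_global\<close>), provided that solutions exist locally. They are written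
  down explicitly (\<open>local_solution_exists\<close>); on the hyperplane \<open>x\<^sub>k = 0\<close> the sign of the first
  nonzero \<open>(A\<^sup>m x)\<^sub>k\<close> decides between the regular flow \<open>e\<^bsup>tA\<^esup> x\<close> and sliding along the hyperplane.
  Conversely, the solution \<open>\<phi>\<close> of the stable system needed for the comparison is obtained by
  extending the trivial solution on \<open>{0}\<close> to a maximal one with Zorn's lemma.
\<close>

section \<open>Absolutely continuous functions\<close>

text \<open>
  The definition of absolute continuity indexes the intervals by an initial segment of the naturals;
  divisions of an interval come as finite sets.
\<close>

lemma abs_continuous_on_finite_sum:
  assumes "abs_continuous_on a b f" "0 < \<epsilon>"
  obtains \<delta> where "0 < \<delta>"
    "\<And>(S::'i set) u v. finite S \<Longrightarrow> (\<And>i. i \<in> S \<Longrightarrow> a \<le> u i \<and> u i \<le> v i \<and> v i \<le> b) \<Longrightarrow>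
       disjoint_family_on (\<lambda>i. {u i<..<v i}) S \<Longrightarrow> (\<Sum>i\<in>S. v i - u i) < \<delta> \<Longrightarrow>
       (\<Sum>i\<in>S. dist (f (u i)) (f (v i))) < \<epsilon>"
proof -
  from assms(1)[unfolded abs_continuous_on_def, rule_format, OF assms(2)]
  obtain \<delta> where "\<delta> > 0" and ex: "\<forall>m u v. (\<forall>i<m::nat. a \<le> u i \<and> u i \<le> v i \<and> v i \<le> b) \<and>
      disjoint_family_on (\<lambda>i. {u i<..<v i}) {..<m} \<and> (\<Sum>i<m. v i - u i) < \<delta> \<longrightarrow>
      (\<Sum>i<m. dist (f (u i)) (f (v i))) < \<epsilon>"
    by auto
  note \<delta> = ex[rule_format, OF conjI, OF _ conjI]
  show ?thesis
  proof (rule that[OF \<open>\<delta> > 0\<close>])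
    fix S :: "'i set" and u v
    assume "finite S" and uv: "\<And>i. i \<in> S \<Longrightarrow> a \<le> u i \<and> u i \<le> v i \<and> v i \<le> b"
      and disj: "disjoint_family_on (\<lambda>i. {u i<..<v i}) S" and less: "(\<Sum>i\<in>S. v i - u i) < \<delta>"
    obtain h where h: "bij_betw h {..<card S} S"
      using ex_bij_betw_nat_finite[OF \<open>finite S\<close>] by (auto simp: atLeast0LessThan)
    have hS: "h i \<in> S" if "i < card S" for i
      using h that by (auto simp: bij_betw_def)
    have "(\<Sum>i<card S. dist (f ((u \<circ> h) i)) (f ((v \<circ> h) i))) < \<epsilon>"
    proof (intro \<delta> allI impI)
      show "a \<le> (u \<circ> h) i \<and> (u \<circ> h) i \<le> (v \<circ> h) i \<and> (v \<circ> h) i \<le> b"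
        if "i < card S" for i using uv hS that by auto
      show "disjoint_family_on (\<lambda>i. {(u \<circ> h) i<..<(v \<circ> h) i}) {..<card S}"
        unfolding disjoint_family_on_def
      proof (intro ballI impI)
        fix i j assume "i \<in> {..<card S}" "j \<in> {..<card S}" "i \<noteq> j"
        then have "h i \<in> S" "h j \<in> S" "h i \<noteq> h j"
          using h by (auto simp: bij_betw_def inj_on_def)
        then show "{(u \<circ> h) i<..<(v \<circ> h) i} \<inter> {(u \<circ> h) j<..<(v \<circ> h) j} = {}"
          using disj unfolding disjoint_family_on_def comp_def by blast
      qed
      show "(\<Sum>i<card S. (v \<circ> h) i - (u \<circ> h) i) < \<delta>"
        using less sum.reindex_bij_betw[OF h, of "\<lambda>i. v i - u i"] by simp
    qed
    then show "(\<Sum>i\<in>S. dist (f (u i)) (f (v i))) < \<epsilon>"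
      using sum.reindex_bij_betw[OF h, of "\<lambda>i. dist (f (u i)) (f (v i))"] by simp
  qed
qed

lemma tagged_division_interval:
  fixes a b :: real
  assumes "p tagged_division_of {a..b}" "(x, K) \<in> p"
  shows "K = {Inf K..Sup K}" "a \<le> Inf K" "Inf K \<le> x" "x \<le> Sup K" "Sup K \<le> b"
proof -
  obtain u v where K: "K = cbox u v" 
    using tagged_division_ofD(4)[OF assms] by blast
  have x: "x \<in> K" and sub: "K \<subseteq> {a..b}"
    using tagged_division_ofD(2,3)[OF assms] by auto
  then have "u \<le> v" using K by auto
  then have "Inf K = u" "Sup K = v" using K by (auto simp: cbox_interval)
  then show "K = {Inf K..Sup K}" "a \<le> Inf K" "Inf K \<le> x" "x \<le> Sup K" "Sup K \<le> b"
    using K x sub \<open>u \<le> v\<close> by (auto simp: cbox_interval)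
qed

text \<open>
  The form of the fundamental theorem on which all estimates for solutions rest. Take a tagged
  division so fine that the intervals tagged in \<open>E\<close> lie in an open set of small measure and that \<open>f\<close>
  is nearly linear around the tags of the others. Absolute continuity bounds the increments over the
  former, the sign of the derivative those over the latter.
\<close>

lemma abs_continuous_on_nonincreasing:
  fixes f :: "real \<Rightarrow> real"
  assumes "a \<le> b" and ac: "abs_continuous_on a b f" and "negligible E"
    and deriv: "\<And>t. t \<in> {a..b} - E \<Longrightarrow> \<exists>D\<le>0. (f has_real_derivative D) (at t within {a..b})"
  shows "f b \<le> f a"
proof (rule field_le_epsilon)
  fix \<epsilon>' :: real assume "\<epsilon>' > 0"
  define \<epsilon> where "\<epsilon> = \<epsilon>' / (1 + (b - a))"
  have "\<epsilon> > 0" 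
    using \<open>\<epsilon>' > 0\<close> \<open>a \<le> b\<close> by (simp add: \<epsilon>_def)
  have "\<epsilon> * (1 + (b - a)) = \<epsilon>'"
    using \<open>a \<le> b\<close> by (simp add: \<epsilon>_def)
  then have \<epsilon>': "\<epsilon> + \<epsilon> * (b - a) = \<epsilon>'" by (simp only: distrib_left mult_1_right)
  obtain \<delta> where "\<delta> > 0" and \<delta>: "\<And>(S::(real \<times> real set) set) u v. finite S \<Longrightarrow>
       (\<And>i. i \<in> S \<Longrightarrow> a \<le> u i \<and> u i \<le> v i \<and> v i \<le> b) \<Longrightarrow>
       disjoint_family_on (\<lambda>i. {u i<..<v i}) S \<Longrightarrow> (\<Sum>i\<in>S. v i - u i) < \<delta> \<Longrightarrow>
       (\<Sum>i\<in>S. dist (f (u i)) (f (v i))) < \<epsilon>"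
    by (rule abs_continuous_on_finite_sum[OF ac \<open>\<epsilon> > 0\<close>]) blast
  obtain U where "open U" "E \<subseteq> U" and Um: "U \<in> lmeasurable" "measure lebesgue U < \<delta>"
  proof -
    have E: "E \<in> sets lebesgue" "E \<in> lmeasurable" "measure lebesgue E = 0"
      using \<open>negligible E\<close> by (auto simp: negligible_iff_measure)
    obtain U where U: "open U" "E \<subseteq> U" "U - E \<in> lmeasurable" "emeasure lebesgue (U - E) < ennreal \<delta>"
      using sets_lebesgue_outer_open[OF E(1) \<open>\<delta> > 0\<close>] by metis
    have "U = (U - E) \<union> E" using U by auto
    then have "U \<in> lmeasurable" using U(3) E(2) by (metis fmeasurable.Un)
    moreover have "measure lebesgue U < \<delta>"
    proof -
      have "measure lebesgue U = measure lebesgue (U - E)"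
        using \<open>negligible E\<close> U(2) E
        by (metis Diff_subset \<open>U = U - E \<union> E\<close> add.right_neutral calculation
            measurable_measure_Diff diff_zero)
      then show ?thesis using U(3,4) \<open>\<delta> > 0\<close>
        by (simp add: emeasure_eq_measure2 ennreal_less_iff)
    qed
    ultimately show ?thesis using U that by blast
  qed
  have "\<exists>d>0. (t \<in> E \<longrightarrow> ball t d \<subseteq> U) \<and>
      (t \<in> {a..b} - E \<longrightarrow> (\<forall>y\<in>{a..b}. y \<in> ball t d \<longrightarrow>
          (t \<le> y \<longrightarrow> f y - f t \<le> \<epsilon> * (y - t)) \<and> (y \<le> t \<longrightarrow> f t - f y \<le> \<epsilon> * (t - y))))" for t
  proof (cases "t \<in> E")
    case True
    then show ?thesis using \<open>open U\<close> \<open>E \<subseteq> U\<close> by (metis DiffD2 open_contains_ball subsetD)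
  next
    case False
    show ?thesis
    proof (cases "t \<in> {a..b}")
      case t: True
      then obtain D where "D \<le> 0" and D: "(f has_real_derivative D) (at t within {a..b})"
        using deriv False by auto
      from D obtain d where "d > 0" and d: "\<And>y. y \<in> {a..b} \<Longrightarrow> norm (y - t) < d \<Longrightarrow>
          norm (f y - f t - D * (y - t)) \<le> \<epsilon> * norm (y - t)"
        using \<open>\<epsilon> > 0\<close> unfolding has_field_derivative_def has_derivative_within_alt
        by (metis mult.commute)
      have "(t \<le> y \<longrightarrow> f y - f t \<le> \<epsilon> * (y - t)) \<and> (y \<le> t \<longrightarrow> f t - f y \<le> \<epsilon> * (t - y))"
        if y: "y \<in> {a..b}" "y \<in> ball t d" for y
      proof -
        have "norm (f y - f t - D * (y - t)) \<le> \<epsilon> * norm (y - t)"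
          using d[OF y(1)] y(2) by (simp add: dist_real_def abs_minus_commute)
        moreover have "D * (y - t) \<le> 0" if "t \<le> y" 
          using that \<open>D \<le> 0\<close> by (simp add: mult_nonpos_nonneg)
        moreover have "0 \<le> D * (y - t)" if "y \<le> t" 
          using that \<open>D \<le> 0\<close> by (simp add: mult_nonpos_nonpos)
        ultimately show ?thesis by (auto simp: abs_le_iff)
      qed
      then show ?thesis using \<open>d > 0\<close> False by blast
    qed (use False in \<open>auto intro: exI[of _ 1]\<close>)
  qed
  then obtain d where d0: "\<And>t. d t > 0" and dE: "\<And>t. t \<in> E \<Longrightarrow> ball t (d t) \<subseteq> U"
    and dR: "\<And>t y. t \<in> {a..b} - E \<Longrightarrow> y \<in> {a..b} \<Longrightarrow> y \<in> ball t (d t) \<Longrightarrow> t \<le> y \<Longrightarrow> 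
            f y - f t \<le> \<epsilon> * (y - t)"
    and dL: "\<And>t y. t \<in> {a..b} - E \<Longrightarrow> y \<in> {a..b} \<Longrightarrow> y \<in> ball t (d t) \<Longrightarrow> y \<le> t \<Longrightarrow> 
            f t - f y \<le> \<epsilon> * (t - y)"
    by metis
  have "gauge (\<lambda>t. ball t (d t))" using d0 by (simp add: gauge_def)
  then obtain p where p: "p tagged_division_of {a..b}" and fine: "(\<lambda>t. ball t (d t)) fine p"
    by (rule fine_division_exists_real)
  note iv = tagged_division_interval[OF p]
  have "finite p" using p by (rule tagged_division_ofD(1))
  define p1 where "p1 = {(x, K) \<in> p. x \<in> E}"
  have p1: "p1 \<subseteq> p" "finite p1" using \<open>finite p\<close> finite_subset[of p1 p] by (auto simp: p1_def)
  define u v :: "real \<times> real set \<Rightarrow> real" where "u = (\<lambda>(x, K). Inf K)" and "v = (\<lambda>(x, K). Sup K)"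
  have uv: "a \<le> u i \<and> u i \<le> v i \<and> v i \<le> b" if "i \<in> p" for i
    using iv(2-5)[of "fst i" "snd i"] that by (simp add: u_def v_def case_prod_unfold)
  have disj: "disjoint_family_on (\<lambda>i. {u i<..<v i}) p"
    unfolding disjoint_family_on_def
  proof (intro ballI impI)
    fix i j assume ij: "i \<in> p" "j \<in> p" "i \<noteq> j"
    obtain x K y L where [simp]: "i = (x, K)" "j = (y, L)" by (cases i, cases j)
    have "interior K \<inter> interior L = {}"
      using tagged_division_ofD(5)[OF p, of x K y L] ij by auto
    moreover have "interior K = {Inf K<..<Sup K}" "interior L = {Inf L<..<Sup L}"
      using trans[OF arg_cong[OF iv(1), of _ _ interior] interior_atLeastAtMost_real] ij by auto
    ultimately show "{u i<..<v i} \<inter> {u j<..<v j} = {}" by (simp add: u_def v_def)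
  qed
  have "(\<Sum>i\<in>p1. v i - u i) = (\<Sum>i\<in>p1. measure lebesgue {u i<..<v i})"
    using uv p1 by (intro sum.cong) auto
  also have "\<dots> = measure lebesgue (\<Union>i\<in>p1. {u i<..<v i})"
  proof (rule measure_finite_Union[symmetric])
    show "disjoint_family_on (\<lambda>i. {u i<..<v i}) p1"
      using disj p1 by (meson disjoint_family_on_mono)
    show "emeasure lebesgue {u i<..<v i} \<noteq> \<infinity>" for i
      by (cases "u i \<le> v i") auto
  qed (use p1 in auto)
  also have "\<dots> \<le> measure lebesgue U"
  proof (rule measure_mono_fmeasurable[OF _ _ Um(1)])
    show "(\<Union>i\<in>p1. {u i<..<v i}) \<subseteq> U"
    proof safe
      fix x K s assume "(x, K) \<in> p1" and s: "s \<in> {u (x, K)<..<v (x, K)}"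
      then have "x \<in> E" "K \<subseteq> ball x (d x)" "(x, K) \<in> p"
        using fine by (auto simp: p1_def fine_def)
      moreover have "s \<in> {Inf K..Sup K}" using s by (simp add: u_def v_def)
      then have "s \<in> K" using iv(1)[OF \<open>(x, K) \<in> p\<close>] by (rule back_subst[of "\<lambda>K. s \<in> K", OF _ sym])
      ultimately show "s \<in> U" using dE by blast
    qed
  qed (use p1 in auto)
  finally have "(\<Sum>i\<in>p1. v i - u i) < \<delta>" using Um by simp
  then have sum1: "(\<Sum>i\<in>p1. dist (f (u i)) (f (v i))) < \<epsilon>"
    using p1 uv disj by (intro \<delta>) (auto intro: disjoint_family_on_mono)
  have "f b - f a = (\<Sum>i\<in>p. f (v i) - f (u i))"
    using additive_tagged_division_1[OF \<open>a \<le> b\<close> p, of f] by (simp add: u_def v_def case_prod_unfold)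
  also have "\<dots> = (\<Sum>i\<in>p1. f (v i) - f (u i)) + (\<Sum>i\<in>p - p1. f (v i) - f (u i))"
    using sum.subset_diff[OF p1(1) \<open>finite p\<close>, of "\<lambda>i. f (v i) - f (u i)"] by simp
  also have "(\<Sum>i\<in>p1. f (v i) - f (u i)) \<le> (\<Sum>i\<in>p1. dist (f (u i)) (f (v i)))"
    by (intro sum_mono) (auto simp: dist_real_def)
  also have "(\<Sum>i\<in>p - p1. f (v i) - f (u i)) \<le> (\<Sum>i\<in>p - p1. \<epsilon> * (v i - u i))"
  proof (intro sum_mono)
    fix i assume i: "i \<in> p - p1"
    obtain x K where [simp]: "i = (x, K)" by (cases i)
    have xK: "(x, K) \<in> p" and "x \<notin> E" using i by (auto simp: p1_def)
    have "K \<subseteq> ball x (d x)" using fine xK by (auto simp: fine_def)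
    moreover have "Inf K \<in> K" "Sup K \<in> K" 
      using back_subst[of "\<lambda>K'. Inf K \<in> K'", OF _ sym, OF _ iv(1)[OF xK]]
        back_subst[of "\<lambda>K'. Sup K \<in> K'", OF _ sym, OF _ iv(1)[OF xK]] iv(3,4)[OF xK] by simp_all
    moreover have "x \<in> {a..b} - E" "Inf K \<in> {a..b}" "Sup K \<in> {a..b}"
      using iv[OF xK] \<open>x \<notin> E\<close> by auto
    ultimately have "f (Sup K) - f x \<le> \<epsilon> * (Sup K - x)" "f x - f (Inf K) \<le> \<epsilon> * (x - Inf K)"
      using dR[of x "Sup K"] dL[of x "Inf K"] iv[OF xK] by auto
    then show "f (v i) - f (u i) \<le> \<epsilon> * (v i - u i)"
      by (simp add: u_def v_def algebra_simps)
  qed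
  also have "\<dots> \<le> (\<Sum>i\<in>p. \<epsilon> * (v i - u i))"
    using uv \<open>\<epsilon> > 0\<close> \<open>finite p\<close> by (intro sum_mono2) auto
  also have "\<dots> = \<epsilon> * (b - a)"
    using additive_tagged_division_1[OF \<open>a \<le> b\<close> p, of "\<lambda>x. x"]
    by (simp add: u_def v_def case_prod_unfold sum_distrib_left[symmetric])
  finally show "f b \<le> f a + \<epsilon>'" using sum1 \<epsilon>' by linarith
qed

text \<open>
  One closure property that covers sums, products of bounded functions and Lipschitz functions of
  absolutely continuous ones.
\<close>

lemma abs_continuous_on_dominated:
  assumes f: "abs_continuous_on a b f" and g: "abs_continuous_on a b g"
    and dom: "\<And>s t. s \<in> {a..b} \<Longrightarrow> t \<in> {a..b} \<Longrightarrow>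
      dist (h s) (h t) \<le> L * (dist (f s) (f t) + dist (g s) (g t))"
  shows "abs_continuous_on a b h"
  unfolding abs_continuous_on_def
proof (intro allI impI)
  fix \<epsilon> :: real assume "\<epsilon> > 0"
  define L' where "L' = \<bar>L\<bar> + 1"
  have "L' > 0" "L \<le> L'" by (auto simp: L'_def)
  have e: "\<epsilon> / (2 * L') > 0" using \<open>\<epsilon> > 0\<close> \<open>L' > 0\<close> by simp
  from f[unfolded abs_continuous_on_def, rule_format, OF e]
  obtain \<delta>1 where "\<delta>1 > 0" and 1: "\<forall>(m::nat) u v. (\<forall>i<m. a \<le> u i \<and> u i \<le> v i \<and> v i \<le> b) \<and>
      disjoint_family_on (\<lambda>i. {u i<..<v i}) {..<m} \<and> (\<Sum>i<m. v i - u i) < \<delta>1 \<longrightarrow>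
      (\<Sum>i<m. dist (f (u i)) (f (v i))) < \<epsilon> / (2 * L')" by auto
  from g[unfolded abs_continuous_on_def, rule_format, OF e]
  obtain \<delta>2 where "\<delta>2 > 0" and 2: "\<forall>(m::nat) u v. (\<forall>i<m. a \<le> u i \<and> u i \<le> v i \<and> v i \<le> b) \<and>
      disjoint_family_on (\<lambda>i. {u i<..<v i}) {..<m} \<and> (\<Sum>i<m. v i - u i) < \<delta>2 \<longrightarrow>
      (\<Sum>i<m. dist (g (u i)) (g (v i))) < \<epsilon> / (2 * L')" by auto
  show "\<exists>\<delta>>0. \<forall>(m::nat) u v. (\<forall>i<m. a \<le> u i \<and> u i \<le> v i \<and> v i \<le> b) \<and>
      disjoint_family_on (\<lambda>i. {u i<..<v i}) {..<m} \<and> (\<Sum>i<m. v i - u i) < \<delta> \<longrightarrow>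
      (\<Sum>i<m. dist (h (u i)) (h (v i))) < \<epsilon>"
  proof (intro exI[of _ "min \<delta>1 \<delta>2"] conjI allI impI)
    fix m :: nat and u v :: "nat \<Rightarrow> real"
    assume *: "(\<forall>i<m. a \<le> u i \<and> u i \<le> v i \<and> v i \<le> b) \<and>
      disjoint_family_on (\<lambda>i. {u i<..<v i}) {..<m} \<and> (\<Sum>i<m. v i - u i) < min \<delta>1 \<delta>2"
    have "(\<Sum>i<m. dist (h (u i)) (h (v i))) \<le>
        (\<Sum>i<m. L' * (dist (f (u i)) (f (v i)) + dist (g (u i)) (g (v i))))"
    proof (intro sum_mono)
      fix i assume "i \<in> {..<m}"
      then have "u i \<in> {a..b}" "v i \<in> {a..b}" using * by force+
      from dom[OF this] \<open>L \<le> L'\<close>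
      show "dist (h (u i)) (h (v i)) \<le> L' * (dist (f (u i)) (f (v i)) + dist (g (u i)) (g (v i)))"
        by (rule order_trans[OF _ mult_right_mono]) auto
    qed
    also have "\<dots> = L' * ((\<Sum>i<m. dist (f (u i)) (f (v i))) + (\<Sum>i<m. dist (g (u i)) (g (v i))))"
      by (simp add: sum_distrib_left[symmetric] sum.distrib)
    also have "\<dots> < L' * (\<epsilon> / (2 * L') + \<epsilon> / (2 * L'))"
      using 1 2 * \<open>L' > 0\<close> by (intro mult_strict_left_mono add_strict_mono) auto
    also have "\<dots> = \<epsilon>" using \<open>L' > 0\<close> by (simp add: field_simps)
    finally show "(\<Sum>i<m. dist (h (u i)) (h (v i))) < \<epsilon>" .
  qed (use \<open>\<delta>1 > 0\<close> \<open>\<delta>2 > 0\<close> in auto)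
qed

lemma abs_continuous_on_ident: "abs_continuous_on a b (\<lambda>t::real. t)"
  unfolding abs_continuous_on_def
proof (intro allI impI)
  fix \<epsilon> :: real assume "\<epsilon> > 0"
  have "(\<Sum>i<m. dist (u i) (v i)) < \<epsilon>"
    if "\<forall>i<m. a \<le> u i \<and> u i \<le> v i \<and> v i \<le> b" "(\<Sum>i<m. v i - u i) < \<epsilon>" for m :: nat and u v
  proof -
    have "(\<Sum>i<m. dist (u i) (v i)) = (\<Sum>i<m. v i - u i)"
      using that(1) by (intro sum.cong) (auto simp: dist_real_def)
    then show ?thesis using that by simp
  qed
  then show "\<exists>\<delta>>0. \<forall>(m::nat) u v. (\<forall>i<m. a \<le> u i \<and> u i \<le> v i \<and> v i \<le> b) \<and>
      disjoint_family_on (\<lambda>i. {u i<..<v i}) {..<m} \<and> (\<Sum>i<m. v i - u i) < \<delta> \<longrightarrow>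
      (\<Sum>i<m. dist (u i) (v i)) < \<epsilon>"
    using \<open>\<epsilon> > 0\<close> by blast
qed

lemma lipschitz_imp_abs_continuous_on:
  assumes "L-lipschitz_on {a..b} f"
  shows "abs_continuous_on a b f"
proof (rule abs_continuous_on_dominated[OF abs_continuous_on_ident abs_continuous_on_ident])
  show "dist (f s) (f t) \<le> L * (dist s t + dist s t)" if "s \<in> {a..b}" "t \<in> {a..b}" for s t
  proof -
    have "dist (f s) (f t) \<le> L * dist s t" using lipschitz_onD[OF assms] that .
    also have "\<dots> \<le> L * (dist s t + dist s t)"
      using lipschitz_on_nonneg[OF assms] by (intro mult_left_mono) auto
    finally show ?thesis .
  qed
qed

lemma abs_continuous_on_subinterval:
  assumes "abs_continuous_on a b f" "a \<le> c" "d \<le> b"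
  shows "abs_continuous_on c d f"
  unfolding abs_continuous_on_def
proof (intro allI impI)
  fix \<epsilon> :: real assume "\<epsilon> > 0"
  from assms(1)[unfolded abs_continuous_on_def, rule_format, OF this]
  obtain \<delta> where "\<delta> > 0" and \<delta>: "\<forall>(m::nat) u v. (\<forall>i<m. a \<le> u i \<and> u i \<le> v i \<and> v i \<le> b) \<and>
      disjoint_family_on (\<lambda>i. {u i<..<v i}) {..<m} \<and> (\<Sum>i<m. v i - u i) < \<delta> \<longrightarrow>
      (\<Sum>i<m. dist (f (u i)) (f (v i))) < \<epsilon>" by auto
  show "\<exists>\<delta>>0. \<forall>(m::nat) u v. (\<forall>i<m. c \<le> u i \<and> u i \<le> v i \<and> v i \<le> d) \<and>
      disjoint_family_on (\<lambda>i. {u i<..<v i}) {..<m} \<and> (\<Sum>i<m. v i - u i) < \<delta> \<longrightarrow>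
      (\<Sum>i<m. dist (f (u i)) (f (v i))) < \<epsilon>"
  proof (intro exI[of _ \<delta>] conjI allI impI \<delta>[rule_format])
    fix m :: nat and u v :: "nat \<Rightarrow> real" and i
    assume "(\<forall>i<m. c \<le> u i \<and> u i \<le> v i \<and> v i \<le> d) \<and>
      disjoint_family_on (\<lambda>i. {u i<..<v i}) {..<m} \<and> (\<Sum>i<m. v i - u i) < \<delta>" "i < m"
    then show "a \<le> u i" "v i \<le> b" using assms(2,3) by force+
  qed (use \<open>\<delta> > 0\<close> in auto)
qed

lemma abs_continuous_on_imp_continuous_on:
  assumes "abs_continuous_on a b f"
  shows "continuous_on {a..b} f"
  unfolding continuous_on_iff
proof (intro ballI allI impI)
  fix t \<epsilon> :: real assume t: "t \<in> {a..b}" and "0 < \<epsilon>"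
  from assms[unfolded abs_continuous_on_def, rule_format, OF \<open>0 < \<epsilon>\<close>]
  obtain \<delta> where "\<delta> > 0" and \<delta>: "\<forall>(m::nat) u v. (\<forall>i<m. a \<le> u i \<and> u i \<le> v i \<and> v i \<le> b) \<and>
      disjoint_family_on (\<lambda>i. {u i<..<v i}) {..<m} \<and> (\<Sum>i<m. v i - u i) < \<delta> \<longrightarrow>
      (\<Sum>i<m. dist (f (u i)) (f (v i))) < \<epsilon>" by auto
  have *: "dist (f u) (f v) < \<epsilon>" if "u \<in> {a..b}" "v \<in> {a..b}" "u \<le> v" "v - u < \<delta>" for u v
    using \<delta>[rule_format, of 1 "\<lambda>_. u" "\<lambda>_. v"] that by (auto simp: disjoint_family_on_def)
  have "dist (f s) (f t) < \<epsilon>" if "s \<in> {a..b}" "dist s t < \<delta>" for s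
    using *[of s t] *[of t s] t that by (cases "s \<le> t") (auto simp: dist_real_def dist_commute)
  then show "\<exists>d>0. \<forall>s\<in>{a..b}. dist s t < d \<longrightarrow> dist (f s) (f t) < \<epsilon>"
    using \<open>\<delta> > 0\<close> by (intro exI[of _ \<delta>]) simp
qed

text \<open>
  The function \<open>exp (- L (t - a)) f t - m (t - a)\<close> has nonpositive derivative outside \<open>E\<close>.
\<close>

lemma abs_continuous_on_gronwall:
  fixes f :: "real \<Rightarrow> real"
  assumes "a \<le> b" and ac: "abs_continuous_on a b f" and "negligible E" and "0 \<le> L" "0 \<le> m"
    and deriv: "\<And>t. t \<in> {a..b} - E \<Longrightarrow>
      \<exists>D. (f has_real_derivative D) (at t within {a..b}) \<and> D \<le> L * f t + m"
  shows "f b \<le> exp (L * (b - a)) * (f a + m * (b - a))"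
proof -
  define g where "g = (\<lambda>t. exp (- L * (t - a)) * f t - m * (t - a))"
  have "continuous_on {a..b} f" using ac by (rule abs_continuous_on_imp_continuous_on)
  then have "bounded (f ` {a..b})" 
    by (intro compact_imp_bounded compact_continuous_image) auto
  then obtain B where "\<forall>x\<in>f ` {a..b}. norm x \<le> B"
    unfolding bounded_iff by blast
  then have B: "\<bar>f t\<bar> \<le> B" if "t \<in> {a..b}" for t
    using that by auto
  have "0 \<le> B" using B[of a] \<open>a \<le> b\<close> by auto
  have exp_le1: "exp (- L * (t - a)) \<le> 1" if "t \<in> {a..b}" for t
    using that \<open>0 \<le> L\<close> by simp
  have exp_lip: "\<bar>exp (- L * (s - a)) - exp (- L * (t - a))\<bar> \<le> L * \<bar>s - t\<bar>"
    if "s \<in> {a..b}" "t \<in> {a..b}" for s t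
  proof -
    have "norm (exp (- L * (s - a)) - exp (- L * (t - a))) \<le> L * norm (s - t)"
    proof (rule field_differentiable_bound[of "{a..b}"])
      fix z assume z: "z \<in> {a..b}"
      show "((\<lambda>t. exp (- L * (t - a))) has_field_derivative (- L * exp (- L * (z - a)))) (at z within {a..b})"
        by (auto intro!: derivative_eq_intros)
      show "norm (- L * exp (- L * (z - a))) \<le> L"
        using exp_le1[OF z] \<open>0 \<le> L\<close> mult_left_le[of "exp (- L * (z - a))" L] by (simp add: abs_mult)
    qed (use that in auto)
    then show ?thesis by simp
  qed
  have "g b \<le> g a"
  proof (rule abs_continuous_on_nonincreasing[OF \<open>a \<le> b\<close> _ \<open>negligible E\<close>])
    show "abs_continuous_on a b g"
    proof (rule abs_continuous_on_dominated[OF ac abs_continuous_on_ident])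
      fix s t assume st: "s \<in> {a..b}" "t \<in> {a..b}"
      have "g s - g t = (exp (- L * (s - a)) - exp (- L * (t - a))) * f s
          + exp (- L * (t - a)) * (f s - f t) - m * (s - t)"
        by (simp add: g_def algebra_simps)
      also have "\<bar>\<dots>\<bar> \<le> \<bar>(exp (- L * (s - a)) - exp (- L * (t - a))) * f s\<bar>
          + \<bar>exp (- L * (t - a)) * (f s - f t)\<bar> + \<bar>m * (s - t)\<bar>" by linarith
      also have "\<dots> \<le> (L * \<bar>s - t\<bar>) * B + 1 * \<bar>f s - f t\<bar> + m * \<bar>s - t\<bar>"
        unfolding abs_mult using exp_lip[OF st] exp_le1[OF st(2)] B[OF st(1)] \<open>0 \<le> L\<close> \<open>0 \<le> m\<close>
        by (intro add_mono mult_mono) auto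
      also have "\<dots> \<le> (L * B + 1 + m) * (\<bar>f s - f t\<bar> + \<bar>s - t\<bar>)"
        using \<open>0 \<le> L\<close> \<open>0 \<le> m\<close> \<open>0 \<le> B\<close> by (simp add: algebra_simps)
      finally show "dist (g s) (g t) \<le> (L * B + 1 + m) * (dist (f s) (f t) + dist s t)"
        by (simp add: dist_real_def)
    qed
  next
    fix t assume t: "t \<in> {a..b} - E"
    then obtain D where D: "(f has_real_derivative D) (at t within {a..b})" "D \<le> L * f t + m"
      using deriv by blast
    define e where "e = exp (- L * (t - a))"
    have "e \<le> 1" "0 < e" using exp_le1 t by (auto simp: e_def)
    have "(g has_real_derivative (e * D - L * e * f t - m)) (at t within {a..b})"
      unfolding g_def e_def using D(1) by (auto intro!: derivative_eq_intros simp: algebra_simps)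
    moreover have "e * D \<le> e * (L * f t + m)" using D(2) \<open>0 < e\<close> by simp
    moreover have "e * m \<le> m" using \<open>e \<le> 1\<close> \<open>0 \<le> m\<close> by (simp add: mult_left_le_one_le \<open>0 < e\<close> less_imp_le)
    ultimately show "\<exists>D\<le>0. (g has_real_derivative D) (at t within {a..b})"
      by (intro exI[of _ "e * D - L * e * f t - m"]) (simp add: algebra_simps)
  qed
  then have "exp (- L * (b - a)) * f b \<le> f a + m * (b - a)" by (simp add: g_def)
  then have "exp (L * (b - a)) * (exp (- L * (b - a)) * f b) \<le> exp (L * (b - a)) * (f a + m * (b - a))"
    by simp
  then show ?thesis by (simp add: mult.assoc[symmetric] exp_add[symmetric])
qed

text \<open>
  Apply the scalar monotonicity statement to the component of \<open>f\<close> in the direction of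
  \<open>f b - f a\<close>.
\<close>

lemma abs_continuous_on_increment_le:
  fixes f :: "real \<Rightarrow> 'a::euclidean_space"
  assumes "a \<le> b" and ac: "abs_continuous_on a b f" and "negligible E"
    and deriv: "\<And>t. t \<in> {a..b} - E \<Longrightarrow>
      \<exists>v. (f has_vector_derivative v) (at t within {a..b}) \<and> norm v \<le> M"
  shows "norm (f b - f a) \<le> M * (b - a)"
proof -
  define z where "z = f b - f a"
  define g where "g = (\<lambda>t. z \<bullet> f t - norm z * M * t)"
  have "g b \<le> g a"
  proof (rule abs_continuous_on_nonincreasing[OF \<open>a \<le> b\<close> _ \<open>negligible E\<close>])
    show "abs_continuous_on a b g"
    proof (rule abs_continuous_on_dominated[OF ac abs_continuous_on_ident])
      fix s t assume "s \<in> {a..b}" "t \<in> {a..b}"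
      have "g s - g t = z \<bullet> (f s - f t) - norm z * M * (s - t)"
        by (simp add: g_def algebra_simps)
      also have "\<bar>\<dots>\<bar> \<le> \<bar>z \<bullet> (f s - f t)\<bar> + \<bar>norm z * M * (s - t)\<bar>" by linarith
      also have "\<dots> \<le> norm z * norm (f s - f t) + norm z * \<bar>M\<bar> * \<bar>s - t\<bar>"
        using Cauchy_Schwarz_ineq2[of z "f s - f t"] by (simp add: abs_mult)
      also have "\<dots> \<le> (norm z + norm z * \<bar>M\<bar>) * (norm (f s - f t) + \<bar>s - t\<bar>)"
        by (simp add: algebra_simps)
      finally show "dist (g s) (g t) \<le> (norm z + norm z * \<bar>M\<bar>) * (dist (f s) (f t) + dist s t)"
        by (simp add: dist_real_def dist_norm)
    qed
  next
    fix t assume "t \<in> {a..b} - E"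
    then obtain v where v: "(f has_vector_derivative v) (at t within {a..b})" "norm v \<le> M"
      using deriv by blast
    have "((\<lambda>t. z \<bullet> f t) has_vector_derivative z \<bullet> v) (at t within {a..b})"
      by (rule bounded_linear.has_vector_derivative[OF bounded_linear_inner_right v(1)])
    then have "(g has_real_derivative (z \<bullet> v - norm z * M)) (at t within {a..b})"
      unfolding g_def has_real_derivative_iff_has_vector_derivative[symmetric]
      by (auto intro!: derivative_eq_intros)
    moreover have "z \<bullet> v \<le> norm z * M"
      using norm_cauchy_schwarz[of z v] mult_left_mono[OF v(2), of "norm z"] by simp
    ultimately show "\<exists>D\<le>0. (g has_real_derivative D) (at t within {a..b})"
      by (intro exI[of _ "z \<bullet> v - norm z * M"]) auto
  qed
  then have "z \<bullet> z \<le> norm z * (M * (b - a))"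
    by (simp add: g_def z_def algebra_simps)
  then have "norm z * norm z \<le> norm z * (M * (b - a))"
    by (simp add: dot_square_norm power2_eq_square)
  moreover have "0 \<le> M * (b - a)"
  proof (cases "a = b")
    case False
    have "\<not> {a..b} \<subseteq> E"
      using \<open>negligible E\<close> False \<open>a \<le> b\<close> negligible_subset[of E "{a..b}"] 
        negligible_interval(1)[of a b] by auto
    then obtain t where "t \<in> {a..b} - E" by blast
    then have "0 \<le> M" using deriv norm_ge_zero order_trans by metis
    then show ?thesis using \<open>a \<le> b\<close> by simp
  qed simp
  ultimately show ?thesis unfolding z_def[symmetric]
    by (cases "z = 0") auto
qed

text \<open>
  Zeros with nonzero derivative are isolated. Hence a function that is differentiable almost
  everywhere has derivative \<open>0\<close> at almost all of its zeros. So at almost every time at which two solutions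
  agree in the \<open>k\<close>-th component, their velocities do as well.
\<close>

lemma countable_nonstationary_zeros:
  fixes f :: "real \<Rightarrow> real"
  shows "countable {t\<in>S. f t = 0 \<and> (\<exists>D. D \<noteq> 0 \<and> (f has_real_derivative D) (at t within S))}"
    (is "countable ?Z")
proof -
  define Z where "Z = ?Z"
  obtain \<B> :: "real set set" where "countable \<B>" and basis: "topological_basis \<B>"
    using ex_countable_basis by auto
  have "\<exists>U. U \<in> \<B> \<and> t \<in> U \<and> Z \<inter> U = {t}" if "t \<in> Z" for t
  proof -
    from that obtain D where "t \<in> S" "f t = 0" "D \<noteq> 0" and D: "(f has_real_derivative D) (at t within S)"
      unfolding Z_def by blast
    have "((\<lambda>s. (f s - f t) / (s - t)) \<longlongrightarrow> D) (at t within S)"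
      using D by (simp add: has_field_derivative_iff)
    then have "eventually (\<lambda>s. (f s - f t) / (s - t) \<noteq> 0) (at t within S)"
      using \<open>D \<noteq> 0\<close> by (rule tendsto_imp_eventually_ne)
    then obtain V where V: "open V" "t \<in> V"
      and ne: "\<forall>s\<in>V. s \<noteq> t \<longrightarrow> s \<in> S \<longrightarrow> (f s - f t) / (s - t) \<noteq> 0"
      unfolding eventually_at_topological by blast
    have V0: "f s \<noteq> 0" if "s \<in> V" "s \<in> S" "s \<noteq> t" for s
      using ne[rule_format, OF that(1,3,2)] \<open>f t = 0\<close> by auto
    from basis V(1,2) obtain U where "U \<in> \<B>" "t \<in> U" "U \<subseteq> V" 
      by (rule topological_basisE)
    have "Z \<inter> U = {t}"
    proof (intro equalityI subsetI)
      fix s assume "s \<in> Z \<inter> U"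
      then show "s \<in> {t}" using V0[of s] \<open>U \<subseteq> V\<close> by (auto simp: Z_def)
    qed (use that \<open>t \<in> U\<close> in simp)
    with \<open>U \<in> \<B>\<close> \<open>t \<in> U\<close> show ?thesis by (intro exI[of _ U] conjI)
  qed
  then have "\<forall>t\<in>Z. \<exists>U. U \<in> \<B> \<and> t \<in> U \<and> Z \<inter> U = {t}" by (rule ballI)
  from bchoice[OF this] obtain U where U: "\<forall>t\<in>Z. U t \<in> \<B> \<and> t \<in> U t \<and> Z \<inter> U t = {t}"
    by (rule exE)
  have "inj_on U Z"
  proof (rule inj_onI)
    fix s t assume "s \<in> Z" "t \<in> Z" and eq: "U s = U t"
    have "{s} = Z \<inter> U s"
      using bspec[OF U \<open>s \<in> Z\<close>] by (elim conjE) (rule sym)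
    also have "\<dots> = {t}"
      using bspec[OF U \<open>t \<in> Z\<close>] unfolding eq by (elim conjE)
    finally show "s = t" by simp
  qed
  moreover have "countable (U ` Z)"
  proof (rule countable_subset[OF _ \<open>countable \<B>\<close>])
    show "U ` Z \<subseteq> \<B>" using U by (auto simp only: image_subset_iff)
  qed
  ultimately show ?thesis unfolding Z_def[symmetric] by (rule countable_image_inj_on[rotated])
qed

section \<open>Norms and the Filippov set of the piecewise field\<close>

text \<open>
  All norms on a finite-dimensional space are equivalent; the estimates below use the Euclidean norm.
\<close>

lemma is_norm_equivalent:
  fixes N :: "real^'n \<Rightarrow> real"
  assumes "is_norm N"
  obtains m M where "0 < m" "0 < M" "\<And>x. m * norm x \<le> N x" "\<And>x. N x \<le> M * norm x"
proof -
  have zero: "N x = 0 \<longleftrightarrow> x = 0" and scale: "N (r *\<^sub>R x) = \<bar>r\<bar> * N x"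
    and triangle: "N (x + y) \<le> N x + N y" for x y r
    using assms unfolding is_norm_def by blast+
  have N0: "N 0 = 0" using zero by blast
  have minus: "N (- x) = N x" for x using scale[of "-1" x] by simp
  have nonneg: "0 \<le> N x" for x
    using triangle[of x "- x"] by (simp add: minus N0)
  have sum_le: "N (sum f S) \<le> (\<Sum>i\<in>S. N (f i))" if "finite S" for f and S :: "'n set"
    using that
  proof (induction S)
    case (insert i S)
    then show ?case using triangle[of "f i" "sum f S"] by simp
  qed (simp add: N0)
  define M where "M = (\<Sum>i\<in>UNIV. N (axis i 1)) + 1"
  have "0 < M" using nonneg by (simp add: M_def sum_nonneg add_nonneg_pos)
  have upper: "N x \<le> M * norm x" for x
  proof -
    have "N x = N (\<Sum>i\<in>UNIV. x $ i *\<^sub>R axis i 1)"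
      using basis_expansion[of x] by (simp add: scalar_mult_eq_scaleR)
    also have "\<dots> \<le> (\<Sum>i\<in>UNIV. \<bar>x $ i\<bar> * N (axis i 1))"
      using sum_le[of UNIV "\<lambda>i. x $ i *\<^sub>R axis i 1"] by (simp add: scale)
    also have "\<dots> \<le> (\<Sum>i\<in>UNIV. norm x * N (axis i 1))"
      by (intro sum_mono mult_right_mono component_le_norm_cart nonneg)
    also have "\<dots> \<le> M * norm x"
      by (simp add: M_def sum_distrib_left[symmetric] algebra_simps)
    finally show ?thesis .
  qed
  have "M-lipschitz_on (sphere 0 1) N"
  proof (rule lipschitz_onI)
    fix x y
    have "\<bar>N x - N y\<bar> \<le> N (x - y)"
      using triangle[of y "x - y"] triangle[of x "y - x"] minus[of "x - y"] by simp
    then show "dist (N x) (N y) \<le> M * dist x y"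
      using upper[of "x - y"] by (simp add: dist_real_def dist_norm)
  qed (use \<open>0 < M\<close> in simp)
  then have "continuous_on (sphere 0 1) N" by (rule lipschitz_on_continuous_on)
  moreover have "axis undefined 1 \<in> (sphere 0 1 :: (real^'n) set)" by simp
  ultimately obtain z where z: "z \<in> sphere 0 1" "\<And>x. x \<in> sphere 0 1 \<Longrightarrow> N z \<le> N x"
    using continuous_attains_inf[of "sphere 0 1" N] by (metis compact_sphere empty_iff)
  have "z \<noteq> 0" using z(1) by auto
  then have "0 < N z" using nonneg[of z] zero[of z] by simp
  moreover have "N z * norm x \<le> N x" for x
  proof (cases "x = 0")
    case False
    then have "N z \<le> N ((1 / norm x) *\<^sub>R x)" by (intro z(2)) simp
    then show ?thesis using False by (simp add: scale field_simps)
  qed (simp add: N0)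
  ultimately show ?thesis using that \<open>0 < M\<close> upper by blast
qed

lemma induced_norm_bound:
  fixes N :: "real^'n \<Rightarrow> real"
  assumes "is_norm N"
  shows "N (B *v x) \<le> induced_norm N B * N x"
proof -
  obtain m M where mM: "0 < m" "0 < M" "\<And>x. m * norm x \<le> N x" "\<And>x. N x \<le> M * norm x"
    by (rule is_norm_equivalent[OF assms]) (rule that)
  obtain K where K: "\<And>x. norm (B *v x) \<le> norm x * K" "0 < K"
    using bounded_linear.pos_bounded[OF matrix_vector_mul_bounded_linear[of B]] by metis
  have pos: "0 < N x" if "x \<noteq> 0" for x
    using mM(1) mM(3)[of x] that by (metis mult_pos_pos zero_less_norm_iff order_less_le_trans)
  have N0: "N 0 = 0" using assms unfolding is_norm_def by blast
  have "N (B *v x) / N x \<le> M * K / m" for x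
  proof (cases "x = 0")
    case False
    have "N (B *v x) \<le> M * (norm x * K)"
      using mM(4)[of "B *v x"] mult_left_mono[OF K(1)[of x], of M] mM(2) by linarith
    also have "\<dots> = M * K / m * (m * norm x)" using mM by simp
    also have "\<dots> \<le> M * K / m * N x" using mM K by (intro mult_left_mono) auto
    finally show ?thesis using pos[OF False] by (simp add: divide_le_eq)
  qed (use mM K N0 in simp)
  then have "bdd_above (range (\<lambda>x. N (B *v x) / N x))" by (intro bdd_aboveI2)
  then have "N (B *v x) / N x \<le> induced_norm N B"
    unfolding induced_norm_def by (rule cSUP_upper[rotated]) simp
  then show ?thesis
    using pos[of x] N0 by (cases "x = 0") (simp_all add: divide_le_eq)
qed

text \<open>
  The explicit form of the Filippov map. It is parametrised by the weight of \<open>c\<close>, because the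
  comparison of two solutions compares their weights.
\<close>

definition filippov_set :: "'n \<Rightarrow> real^'n^'n \<Rightarrow> real^'n \<Rightarrow> real^'n \<Rightarrow> (real^'n) set" where
  "filippov_set k A c x = {(1 - w) *\<^sub>R (A *v x) + w *\<^sub>R c | w.
     0 \<le> w \<and> w \<le> 1 \<and> (x $ k < 0 \<longrightarrow> w = 0) \<and> (0 < x $ k \<longrightarrow> w = 1)}"

lemma filippov_set_alt:
  "filippov_set k A c x =
     (if x $ k < 0 then {A *v x} else if 0 < x $ k then {c} else closed_segment (A *v x) c)"
proof (cases "x $ k" "0 :: real" rule: linorder_cases)
  case less
  then have "(0 \<le> w \<and> w \<le> 1 \<and> (x $ k < 0 \<longrightarrow> w = 0) \<and> (0 < x $ k \<longrightarrow> w = 1)) \<longleftrightarrow> w = 0" for w :: real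
    by auto
  with less show ?thesis unfolding filippov_set_def by simp
next
  case greater
  then have "(0 \<le> w \<and> w \<le> 1 \<and> (x $ k < 0 \<longrightarrow> w = 0) \<and> (0 < x $ k \<longrightarrow> w = 1)) \<longleftrightarrow> w = 1" for w :: real
    by auto
  with greater show ?thesis unfolding filippov_set_def by simp
qed (simp add: filippov_set_def closed_segment_def)

text \<open>
  Inclusion from left to right: the values of the field near \<open>x\<close> lie in a closed \<open>\<eta>\<close>-neighbourhood
  of the compact convex right-hand side. From right to left: \<open>A x\<close> and \<open>c\<close> are limits of values taken
  at points moved off the hyperplane in direction \<open>k\<close>.
\<close>

lemma filippov_map_eq:
  fixes N :: "real^'n \<Rightarrow> real"
  assumes "is_norm N"
  shows "filippov_map N k (pw_field k A c) x = filippov_set k A c x"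
proof -
  obtain m M where mM: "0 < m" "0 < M" "\<And>x. m * norm x \<le> N x" "\<And>x. N x \<le> M * norm x"
    by (rule is_norm_equivalent[OF assms]) (rule that)
  let ?F = "pw_field k A c"
  let ?C = "\<lambda>\<delta>. (\<lambda>S. closed S \<and> convex S) hull (?F ` (norm_ball N x \<delta> - {y. y $ k = 0}))"
  have C: "closed (?C \<delta>) \<and> convex (?C \<delta>)" for \<delta>
    by (rule hull_in) (auto intro: closed_Inter convex_Inter)
  have sub: "?F ` (norm_ball N x \<delta> - {y. y $ k = 0}) \<subseteq> ?C \<delta>" for \<delta>
    by (rule hull_subset)
  have compact: "compact (filippov_set k A c x)" and conv: "convex (filippov_set k A c x)"
    by (auto simp: filippov_set_alt)
  have ne: "filippov_set k A c x \<noteq> {}" by (auto simp: filippov_set_alt)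
  show ?thesis
  proof (rule equalityI)
    show "filippov_map N k ?F x \<subseteq> filippov_set k A c x"
    proof
      fix v assume v: "v \<in> filippov_map N k ?F x"
      have "infdist v (filippov_set k A c x) \<le> \<eta>" if "\<eta> > 0" for \<eta>
      proof -
        obtain d where "d > 0" and d: "\<And>y. norm (y - x) < d \<Longrightarrow> norm (A *v y - A *v x) < \<eta>"
        proof -
          have "continuous (at x) (\<lambda>y. A *v y)"
            by (intro linear_continuous_at matrix_vector_mul_bounded_linear)
          then show ?thesis using that \<open>\<eta> > 0\<close> unfolding continuous_at_eps_delta dist_norm by blast
        qed
        \<comment> \<open>If \<open>x\<close> is off the hyperplane, then points this close to \<open>x\<close> lie on the same side.\<close>
        define d' where "d' = (if x $ k = 0 then d else min d \<bar>x $ k\<bar>)"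
        have "d' > 0" "d' \<le> d" using \<open>d > 0\<close> by (auto simp: d'_def)
        define T where "T = (\<Union>s\<in>filippov_set k A c x. \<Union>z\<in>cball 0 \<eta>. {s + z})"
        have "?F ` (norm_ball N x (m * d') - {y. y $ k = 0}) \<subseteq> T"
        proof
          fix w assume "w \<in> ?F ` (norm_ball N x (m * d') - {y. y $ k = 0})"
          then obtain y where w: "w = ?F y" and yk: "y $ k \<noteq> 0" and "N (x - y) < m * d'"
            by (auto simp: norm_ball_def)
          then have "m * norm (x - y) < m * d'" using mM(3)[of "x - y"] by linarith
          then have dist: "norm (x - y) < d'" using mM(1) by simp
          then have "norm (A *v y - A *v x) < \<eta>" 
            using d[of y] \<open>d' \<le> d\<close> by (simp add: norm_minus_commute)
          moreover have "\<bar>x $ k - y $ k\<bar> < d'" 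
            using component_le_norm_cart[of "x - y" k] dist by simp
          then have "x $ k \<noteq> 0 \<Longrightarrow> \<bar>x $ k - y $ k\<bar> < \<bar>x $ k\<bar>" by (simp add: d'_def)
          then have side: "x $ k < 0 \<Longrightarrow> y $ k < 0" "0 < x $ k \<Longrightarrow> 0 < y $ k" by linarith+
          show "w \<in> T"
          proof (cases "y $ k < 0")
            case True
            then have "A *v x \<in> filippov_set k A c x" using side by (auto simp: filippov_set_alt)
            moreover have "w = A *v x + (A *v y - A *v x)" using True by (simp add: w pw_field_def)
            moreover have "A *v y - A *v x \<in> cball 0 \<eta>"
              using \<open>norm (A *v y - A *v x) < \<eta>\<close> by simp
            ultimately show ?thesis unfolding T_def by blast
          next
            case False
            then have "c \<in> filippov_set k A c x" using side by (auto simp: filippov_set_alt)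
            moreover have "w = c + 0" using False by (simp add: w pw_field_def)
            moreover have "0 \<in> cball (0::real^'n) \<eta>" using \<open>\<eta> > 0\<close> by simp
            ultimately show ?thesis unfolding T_def by blast
          qed
        qed
        moreover have "closed T \<and> convex T"
          unfolding T_def using convex_sums[OF conv convex_cball]
            compact_closed_sums[OF compact closed_cball] by blast
        ultimately have "?C (m * d') \<subseteq> T" by (rule hull_minimal)
        moreover have "v \<in> ?C (m * d')"
          using v mM(1) \<open>d' > 0\<close> by (simp add: filippov_map_def)
        ultimately obtain s z where "s \<in> filippov_set k A c x" "norm z \<le> \<eta>" "v = s + z"
          unfolding T_def by auto
        then show ?thesis using infdist_le[of s "filippov_set k A c x" v] by (simp add: dist_norm)
      qed
      then have "infdist v (filippov_set k A c x) \<le> 0" by (rule field_le_epsilon[of _ 0, simplified])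
      then show "v \<in> filippov_set k A c x"
        using in_closed_iff_infdist_zero[OF compact_imp_closed[OF compact] ne] infdist_nonneg
        by (metis order_antisym)
    qed
    have "filippov_set k A c x \<subseteq> ?C \<delta>" if "\<delta> > 0" for \<delta>
    proof -
      define y where "y r = x + r *\<^sub>R axis k 1" for r :: real
      have yk: "y r $ k = x $ k + r" for r by (simp add: y_def)
      have y_ball: "y r \<in> norm_ball N x \<delta>" if "\<bar>r\<bar> < \<delta> / M" for r
      proof -
        have "x - y r = - (r *\<^sub>R axis k 1)" by (simp add: y_def)
        then have "N (x - y r) \<le> M * \<bar>r\<bar>" using mM(4)[of "x - y r"] by simp
        then show ?thesis using that mM(2) by (simp add: norm_ball_def field_simps)
      qed
      have left: "A *v x \<in> ?C \<delta>" if "x $ k \<le> 0"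
      proof -
        have "A *v y r = A *v x + r *\<^sub>R (A *v axis k 1)" for r
          by (simp add: y_def matrix_vector_right_distrib matrix_vector_mult_scaleR)
        moreover have "((\<lambda>r. A *v x + r *\<^sub>R (A *v axis k 1)) \<longlongrightarrow> A *v x + 0 *\<^sub>R (A *v axis k 1)) (at_left 0)"
          by (intro tendsto_intros)
        ultimately have "((\<lambda>r. A *v y r) \<longlongrightarrow> A *v x) (at_left 0)" by simp
        moreover have "\<forall>\<^sub>F r in at_left 0. A *v y r \<in> ?C \<delta>"
        proof -
          have "\<forall>\<^sub>F r in at_left (0::real). r \<in> {-\<delta> / M<..<0}"
            using \<open>\<delta> > 0\<close> mM(2) by (intro eventually_at_leftI[of "- \<delta> / M"]) auto
          then show ?thesis
          proof (rule eventually_mono)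
            fix r assume r: "r \<in> {-\<delta> / M<..<0}"
            then have "y r \<in> norm_ball N x \<delta> - {y. y $ k = 0}" 
              using that y_ball[of r] by (auto simp: yk)
            from subsetD[OF sub imageI[OF this]] have "?F (y r) \<in> ?C \<delta>" .
            moreover have "?F (y r) = A *v y r" using r that by (simp add: pw_field_def yk)
            ultimately show "A *v y r \<in> ?C \<delta>" by (rule subst[rotated])
          qed
        qed
        ultimately show ?thesis
          by (intro Lim_in_closed_set[OF conjunct1[OF C] _ trivial_limit_at_left_real])
      qed
      have right: "c \<in> ?C \<delta>" if "0 \<le> x $ k"
      proof -
        define r where "r = \<delta> / M / 2"
        have "0 < r" "\<bar>r\<bar> < \<delta> / M" using \<open>\<delta> > 0\<close> mM(2) by (auto simp: r_def field_simps)
        then have "y r \<in> norm_ball N x \<delta> - {y. y $ k = 0}" 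
          using that y_ball[of r] by (auto simp: yk)
        from subsetD[OF sub imageI[OF this]] have "?F (y r) \<in> ?C \<delta>" .
        moreover have "?F (y r) = c" using \<open>0 < r\<close> that by (simp add: pw_field_def yk)
        ultimately show ?thesis by (rule subst[rotated])
      qed
      have "closed_segment (A *v x) c \<subseteq> ?C \<delta>" if "x $ k = 0"
        using left right that by (intro closed_segment_subset conjunct2[OF C]) simp_all
      then show ?thesis
        using left right by (simp add: filippov_set_alt)
    qed
    then show "filippov_set k A c x \<subseteq> filippov_map N k ?F x"
      unfolding filippov_map_def by blast
  qed
qed

section \<open>Comparison of solutions of nearby systems\<close>

lemma filippov_solution_compact_iff:
  "filippov_solution_compact G a b \<phi> \<longleftrightarrow> abs_continuous_on a b \<phi> \<and>
     (\<exists>E. negligible E \<and>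
        (\<forall>t\<in>{a..b} - E. \<exists>v\<in>G (\<phi> t). (\<phi> has_vector_derivative v) (at t within {a..b})))"
    (is "_ \<longleftrightarrow> _ \<and> ?R")
proof -
  let ?P = "\<lambda>t. \<exists>v\<in>G (\<phi> t). (\<phi> has_vector_derivative v) (at t within {a..b})"
  have "(AE t\<in>{a..b} in lebesgue. ?P t) \<longleftrightarrow> ?R"
  proof
    assume "AE t\<in>{a..b} in lebesgue. ?P t"
    then obtain E where "E \<in> null_sets lebesgue" "{t. \<not> (t \<in> {a..b} \<longrightarrow> ?P t)} \<subseteq> E"
      unfolding eventually_ae_filter by auto
    then show ?R by (intro exI[of _ E]) (auto simp: negligible_iff_null_sets)
  next
    assume ?R
    then obtain E where "negligible E" and E: "\<forall>t\<in>{a..b} - E. ?P t" by blast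
    then show "AE t\<in>{a..b} in lebesgue. ?P t"
      by (intro AE_I'[of E]) (auto simp: negligible_iff_null_sets)
  qed
  then show ?thesis unfolding filippov_solution_compact_def by blast
qed

text \<open>
  The pointwise inequality behind the comparison: \<open>v\<close> and \<open>w\<close> are velocities at \<open>x\<close> and \<open>y\<close>, and
  the left-hand side bounds the derivative of \<open>|x - y| + K |x\<^sub>k - y\<^sub>k|\<close> plus a multiple of \<open>y\<^sub>k\<close>.
  The bound on \<open>x\<close> ensures \<open>(c - A x)\<^sub>k \<le> - \<kappa> / 2\<close>, and \<open>K\<close> is chosen with \<open>|c - A x| \<le> K \<kappa> / 2\<close>. The
  last summand on the left absorbs the part of \<open>c' - c\<close> that acts on \<open>y\<close> while it is on the right or
  slides. The assumption \<open>tie\<close> holds at almost every time.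
\<close>

lemma filippov_set_contraction:
  fixes A A' :: "real^'n^'n" and c c' x y v w :: "real^'n"
  assumes \<kappa>: "c $ k = - \<kappa>" "0 < \<kappa>"
    and a: "0 < a" "\<And>x. norm (A *v x) \<le> a * norm x"
    and \<delta>: "0 \<le> \<delta>" "\<delta> \<le> \<kappa> / 2"
    and A': "\<And>x. norm (A' *v x - A *v x) \<le> \<delta> * norm x" and c': "norm (c' - c) \<le> \<delta>"
    and r: "norm x \<le> \<kappa> / (2 * a)"
    and K: "K = 2 * (norm c + \<kappa> / 2) / \<kappa>"
    and v: "v \<in> filippov_set k A c x" and w: "w \<in> filippov_set k A' c' y"
    and tie: "x $ k = y $ k \<Longrightarrow> v $ k = w $ k"
  shows "norm (v - w) + K * (sgn (x $ k - y $ k) * (v $ k - w $ k)) + \<delta> * (1 + K) * 2 / \<kappa> * w $ k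
           \<le> (1 + K) * (a * norm (x - y)) + (1 + K) * (2 + 2 * a / \<kappa>) * \<delta> * norm y"
proof -
  obtain p where p: "v = (1 - p) *\<^sub>R (A *v x) + p *\<^sub>R c" "0 \<le> p" "p \<le> 1"
      "x $ k < 0 \<longrightarrow> p = 0" "0 < x $ k \<longrightarrow> p = 1"
    using v unfolding filippov_set_def by blast
  obtain q where q: "w = (1 - q) *\<^sub>R (A' *v y) + q *\<^sub>R c'" "0 \<le> q" "q \<le> 1"
      "y $ k < 0 \<longrightarrow> q = 0" "0 < y $ k \<longrightarrow> q = 1"
    using w unfolding filippov_set_def by blast
  define R where "R = (1 - q) *\<^sub>R (A *v (x - y) + (A *v y - A' *v y)) + q *\<^sub>R (c - c')"
  define jump where "jump = c - A *v x"
  have split: "v - w = (p - q) *\<^sub>R jump + R"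
    by (simp add: p q R_def jump_def matrix_vector_mult_diff_distrib algebra_simps)
  have R: "norm R \<le> a * norm (x - y) + \<delta> * norm y + q * \<delta>"
  proof -
    have "norm R \<le> norm ((1 - q) *\<^sub>R (A *v (x - y) + (A *v y - A' *v y))) + norm (q *\<^sub>R (c - c'))"
      unfolding R_def by (rule norm_triangle_ineq)
    also have "\<dots> = (1 - q) * norm (A *v (x - y) + (A *v y - A' *v y)) + q * norm (c - c')"
      using q by simp
    also have "\<dots> \<le> 1 * (norm (A *v (x - y)) + norm (A *v y - A' *v y)) + q * \<delta>"
      using q c' by (intro add_mono mult_mono norm_triangle_ineq) (auto simp: norm_minus_commute)
    also have "\<dots> \<le> a * norm (x - y) + \<delta> * norm y + q * \<delta>"
      using a(2)[of "x - y"] A'[of y] by (simp add: norm_minus_commute)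
    finally show ?thesis .
  qed
  have Ax: "norm (A *v x) \<le> \<kappa> / 2"
    using a(2)[of x] mult_left_mono[OF r, of a] a(1) by (simp add: field_simps)
  have jump_k: "jump $ k \<le> - \<kappa> / 2"
    using component_le_norm_cart[of "A *v x" k] Ax by (simp add: jump_def \<kappa>)
  have jump_norm: "norm jump \<le> norm c + \<kappa> / 2"
    unfolding jump_def using norm_triangle_ineq4[of c "A *v x"] Ax by linarith
  have "0 < K" unfolding K using \<kappa>(2) by (intro divide_pos_pos mult_pos_pos) (auto intro: add_nonneg_pos)
  have jump_K: "norm jump \<le> K * (\<kappa> / 2)" using jump_norm \<kappa>(2) by (simp add: K)
  have Rk: "\<bar>R $ k\<bar> \<le> norm R" by (rule component_le_norm_cart)
  have vwk: "v $ k - w $ k = (p - q) * jump $ k + R $ k"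
    using arg_cong[OF split, of "\<lambda>u. u $ k"] by simp
  have sgn_le: "sgn (x $ k - y $ k) * (v $ k - w $ k) \<le> norm R - \<bar>p - q\<bar> * (\<kappa> / 2)"
  proof (cases "x $ k" "y $ k" rule: linorder_cases)
    case less
    then have "p \<le> q" using p q by (cases "x $ k < 0"; cases "0 < y $ k") auto
    then have "\<bar>p - q\<bar> = q - p" by simp
    then have "(q - p) * jump $ k \<le> - (\<bar>p - q\<bar> * (\<kappa> / 2))"
      using mult_left_mono[OF jump_k, of "q - p"] \<open>p \<le> q\<close> by simp
    moreover have "sgn (x $ k - y $ k) * (v $ k - w $ k) = (q - p) * jump $ k - R $ k"
      using less unfolding vwk by (simp add: algebra_simps)
    ultimately show ?thesis using Rk by linarith
  next
    case greater
    then have "q \<le> p" using p q by (cases "y $ k < 0"; cases "0 < x $ k") auto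
    then have "\<bar>p - q\<bar> = p - q" by simp
    then have "(p - q) * jump $ k \<le> - (\<bar>p - q\<bar> * (\<kappa> / 2))"
      using mult_left_mono[OF jump_k, of "p - q"] \<open>q \<le> p\<close> by simp
    moreover have "sgn (x $ k - y $ k) * (v $ k - w $ k) = (p - q) * jump $ k + R $ k"
      using greater unfolding vwk by simp
    ultimately show ?thesis using Rk by linarith
  next
    case equal
    then have "(p - q) * jump $ k = - R $ k" using tie vwk by simp
    then have "\<bar>p - q\<bar> * \<bar>jump $ k\<bar> = \<bar>R $ k\<bar>"
      by (metis abs_minus_cancel abs_mult)
    moreover have "\<bar>p - q\<bar> * (\<kappa> / 2) \<le> \<bar>p - q\<bar> * \<bar>jump $ k\<bar>"
      using jump_k by (intro mult_left_mono) auto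
    ultimately show ?thesis using equal Rk by simp
  qed
  have "norm (v - w) \<le> \<bar>p - q\<bar> * norm jump + norm R"
    unfolding split using norm_triangle_ineq[of "(p - q) *\<^sub>R jump" R] by simp
  also have "\<dots> \<le> K * (\<bar>p - q\<bar> * (\<kappa> / 2)) + norm R"
    using mult_left_mono[OF jump_K, of "\<bar>p - q\<bar>"] by (simp add: algebra_simps)
  finally have "norm (v - w) + K * (sgn (x $ k - y $ k) * (v $ k - w $ k)) \<le> (1 + K) * norm R"
    using mult_left_mono[OF sgn_le, of K] \<open>0 < K\<close> by (simp add: algebra_simps)
  also have "\<dots> \<le> (1 + K) * (a * norm (x - y) + \<delta> * norm y + q * \<delta>)"
    using R \<open>0 < K\<close> by (intro mult_left_mono) auto
  finally have main: "norm (v - w) + K * (sgn (x $ k - y $ k) * (v $ k - w $ k))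
      \<le> (1 + K) * (a * norm (x - y) + \<delta> * norm y + q * \<delta>)" .
  have "w $ k \<le> (a + \<kappa> / 2) * norm y - q * (\<kappa> / 2)"
  proof -
    have "norm (A' *v y) \<le> norm (A *v y) + norm (A' *v y - A *v y)"
      using norm_triangle_ineq[of "A *v y" "A' *v y - A *v y"] by simp
    also have "\<dots> \<le> (a + \<kappa> / 2) * norm y"
      using a(2)[of y] A'[of y] mult_right_mono[OF \<delta>(2), of "norm y"] by (simp add: algebra_simps)
    finally have A'y: "\<bar>(A' *v y) $ k\<bar> \<le> (a + \<kappa> / 2) * norm y"
      using component_le_norm_cart[of "A' *v y" k] by linarith
    have "(1 - q) * (A' *v y) $ k \<le> (1 - q) * \<bar>(A' *v y) $ k\<bar>"
      using q(3) by (intro mult_left_mono) auto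
    also have "\<dots> \<le> 1 * ((a + \<kappa> / 2) * norm y)"
      using q(2,3) A'y a(1) \<kappa>(2) by (intro mult_mono) auto
    finally have "(1 - q) * (A' *v y) $ k \<le> (a + \<kappa> / 2) * norm y" by simp
    moreover have "c' $ k \<le> - \<kappa> / 2"
      using component_le_norm_cart[of "c' - c" k] c' \<delta> by (simp add: \<kappa>)
    then have "q * c' $ k \<le> q * (- \<kappa> / 2)" using q by (intro mult_left_mono) auto
    ultimately show ?thesis by (simp add: q)
  qed
  then have "\<delta> * (1 + K) * 2 / \<kappa> * w $ k \<le> \<delta> * (1 + K) * 2 / \<kappa> * ((a + \<kappa> / 2) * norm y - q * (\<kappa> / 2))"
    using \<delta> \<kappa>(2) \<open>0 < K\<close> by (intro mult_left_mono) auto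
  also have "\<dots> = (1 + K) * \<delta> * (2 * a / \<kappa> + 1) * norm y - (1 + K) * (q * \<delta>)"
    using \<kappa>(2) by (simp add: field_simps)
  finally show ?thesis using main by (simp add: algebra_simps)
qed

text \<open>
  The norm fails to be differentiable only at \<open>0\<close>; where \<open>z\<close> vanishes together with its
  derivative, it is of smaller order than the time increment, and so is its norm.
\<close>

lemma has_real_derivative_norm:
  fixes z :: "real \<Rightarrow> real^'n"
  assumes z: "(z has_vector_derivative e) (at t within S)"
    and tie: "z t = 0 \<Longrightarrow> e = 0"
  obtains D where "((\<lambda>t. norm (z t)) has_real_derivative D) (at t within S)" "D \<le> norm e"
proof (cases "z t = 0")
  case True
  then have "e = 0" by (rule tie)
  then have "(z has_derivative (\<lambda>h. 0)) (at t within S)"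
    using z by (simp add: has_vector_derivative_def)
  then have "((\<lambda>t. norm (z t)) has_derivative (\<lambda>h. 0)) (at t within S)"
    unfolding has_derivative_within_alt using True by simp
  then have "((\<lambda>t. norm (z t)) has_real_derivative 0) (at t within S)"
    by (simp only: has_field_derivative_def lambda_zero)
  then show ?thesis by (rule that) simp
next
  case False
  have "((\<lambda>t. norm (z t)) has_derivative (\<lambda>h. h *\<^sub>R e \<bullet> sgn (z t))) (at t within S)"
    using has_derivative_compose[OF z[unfolded has_vector_derivative_def] has_derivative_norm[OF False]]
    by simp
  then have "((\<lambda>t. norm (z t)) has_real_derivative (e \<bullet> sgn (z t))) (at t within S)"
    unfolding has_field_derivative_def by (rule has_derivative_eq_rhs) (simp add: fun_eq_iff)
  moreover have "e \<bullet> sgn (z t) \<le> norm e"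
    using norm_cauchy_schwarz[of e "sgn (z t)"] False by (simp add: norm_sgn)
  ultimately show ?thesis by (rule that)
qed


text \<open>
  Gronwall's inequality for \<open>f = |z| + K |z\<^sub>k| + \<eta> (\<psi>\<^sub>k + \<rho>)\<close> with \<open>z = \<phi> - \<psi>\<close>. The shift by \<open>\<rho>\<close> makes
  the last summand nonnegative, and \<open>\<eta>\<close> is proportional to \<open>\<delta>\<close>, so that \<open>f 0\<close> is of order
  \<open>\<delta> \<rho>\<close>.
\<close>

lemma filippov_solution_comparison:
  fixes A A' :: "real^'n^'n" and c c' :: "real^'n"
  assumes \<kappa>: "c $ k = - \<kappa>" "0 < \<kappa>"
    and a: "0 < a" "\<And>x. norm (A *v x) \<le> a * norm x"
    and \<delta>: "0 \<le> \<delta>" "\<delta> \<le> \<kappa> / 2"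
    and A': "\<And>x. norm (A' *v x - A *v x) \<le> \<delta> * norm x" and c': "norm (c' - c) \<le> \<delta>"
    and K: "K = 2 * (norm c + \<kappa> / 2) / \<kappa>"
    and "0 \<le> T"
    and \<phi>: "filippov_solution_compact (filippov_set k A c) 0 T \<phi>"
    and \<psi>: "filippov_solution_compact (filippov_set k A' c') 0 T \<psi>"
    and init: "\<phi> 0 = \<psi> 0"
    and small: "\<And>t. t \<in> {0..T} \<Longrightarrow> norm (\<phi> t) \<le> \<kappa> / (2 * a)"
    and \<rho>: "\<And>t. t \<in> {0..T} \<Longrightarrow> norm (\<psi> t) \<le> \<rho>"
  shows "norm (\<phi> T - \<psi> T)
      \<le> exp ((1 + K) * a * T) * (4 * (1 + K) / \<kappa> + (1 + K) * (2 + 2 * a / \<kappa>) * T) * \<delta> * \<rho>"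
proof -
  from \<phi> obtain E1 where ac1: "abs_continuous_on 0 T \<phi>" and "negligible E1"
    and E1: "\<forall>t\<in>{0..T} - E1. \<exists>v\<in>filippov_set k A c (\<phi> t). (\<phi> has_vector_derivative v) (at t within {0..T})"
    unfolding filippov_solution_compact_iff by auto
  from \<psi> obtain E2 where ac2: "abs_continuous_on 0 T \<psi>" and "negligible E2"
    and E2: "\<forall>t\<in>{0..T} - E2. \<exists>w\<in>filippov_set k A' c' (\<psi> t). (\<psi> has_vector_derivative w) (at t within {0..T})"
    unfolding filippov_solution_compact_iff by auto
  define z where "z t = \<phi> t - \<psi> t" for t
  define Z where "Z i = {t\<in>{0..T}. z t $ i = 0 \<and>
      (\<exists>D. D \<noteq> 0 \<and> ((\<lambda>t. z t $ i) has_real_derivative D) (at t within {0..T}))}" for i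
  define E where "E = E1 \<union> E2 \<union> (\<Union>i. Z i)"
  have "countable (\<Union>i. Z i)"
    unfolding Z_def by (intro countable_UN countable_nonstationary_zeros) simp
  then have "negligible E"
    unfolding E_def using \<open>negligible E1\<close> \<open>negligible E2\<close>
      null_sets_completionI[OF countable_imp_null_set_lborel]
    by (intro negligible_Un) (simp_all add: negligible_iff_null_sets)
  have "0 < K" unfolding K using \<kappa>(2) by (intro divide_pos_pos mult_pos_pos) (auto intro: add_nonneg_pos)
  define \<eta> where "\<eta> = \<delta> * (1 + K) * 2 / \<kappa>"
  have "0 \<le> \<eta>" unfolding \<eta>_def using \<delta>(1) \<open>0 < K\<close> \<kappa>(2) by simp
  have "0 \<le> \<rho>" using order_trans[OF norm_ge_zero \<rho>[of 0]] \<open>0 \<le> T\<close> by simp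
  \<comment> \<open>Times in some \<open>Z i\<close> are excluded so that a component of \<open>z\<close> that vanishes also has
    vanishing derivative: this gives \<open>tie\<close> below and differentiability of the norms in \<open>f\<close>.\<close>
  define f where "f t = norm (z t) + K * \<bar>z t $ k\<bar> + \<eta> * \<psi> t $ k + \<eta> * \<rho>" for t
  define m where "m = (1 + K) * (2 + 2 * a / \<kappa>) * \<delta> * \<rho>"
  have "0 \<le> m" unfolding m_def using \<open>0 < K\<close> a(1) \<kappa>(2) \<delta>(1) \<open>0 \<le> \<rho>\<close> by simp
  have z_le_f: "norm (z t) \<le> f t" if "t \<in> {0..T}" for t
  proof -
    have "- \<rho> \<le> \<psi> t $ k" using \<rho>[OF that] component_le_norm_cart[of "\<psi> t" k] by linarith
    then have "0 \<le> \<eta> * (\<psi> t $ k + \<rho>)" using \<open>0 \<le> \<eta>\<close> by simp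
    moreover have "0 \<le> K * \<bar>z t $ k\<bar>" using \<open>0 < K\<close> by simp
    ultimately show ?thesis unfolding f_def distrib_left by linarith
  qed
  have "f T \<le> exp ((1 + K) * a * (T - 0)) * (f 0 + m * (T - 0))"
  proof (rule abs_continuous_on_gronwall[OF \<open>0 \<le> T\<close> _ \<open>negligible E\<close>])
    show "abs_continuous_on 0 T f"
    proof (rule abs_continuous_on_dominated[OF ac1 ac2])
      fix s t
      have "\<bar>norm (z s) - norm (z t)\<bar> \<le> norm (z s - z t)" by (rule norm_triangle_ineq3)
      moreover have "\<bar>\<bar>z s $ k\<bar> - \<bar>z t $ k\<bar>\<bar> \<le> norm (z s - z t)"
        using component_le_norm_cart[of "z s - z t" k] by simp
      moreover have "norm (z s - z t) \<le> norm (\<phi> s - \<phi> t) + norm (\<psi> s - \<psi> t)"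
        using norm_triangle_ineq4[of "\<phi> s - \<phi> t" "\<psi> s - \<psi> t"] by (simp add: z_def algebra_simps)
      moreover have "\<bar>\<psi> s $ k - \<psi> t $ k\<bar> \<le> norm (\<phi> s - \<phi> t) + norm (\<psi> s - \<psi> t)"
        using component_le_norm_cart[of "\<psi> s - \<psi> t" k] norm_ge_zero[of "\<phi> s - \<phi> t"]
        unfolding vector_minus_component by linarith
      ultimately have 1: "\<bar>norm (z s) - norm (z t)\<bar> \<le> norm (\<phi> s - \<phi> t) + norm (\<psi> s - \<psi> t)"
        and 2: "\<bar>\<bar>z s $ k\<bar> - \<bar>z t $ k\<bar>\<bar> \<le> norm (\<phi> s - \<phi> t) + norm (\<psi> s - \<psi> t)"
        and 3: "\<bar>\<psi> s $ k - \<psi> t $ k\<bar> \<le> norm (\<phi> s - \<phi> t) + norm (\<psi> s - \<psi> t)" by linarith+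
      have "f s - f t = (norm (z s) - norm (z t)) + K * (\<bar>z s $ k\<bar> - \<bar>z t $ k\<bar>) + \<eta> * (\<psi> s $ k - \<psi> t $ k)"
        by (simp add: f_def algebra_simps)
      also have "\<bar>\<dots>\<bar> \<le> \<bar>norm (z s) - norm (z t)\<bar> + \<bar>K * (\<bar>z s $ k\<bar> - \<bar>z t $ k\<bar>)\<bar> + \<bar>\<eta> * (\<psi> s $ k - \<psi> t $ k)\<bar>"
        by linarith
      also have "\<dots> \<le> (norm (\<phi> s - \<phi> t) + norm (\<psi> s - \<psi> t)) + K * (norm (\<phi> s - \<phi> t) + norm (\<psi> s - \<psi> t))
            + \<eta> * (norm (\<phi> s - \<phi> t) + norm (\<psi> s - \<psi> t))"
        unfolding abs_mult using 1 2 3 \<open>0 < K\<close> \<open>0 \<le> \<eta>\<close> by (intro add_mono mult_mono) auto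
      also have "\<dots> = (1 + K + \<eta>) * (norm (\<phi> s - \<phi> t) + norm (\<psi> s - \<psi> t))"
        by (simp add: algebra_simps)
      finally show "dist (f s) (f t) \<le> (1 + K + \<eta>) * (dist (\<phi> s) (\<phi> t) + dist (\<psi> s) (\<psi> t))"
        by (simp add: dist_real_def dist_norm)
    qed
  next
    fix t assume t: "t \<in> {0..T} - E"
    then have "t \<in> {0..T} - E1" "t \<in> {0..T} - E2" by (auto simp: E_def)
    obtain v where v: "v \<in> filippov_set k A c (\<phi> t)"
      and v': "(\<phi> has_vector_derivative v) (at t within {0..T})"
      using bspec[OF E1 \<open>t \<in> {0..T} - E1\<close>] by (rule bexE)
    obtain w where w: "w \<in> filippov_set k A' c' (\<psi> t)"
      and w': "(\<psi> has_vector_derivative w) (at t within {0..T})"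
      using bspec[OF E2 \<open>t \<in> {0..T} - E2\<close>] by (rule bexE)
    have z': "(z has_vector_derivative (v - w)) (at t within {0..T})"
      unfolding z_def using v' w' by (rule has_vector_derivative_diff)
    have comp: "((\<lambda>t. u t $ i) has_real_derivative (d $ i)) (at t within {0..T})"
      if "(u has_vector_derivative d) (at t within {0..T})" for u :: "real \<Rightarrow> real^'n" and d i
      unfolding has_real_derivative_iff_has_vector_derivative
      by (rule bounded_linear.has_vector_derivative[OF bounded_linear_vec_nth that])
    have tie: "(v - w) $ i = 0" if "z t $ i = 0" for i
    proof (rule ccontr)
      assume "(v - w) $ i \<noteq> 0"
      then have "t \<in> Z i" unfolding Z_def using t that comp[OF z'] by blast
      then show False using t by (auto simp: E_def)
    qed
    obtain D1 where D1: "((\<lambda>t. norm (z t)) has_real_derivative D1) (at t within {0..T})" "D1 \<le> norm (v - w)"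
      using has_real_derivative_norm[OF z'] tie by (auto simp: vec_eq_iff)
    have D2: "((\<lambda>t. \<bar>z t $ k\<bar>) has_real_derivative (sgn (z t $ k) * (v - w) $ k)) (at t within {0..T})"
    proof (cases "z t $ k = 0")
      case True
      then have "((\<lambda>t. z t $ k) has_derivative (\<lambda>h. 0)) (at t within {0..T})"
        using comp[OF z', of k] tie[OF True] by (simp add: has_field_derivative_def lambda_zero)
      then have "((\<lambda>t. \<bar>z t $ k\<bar>) has_derivative (\<lambda>h. 0)) (at t within {0..T})"
        unfolding has_derivative_within_alt using True by simp
      then show ?thesis using True by (simp add: has_field_derivative_def lambda_zero)
    next
      case False
      have "((\<lambda>x. \<bar>x\<bar>) has_real_derivative sgn (z t $ k)) (at (z t $ k))"
        using has_derivative_norm[OF False] unfolding has_field_derivative_def real_norm_def[abs_def]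
        by (rule has_derivative_eq_rhs) (simp add: fun_eq_iff mult.commute)
      from DERIV_chain2[OF this comp[OF z', of k]] show ?thesis .
    qed
    define D where "D = D1 + K * (sgn (z t $ k) * (v - w) $ k) + \<eta> * w $ k"
    have "(f has_real_derivative D) (at t within {0..T})"
      unfolding f_def D_def using D1(1) D2 comp[OF w', of k]
      by (auto intro!: derivative_eq_intros)
    moreover have "D \<le> (1 + K) * a * f t + m"
    proof -
      have t': "t \<in> {0..T}" using t by simp
      have "D \<le> norm (v - w) + K * (sgn (\<phi> t $ k - \<psi> t $ k) * (v $ k - w $ k)) + \<delta> * (1 + K) * 2 / \<kappa> * w $ k"
        using D1(2) by (simp add: D_def z_def \<eta>_def)
      also have "\<dots> \<le> (1 + K) * (a * norm (\<phi> t - \<psi> t)) + (1 + K) * (2 + 2 * a / \<kappa>) * \<delta> * norm (\<psi> t)"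
      proof (rule filippov_set_contraction[OF \<kappa> a \<delta> A' c' small[OF t'] K v w])
        show "v $ k = w $ k" if "\<phi> t $ k = \<psi> t $ k" using tie[of k] that by (simp add: z_def)
      qed
      also have "\<dots> \<le> (1 + K) * (a * f t) + (1 + K) * (2 + 2 * a / \<kappa>) * \<delta> * \<rho>"
        using z_le_f[OF t'] \<rho>[OF t'] \<open>0 < K\<close> a(1) \<delta>(1) \<kappa>(2)
        by (intro add_mono mult_left_mono) (auto simp: z_def)
      finally show ?thesis by (simp add: m_def mult.assoc)
    qed
    ultimately show "\<exists>D. (f has_real_derivative D) (at t within {0..T}) \<and> D \<le> (1 + K) * a * f t + m"
      by blast
  qed (use \<open>0 < K\<close> a(1) \<open>0 \<le> m\<close> in auto)
  moreover have "f 0 \<le> 2 * \<eta> * \<rho>"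
  proof -
    have "\<psi> 0 $ k \<le> \<rho>" using \<rho>[of 0] \<open>0 \<le> T\<close> component_le_norm_cart[of "\<psi> 0" k] by force
    then have "\<eta> * \<psi> 0 $ k \<le> \<eta> * \<rho>" using \<open>0 \<le> \<eta>\<close> by (rule mult_left_mono)
    then show ?thesis by (simp add: f_def z_def init)
  qed
  ultimately have "f T \<le> exp ((1 + K) * a * T) * (2 * \<eta> * \<rho> + m * T)"
    by (smt (verit, best) exp_gt_zero mult_left_mono diff_zero)
  moreover have "2 * \<eta> * \<rho> + m * T = (4 * (1 + K) / \<kappa> + (1 + K) * (2 + 2 * a / \<kappa>) * T) * \<delta> * \<rho>"
    by (simp add: \<eta>_def m_def algebra_simps)
  ultimately show ?thesis using z_le_f[of T] \<open>0 \<le> T\<close> by (simp add: z_def mult.assoc)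
qed

section \<open>Restricting, translating and gluing solutions\<close>

lemma abs_continuous_on_translate:
  assumes "abs_continuous_on a b f"
  shows "abs_continuous_on (a + h) (b + h) (\<lambda>t. f (t - h))"
  unfolding abs_continuous_on_def
proof (intro allI impI)
  fix \<epsilon> :: real assume "\<epsilon> > 0"
  from assms[unfolded abs_continuous_on_def, rule_format, OF this]
  obtain \<delta> where "\<delta> > 0" and \<delta>: "\<forall>(m::nat) u v. (\<forall>i<m. a \<le> u i \<and> u i \<le> v i \<and> v i \<le> b) \<and>
      disjoint_family_on (\<lambda>i. {u i<..<v i}) {..<m} \<and> (\<Sum>i<m. v i - u i) < \<delta> \<longrightarrow>
      (\<Sum>i<m. dist (f (u i)) (f (v i))) < \<epsilon>" by auto
  have "(\<Sum>i<m. dist (f (u i - h)) (f (v i - h))) < \<epsilon>"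
    if uv: "\<forall>i<m. a + h \<le> u i \<and> u i \<le> v i \<and> v i \<le> b + h"
      and disj: "disjoint_family_on (\<lambda>i. {u i<..<v i}) {..<m}" and "(\<Sum>i<m. v i - u i) < \<delta>"
    for m :: nat and u v
  proof (rule \<delta>[rule_format, of m "\<lambda>i. u i - h" "\<lambda>i. v i - h"], intro conjI allI impI)
    show "disjoint_family_on (\<lambda>i. {u i - h<..<v i - h}) {..<m}"
      unfolding disjoint_family_on_def
    proof (intro ballI impI)
      fix i j assume "i \<in> {..<m}" "j \<in> {..<m}" "i \<noteq> j"
      then have "{u i<..<v i} \<inter> {u j<..<v j} = {}" using disj unfolding disjoint_family_on_def by simp
      moreover have "s + h \<in> {u i<..<v i} \<inter> {u j<..<v j}"
        if "s \<in> {u i - h<..<v i - h} \<inter> {u j - h<..<v j - h}" for s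
        using that by auto
      ultimately show "{u i - h<..<v i - h} \<inter> {u j - h<..<v j - h} = {}"
        by (metis equals0I equals0D)
    qed
  next
    fix i assume "i < m"
    then have "a + h \<le> u i \<and> u i \<le> v i \<and> v i \<le> b + h" using uv by simp
    then show "a \<le> u i - h" "u i - h \<le> v i - h" "v i - h \<le> b" by auto
  next
    show "(\<Sum>i<m. (v i - h) - (u i - h)) < \<delta>" using that(3) by simp
  qed
  then show "\<exists>\<delta>>0. \<forall>(m::nat) u v. (\<forall>i<m. a + h \<le> u i \<and> u i \<le> v i \<and> v i \<le> b + h) \<and>
      disjoint_family_on (\<lambda>i. {u i<..<v i}) {..<m} \<and> (\<Sum>i<m. v i - u i) < \<delta> \<longrightarrow>
      (\<Sum>i<m. dist (f (u i - h)) (f (v i - h))) < \<epsilon>"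
    using \<open>\<delta> > 0\<close> by (intro exI[of _ \<delta>]) simp
qed

text \<open>
  Each interval is cut at \<open>b\<close>; the parts are \<open>[min u b, min v b]\<close> and \<open>[max u b, max v b]\<close>, one of
  which is degenerate unless the interval contains \<open>b\<close>.
\<close>

lemma abs_continuous_on_concat:
  assumes ab: "abs_continuous_on a b f" and bc: "abs_continuous_on b c f" and "a \<le> b" "b \<le> c"
  shows "abs_continuous_on a c f"
  unfolding abs_continuous_on_def
proof (intro allI impI)
  fix \<epsilon> :: real assume "\<epsilon> > 0"
  then have e: "\<epsilon> / 2 > 0" by simp
  from ab[unfolded abs_continuous_on_def, rule_format, OF e]
  obtain \<delta>1 where "\<delta>1 > 0" and 1: "\<forall>(m::nat) u v. (\<forall>i<m. a \<le> u i \<and> u i \<le> v i \<and> v i \<le> b) \<and>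
      disjoint_family_on (\<lambda>i. {u i<..<v i}) {..<m} \<and> (\<Sum>i<m. v i - u i) < \<delta>1 \<longrightarrow>
      (\<Sum>i<m. dist (f (u i)) (f (v i))) < \<epsilon> / 2" by auto
  from bc[unfolded abs_continuous_on_def, rule_format, OF e]
  obtain \<delta>2 where "\<delta>2 > 0" and 2: "\<forall>(m::nat) u v. (\<forall>i<m. b \<le> u i \<and> u i \<le> v i \<and> v i \<le> c) \<and>
      disjoint_family_on (\<lambda>i. {u i<..<v i}) {..<m} \<and> (\<Sum>i<m. v i - u i) < \<delta>2 \<longrightarrow>
      (\<Sum>i<m. dist (f (u i)) (f (v i))) < \<epsilon> / 2" by auto
  have "(\<Sum>i<m. dist (f (u i)) (f (v i))) < \<epsilon>"
    if uv: "\<forall>i<m. a \<le> u i \<and> u i \<le> v i \<and> v i \<le> c"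
      and disj: "disjoint_family_on (\<lambda>i. {u i<..<v i}) {..<m}"
      and less: "(\<Sum>i<m. v i - u i) < min \<delta>1 \<delta>2" for m :: nat and u v
  proof -
    have disj': "disjoint_family_on (\<lambda>i. {p i<..<q i}) {..<m}"
      if "\<And>i. {p i<..<q i} \<subseteq> {u i<..<v i}" for p q :: "nat \<Rightarrow> real"
      using disj that unfolding disjoint_family_on_def by (meson disjoint_iff subsetD)
    have "(\<Sum>i<m. min (v i) b - min (u i) b) \<le> (\<Sum>i<m. v i - u i)"
      using uv by (intro sum_mono) (auto simp: min_def)
    then have "(\<Sum>i<m. min (v i) b - min (u i) b) < \<delta>1" using less by linarith
    then have "(\<Sum>i<m. dist (f (min (u i) b)) (f (min (v i) b))) < \<epsilon> / 2"
      by (intro 1[rule_format] conjI disj' allI impI)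
        (assumption | use uv \<open>a \<le> b\<close> in \<open>auto simp: min_def\<close>)+
    moreover have "(\<Sum>i<m. max (v i) b - max (u i) b) \<le> (\<Sum>i<m. v i - u i)"
      using uv by (intro sum_mono) (auto simp: max_def)
    then have "(\<Sum>i<m. max (v i) b - max (u i) b) < \<delta>2" using less by linarith
    then have "(\<Sum>i<m. dist (f (max (u i) b)) (f (max (v i) b))) < \<epsilon> / 2"
      by (intro 2[rule_format] conjI disj' allI impI)
        (assumption | use uv \<open>b \<le> c\<close> in \<open>auto simp: max_def\<close>)+
    moreover have "(\<Sum>i<m. dist (f (u i)) (f (v i))) \<le>
        (\<Sum>i<m. dist (f (min (u i) b)) (f (min (v i) b)) + dist (f (max (u i) b)) (f (max (v i) b)))"
    proof (intro sum_mono)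
      fix i assume "i \<in> {..<m}"
      then have "u i \<le> v i" using uv by simp
      then show "dist (f (u i)) (f (v i)) \<le>
          dist (f (min (u i) b)) (f (min (v i) b)) + dist (f (max (u i) b)) (f (max (v i) b))"
        using dist_triangle[of "f (u i)" "f (v i)" "f b"] by (auto simp: min_def max_def)
    qed
    ultimately show ?thesis by (simp add: sum.distrib)
  qed
  then show "\<exists>\<delta>>0. \<forall>(m::nat) u v. (\<forall>i<m. a \<le> u i \<and> u i \<le> v i \<and> v i \<le> c) \<and>
      disjoint_family_on (\<lambda>i. {u i<..<v i}) {..<m} \<and> (\<Sum>i<m. v i - u i) < \<delta> \<longrightarrow>
      (\<Sum>i<m. dist (f (u i)) (f (v i))) < \<epsilon>"
    using \<open>\<delta>1 > 0\<close> \<open>\<delta>2 > 0\<close> by (intro exI[of _ "min \<delta>1 \<delta>2"]) simp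
qed

lemma abs_continuous_on_cong:
  assumes "abs_continuous_on a b f" "\<And>t. t \<in> {a..b} \<Longrightarrow> f t = g t"
  shows "abs_continuous_on a b g"
  by (rule abs_continuous_on_dominated[OF assms(1,1), where L = 1]) (simp add: assms(2))

lemma filippov_solution_compact_subinterval:
  assumes "filippov_solution_compact G a b \<phi>" "a \<le> c" "d \<le> b"
  shows "filippov_solution_compact G c d \<phi>"
proof -
  from assms(1) obtain E where E: "abs_continuous_on a b \<phi>" "negligible E"
    "\<forall>t\<in>{a..b} - E. \<exists>v\<in>G (\<phi> t). (\<phi> has_vector_derivative v) (at t within {a..b})"
    unfolding filippov_solution_compact_iff by auto
  have sub: "{c..d} \<subseteq> {a..b}" using assms by auto
  have "\<exists>v\<in>G (\<phi> t). (\<phi> has_vector_derivative v) (at t within {c..d})" if "t \<in> {c..d} - E" for t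
  proof -
    have "t \<in> {a..b} - E" using that sub by auto
    from bspec[OF E(3) this] show ?thesis
      using has_vector_derivative_within_subset[OF _ sub] by blast
  qed
  then show ?thesis
    unfolding filippov_solution_compact_iff
    using abs_continuous_on_subinterval[OF E(1) assms(2,3)] E(2) by blast
qed

lemma filippov_solution_compact_translate:
  assumes "filippov_solution_compact G a b \<phi>"
  shows "filippov_solution_compact G (a + h) (b + h) (\<lambda>t. \<phi> (t - h))"
proof -
  from assms obtain E where E: "abs_continuous_on a b \<phi>" "negligible E"
    "\<forall>t\<in>{a..b} - E. \<exists>v\<in>G (\<phi> t). (\<phi> has_vector_derivative v) (at t within {a..b})"
    unfolding filippov_solution_compact_iff by auto
  have "\<exists>v\<in>G (\<phi> (t - h)). ((\<lambda>t. \<phi> (t - h)) has_vector_derivative v) (at t within {a + h..b + h})"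
    if t: "t \<in> {a + h..b + h} - (+) h ` E" for t
  proof -
    have "t - h \<in> {a..b} - E"
    proof
      show "t - h \<notin> E"
      proof
        assume "t - h \<in> E"
        then have "h + (t - h) \<in> (+) h ` E" by (rule imageI)
        then show False using t by simp
      qed
    qed (use t in auto)
    from bspec[OF E(3) this] obtain v where v: "v \<in> G (\<phi> (t - h))"
      "(\<phi> has_vector_derivative v) (at (t - h) within {a..b})" by (rule bexE)
    have "((\<lambda>t. t - h) has_vector_derivative 1) (at t within {a + h..b + h})"
      by (auto intro!: derivative_eq_intros)
    moreover have "(\<phi> has_vector_derivative v) (at (t - h) within (\<lambda>t. t - h) ` {a + h..b + h})"
      using v(2) by (rule has_vector_derivative_within_subset) auto
    ultimately have "(\<phi> \<circ> (\<lambda>t. t - h) has_vector_derivative 1 *\<^sub>R v) (at t within {a + h..b + h})"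
      by (rule vector_diff_chain_within)
    then show ?thesis using v(1) by (auto simp: o_def)
  qed
  then show ?thesis
    unfolding filippov_solution_compact_iff
    using abs_continuous_on_translate[OF E(1)] negligible_translation[OF E(2)] by blast
qed

lemma has_vector_derivative_transfer_interior:
  assumes "(\<phi> has_vector_derivative v) (at t within {a..b})" "a < t" "t < b"
    and "\<And>s. s \<in> {a..b} \<Longrightarrow> \<psi> s = \<phi> s"
  shows "(\<psi> has_vector_derivative v) (at t within S)"
proof -
  have "(\<phi> has_vector_derivative v) (at t)"
    using assms(1) at_within_Icc_at[OF assms(2,3)] by simp
  then have "(\<psi> has_vector_derivative v) (at t)"
  proof (rule has_vector_derivative_transform_within_open[of _ _ _ "{a<..<b}"])
  qed (use assms in auto)
  then show ?thesis by (rule has_vector_derivative_at_within)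
qed

lemma filippov_solution_compact_cong:
  assumes "filippov_solution_compact G a b \<phi>" and eq: "\<And>t. t \<in> {a..b} \<Longrightarrow> \<psi> t = \<phi> t"
  shows "filippov_solution_compact G a b \<psi>"
proof -
  from assms(1) obtain E where E: "abs_continuous_on a b \<phi>" "negligible E"
    "\<forall>t\<in>{a..b} - E. \<exists>v\<in>G (\<phi> t). (\<phi> has_vector_derivative v) (at t within {a..b})"
    unfolding filippov_solution_compact_iff by auto
  have "\<exists>v\<in>G (\<psi> t). (\<psi> has_vector_derivative v) (at t within {a..b})" if "t \<in> {a..b} - E" for t
  proof -
    have "t \<in> {a..b}" using that by simp
    from bspec[OF E(3) that] obtain v where v: "v \<in> G (\<phi> t)"
      "(\<phi> has_vector_derivative v) (at t within {a..b})" by (rule bexE)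
    have "(\<psi> has_vector_derivative v) (at t within {a..b})"
      using v(2) by (rule has_vector_derivative_transform[OF \<open>t \<in> {a..b}\<close>, rotated]) (rule eq)
    then show ?thesis using v(1) eq[OF \<open>t \<in> {a..b}\<close>] by auto
  qed
  moreover have "abs_continuous_on a b \<psi>"
    using abs_continuous_on_cong[OF E(1)] eq by simp
  ultimately show ?thesis
    unfolding filippov_solution_compact_iff using E(2) by blast
qed

lemma filippov_solution_compact_concat:
  assumes ab: "filippov_solution_compact G a b \<phi>" and bc: "filippov_solution_compact G b c \<phi>"
    and "a \<le> b" "b \<le> c"
  shows "filippov_solution_compact G a c \<phi>"
proof -
  from ab obtain E where E: "abs_continuous_on a b \<phi>" "negligible E"
    "\<forall>t\<in>{a..b} - E. \<exists>v\<in>G (\<phi> t). (\<phi> has_vector_derivative v) (at t within {a..b})"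
    unfolding filippov_solution_compact_iff by auto
  from bc obtain F where F: "abs_continuous_on b c \<phi>" "negligible F"
    "\<forall>t\<in>{b..c} - F. \<exists>v\<in>G (\<phi> t). (\<phi> has_vector_derivative v) (at t within {b..c})"
    unfolding filippov_solution_compact_iff by auto
  define H where "H = E \<union> F \<union> {a, b, c}"
  have "negligible H" unfolding H_def using E(2) F(2) by (intro negligible_Un) auto
  moreover have "\<exists>v\<in>G (\<phi> t). (\<phi> has_vector_derivative v) (at t within {a..c})"
    if t: "t \<in> {a..c} - H" for t
  proof (cases "t < b")
    case True
    then have "t \<in> {a..b} - E" "a < t" using t by (auto simp: H_def)
    from bspec[OF E(3) this(1)] show ?thesis
      using has_vector_derivative_transfer_interior[of \<phi> _ t a b \<phi>] \<open>a < t\<close> True by blast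
  next
    case False
    then have "t \<in> {b..c} - F" "b < t" "t < c" using t by (auto simp: H_def)
    from bspec[OF F(3) this(1)] show ?thesis
      using has_vector_derivative_transfer_interior[of \<phi> _ t b c \<phi>] \<open>b < t\<close> \<open>t < c\<close> by blast
  qed
  ultimately show ?thesis
    unfolding filippov_solution_compact_iff
    using abs_continuous_on_concat[OF E(1) F(1) \<open>a \<le> b\<close> \<open>b \<le> c\<close>] by blast
qed

lemma filippov_solution_imp_compact:
  assumes "filippov_solution G I \<phi>" "a \<in> I" "b \<in> I" "a \<le> b"
  shows "filippov_solution_compact G a b \<phi>"
proof -
  have "{a..b} \<subseteq> I"
    using assms unfolding filippov_solution_def is_interval_1 by (metis atLeastAtMost_iff subsetI)
  then show ?thesis using assms unfolding filippov_solution_def by blast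
qed

lemma filippov_solution_compact_imp_forward:
  assumes "filippov_solution_compact G 0 T \<phi>" "0 \<le> T"
  shows "forward_solution G {0..T} \<phi>"
  unfolding forward_solution_def filippov_solution_def
proof (intro conjI allI impI)
  fix a b assume "a \<le> b \<and> {a..b} \<subseteq> {0..T}"
  then show "filippov_solution_compact G a b \<phi>"
    using filippov_solution_compact_subinterval[OF assms(1)] by simp
qed (use assms in \<open>auto simp: is_interval_cc\<close>)

section \<open>Local existence\<close>

definition linear_flow :: "real^'n^'n \<Rightarrow> real^'n \<Rightarrow> real \<Rightarrow> real^'n" where
  "linear_flow A x t = (\<chi> i. \<Sum>n. (((*v) A ^^ n) x $ i / fact n) * t ^ n)"

lemma summable_linear_flow:
  fixes A :: "real^'n^'n"
  shows "summable (\<lambda>n. (((*v) A ^^ n) x $ i / fact n) * t ^ n)"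
proof -
  obtain K where K: "\<And>x. norm (A *v x) \<le> norm x * K" "0 < K"
    using bounded_linear.pos_bounded[OF matrix_vector_mul_bounded_linear[of A]] by metis
  have power: "norm (((*v) A ^^ n) x) \<le> norm x * K ^ n" for n
  proof (induction n)
    case (Suc n)
    have "norm (A *v ((*v) A ^^ n) x) \<le> norm (((*v) A ^^ n) x) * K" by (rule K)
    also have "\<dots> \<le> norm x * K ^ n * K" using Suc K(2) by (intro mult_right_mono) auto
    finally show ?case by (simp add: algebra_simps)
  qed simp
  have "summable (\<lambda>n. norm x * (inverse (fact n) * (K * \<bar>t\<bar>) ^ n))"
    by (intro summable_mult summable_exp)
  then show ?thesis
  proof (rule summable_comparison_test'[where N = 0])
    fix n
    have "\<bar>((*v) A ^^ n) x $ i\<bar> \<le> norm x * K ^ n"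
      using component_le_norm_cart[of "((*v) A ^^ n) x" i] power[of n] by linarith
    then have "\<bar>((*v) A ^^ n) x $ i\<bar> / fact n * \<bar>t\<bar> ^ n \<le> norm x * K ^ n / fact n * \<bar>t\<bar> ^ n"
      by (intro mult_right_mono divide_right_mono) auto
    then show "norm (((*v) A ^^ n) x $ i / fact n * t ^ n) \<le> norm x * (inverse (fact n) * (K * \<bar>t\<bar>) ^ n)"
      by (simp add: abs_mult power_abs power_mult_distrib divide_inverse mult_ac)
  qed
qed

lemma linear_flow_0: "linear_flow A x 0 = x"
proof -
  have "(\<Sum>n. (((*v) A ^^ n) x $ i / fact n) * 0 ^ n) = x $ i" for i
    using powser_zero[of "\<lambda>n. ((*v) A ^^ n) x $ i / fact n"] by simp
  then show ?thesis by (simp add: linear_flow_def vec_eq_iff)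
qed

text \<open>
  Each component is a power series that converges everywhere and may be differentiated termwise.
\<close>

lemma linear_flow_derivative:
  fixes A :: "real^'n^'n"
  shows "(linear_flow A x has_vector_derivative A *v linear_flow A x t) (at t within S)"
proof -
  have comp: "((\<lambda>t. linear_flow A x t $ i) has_real_derivative (A *v linear_flow A x t) $ i) (at t)" for i
  proof -
    let ?c = "\<lambda>i n. ((*v) A ^^ n) x $ i / fact n"
    have deriv: "((\<lambda>t. \<Sum>n. ?c i n * t ^ n) has_real_derivative (\<Sum>n. diffs (?c i) n * t ^ n)) (at t)"
      by (intro termdiffs_strong_converges_everywhere summable_linear_flow)
    have "diffs (?c i) n = (\<Sum>j\<in>UNIV. A $ i $ j * ?c j n)" for n
    proof -
      have "diffs (?c i) n = (A *v ((*v) A ^^ n) x) $ i / fact n"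
        by (simp add: diffs_def field_simps del: of_nat_Suc)
      then show ?thesis by (simp add: matrix_vector_mult_def sum_divide_distrib)
    qed
    then have "(\<Sum>n. diffs (?c i) n * t ^ n) = (\<Sum>n. \<Sum>j\<in>UNIV. A $ i $ j * (?c j n * t ^ n))"
      by (simp add: sum_distrib_right mult.assoc)
    also have "\<dots> = (\<Sum>j\<in>UNIV. \<Sum>n. A $ i $ j * (?c j n * t ^ n))"
      by (intro suminf_sum summable_mult summable_linear_flow)
    also have "\<dots> = (\<Sum>j\<in>UNIV. A $ i $ j * (\<Sum>n. ?c j n * t ^ n))"
      by (intro sum.cong refl suminf_mult summable_linear_flow)
    also have "\<dots> = (A *v linear_flow A x t) $ i"
      by (simp add: linear_flow_def matrix_vector_mult_def)
    finally show ?thesis using deriv by (simp add: linear_flow_def)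
  qed
  have "(linear_flow A x has_vector_derivative A *v linear_flow A x t) (at t)"
    unfolding has_vector_derivative_def
  proof (subst has_derivative_componentwise_within, intro ballI)
    fix b :: "real^'n" assume "b \<in> Basis"
    then obtain i where b: "b = axis i 1" by (auto simp: Basis_vec_def)
    show "((\<lambda>t. linear_flow A x t \<bullet> b) has_derivative (\<lambda>h. h *\<^sub>R (A *v linear_flow A x t) \<bullet> b)) (at t)"
      using comp[of i] unfolding has_field_derivative_def b cart_eq_inner_axis[symmetric]
      by (rule has_derivative_eq_rhs) (simp add: fun_eq_iff)
  qed
  then show ?thesis by (rule has_vector_derivative_at_within)
qed

lemma linear_flow_component_derivative:
  fixes A :: "real^'n^'n" and f :: "real^'n \<Rightarrow> real^'m"
  assumes "bounded_linear f"
  shows "((\<lambda>t. f (linear_flow A x t) $ i) has_real_derivative f (A *v linear_flow A x t) $ i) (at t within S)"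
proof -
  have "((\<lambda>t. f (linear_flow A x t)) has_vector_derivative f (A *v linear_flow A x t)) (at t within S)"
    using assms linear_flow_derivative by (rule bounded_linear.has_vector_derivative)
  then show ?thesis
    unfolding has_real_derivative_iff_has_vector_derivative
    by (rule bounded_linear.has_vector_derivative[OF bounded_linear_vec_nth])
qed

lemma bounded_linear_matrix_power: "bounded_linear ((*v) (A :: real^'n^'n) ^^ n)"
proof (induction n)
  case (Suc n)
  then show ?case
    using bounded_linear_compose[OF matrix_vector_mul_bounded_linear[of A]] by (simp add: o_def)
qed (simp add: id_def)

text \<open>
  Here \<open>g i\<close> is the \<open>i\<close>-th derivative of \<open>g 0\<close>. The sign of the first derivative that does not
  vanish at \<open>0\<close> is passed down by integrating from \<open>0\<close>.
\<close>

lemma eventually_nonpos_of_leading_derivative: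
  fixes g :: "nat \<Rightarrow> real \<Rightarrow> real"
  assumes "\<And>i t. (g i has_real_derivative g (Suc i) t) (at t)"
    and "\<And>i. i < m \<Longrightarrow> g i 0 = 0" "g m 0 < 0"
  shows "\<exists>h>0. \<forall>t\<in>{0..h}. g 0 t \<le> 0"
  using assms
proof (induction m arbitrary: g)
  case 0
  have "isCont (g 0) 0" using 0(1) by (rule DERIV_isCont)
  then obtain d where "d > 0" and d: "\<And>t. \<bar>t\<bar> < d \<Longrightarrow> \<bar>g 0 t - g 0 0\<bar> < - g 0 0"
    using 0(3) unfolding continuous_at_eps_delta dist_real_def
    by (metis diff_zero neg_0_less_iff_less)
  have "g 0 t \<le> 0" if "t \<in> {0..d / 2}" for t
    using d[of t] that \<open>d > 0\<close> by (simp add: abs_less_iff)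
  then show ?case using \<open>d > 0\<close> by (intro exI[of _ "d / 2"]) auto
next
  case (Suc m)
  have "\<exists>h>0. \<forall>t\<in>{0..h}. g (Suc 0) t \<le> 0"
    using Suc.IH[of "\<lambda>i. g (Suc i)"] Suc.prems by simp
  then obtain h where "h > 0" and h: "\<And>t. t \<in> {0..h} \<Longrightarrow> g (Suc 0) t \<le> 0" by blast
  have "g 0 t \<le> g 0 0" if "t \<in> {0..h}" for t
  proof (rule DERIV_nonpos_imp_nonincreasing[of 0 t "g 0"])
    show "\<exists>y. (g 0 has_real_derivative y) (at s) \<and> y \<le> 0" if "0 \<le> s" "s \<le> t" for s
      using Suc.prems(1)[of 0 s] h[of s] \<open>t \<in> {0..h}\<close> that by auto
  qed (use that in simp)
  then show ?case using \<open>h > 0\<close> Suc.prems(2)[of 0] by auto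
qed

lemma filippov_set_bound:
  assumes "\<And>x. norm (A *v x) \<le> a * norm x" "v \<in> filippov_set k A c x"
  shows "norm v \<le> a * norm x + norm c"
proof -
  obtain p where p: "v = (1 - p) *\<^sub>R (A *v x) + p *\<^sub>R c" "0 \<le> p" "p \<le> 1"
    using assms(2) unfolding filippov_set_def by blast
  have "norm v \<le> norm ((1 - p) *\<^sub>R (A *v x)) + norm (p *\<^sub>R c)"
    unfolding p(1) by (rule norm_triangle_ineq)
  also have "\<dots> \<le> 1 * norm (A *v x) + 1 * norm c"
    using p(2,3) unfolding norm_scaleR by (intro add_mono mult_right_mono) auto
  finally show ?thesis using assms(1)[of x] by linarith
qed

lemma matrix_vector_bound:
  fixes A :: "real^'n^'n"
  obtains a where "0 < a" "\<And>x. norm (A *v x) \<le> a * norm x"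
proof -
  obtain K where "\<And>x. norm (A *v x) \<le> norm x * K" "0 < K"
    using bounded_linear.pos_bounded[OF matrix_vector_mul_bounded_linear[of A]] by metis
  then show ?thesis using that[of K] by (simp add: mult.commute)
qed

text \<open>
  A function with derivative in the Filippov set at every point is Lipschitz, because this set is
  bounded along the compact image of the function.
\<close>

lemma filippov_solution_compactI:
  fixes A :: "real^'n^'n"
  assumes "\<And>t. t \<in> {a..b} \<Longrightarrow> \<exists>v\<in>filippov_set k A c (\<phi> t). (\<phi> has_vector_derivative v) (at t within {a..b})"
  shows "filippov_solution_compact (filippov_set k A c) a b \<phi>"
proof -
  obtain K where K: "\<And>x. norm (A *v x) \<le> K * norm x" "0 < K"
    by (rule matrix_vector_bound[of A]) (rule that)
  have "continuous_on {a..b} \<phi>"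
    unfolding continuous_on_eq_continuous_within
  proof
    fix t assume "t \<in> {a..b}"
    from assms[OF this] show "continuous (at t within {a..b}) \<phi>"
      using has_vector_derivative_continuous by blast
  qed
  then have "bounded (\<phi> ` {a..b})"
    by (intro compact_imp_bounded compact_continuous_image) auto
  then obtain B where "\<forall>x\<in>\<phi> ` {a..b}. norm x \<le> B" unfolding bounded_iff by blast
  then have B: "norm (\<phi> t) \<le> B" if "t \<in> {a..b}" for t using that by simp
  have "(\<bar>K * B + norm c\<bar>)-lipschitz_on {a..b} \<phi>"
  proof (rule lipschitz_onI)
    fix s t assume st: "s \<in> {a..b}" "t \<in> {a..b}"
    have "\<forall>t. \<exists>v. t \<in> {a..b} \<longrightarrow> v \<in> filippov_set k A c (\<phi> t) \<and> (\<phi> has_vector_derivative v) (at t within {a..b})"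
      using assms by blast
    then obtain v where v: "\<And>t. t \<in> {a..b} \<Longrightarrow> v t \<in> filippov_set k A c (\<phi> t)"
      "\<And>t. t \<in> {a..b} \<Longrightarrow> (\<phi> has_vector_derivative v t) (at t within {a..b})"
      by metis
    have "norm (\<phi> s - \<phi> t) \<le> \<bar>K * B + norm c\<bar> * norm (s - t)"
    proof (rule differentiable_bound[of "{a..b}" \<phi> "\<lambda>t h. h *\<^sub>R v t"])
      show "(\<phi> has_derivative (\<lambda>h. h *\<^sub>R v t)) (at t within {a..b})" if "t \<in> {a..b}" for t
        using v(2)[OF that] by (simp add: has_vector_derivative_def)
      show "onorm (\<lambda>h. h *\<^sub>R v t) \<le> \<bar>K * B + norm c\<bar>" if "t \<in> {a..b}" for t
      proof (rule onorm_le)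
        fix h :: real
        have "norm (v t) \<le> K * norm (\<phi> t) + norm c"
          by (rule filippov_set_bound[OF K(1) v(1)[OF that]])
        also have "\<dots> \<le> \<bar>K * B + norm c\<bar>"
          using mult_left_mono[OF B[OF that], of K] K(2) by linarith
        finally show "norm (h *\<^sub>R v t) \<le> \<bar>K * B + norm c\<bar> * norm h"
          by (simp add: mult.commute[of _ "\<bar>h\<bar>"] mult_left_mono)
      qed
    qed (use st in auto)
    then show "dist (\<phi> s) (\<phi> t) \<le> \<bar>K * B + norm c\<bar> * dist s t"
      by (simp add: dist_norm)
  qed simp
  then show ?thesis
    unfolding filippov_solution_compact_iff
    using lipschitz_imp_abs_continuous_on assms by (intro conjI exI[of _ "{}"]) auto
qed


text \<open>
  Used to invert a change of time.
\<close>

lemma strictly_increasing_inverse: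
  fixes \<tau> \<tau>' :: "real \<Rightarrow> real"
  assumes "a < b" and deriv: "\<And>s. s \<in> {a..b} \<Longrightarrow> (\<tau> has_real_derivative \<tau>' s) (at s within {a..b})"
    and pos: "\<And>s. s \<in> {a..b} \<Longrightarrow> 0 < \<tau>' s"
  obtains \<sigma> where "\<And>s. s \<in> {a..b} \<Longrightarrow> \<sigma> (\<tau> s) = s"
    "\<And>s. a < s \<Longrightarrow> s < b \<Longrightarrow> (\<sigma> has_real_derivative inverse (\<tau>' s)) (at (\<tau> s))"
    "\<And>s s'. s \<in> {a..b} \<Longrightarrow> s' \<in> {a..b} \<Longrightarrow> s < s' \<Longrightarrow> \<tau> s < \<tau> s'"
    "continuous_on {a..b} \<tau>"
proof -
  have cont: "continuous_on {a..b} \<tau>"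
    using deriv by (meson DERIV_continuous_on)
  have deriv_at: "(\<tau> has_real_derivative \<tau>' s) (at s)" if "a < s" "s < b" for s
    using deriv[of s] that at_within_Icc_at[OF that] by simp
  have mono: "\<tau> s < \<tau> s'" if "s \<in> {a..b}" "s' \<in> {a..b}" "s < s'" for s s'
  proof (rule DERIV_pos_imp_increasing_open[OF \<open>s < s'\<close>])
    show "\<exists>y. (\<tau> has_real_derivative y) (at x) \<and> 0 < y" if "s < x" "x < s'" for x
      using deriv_at[of x] pos[of x] that \<open>s \<in> {a..b}\<close> \<open>s' \<in> {a..b}\<close> by auto
    show "continuous_on {s..s'} \<tau>"
      using cont by (rule continuous_on_subset) (use that in auto)
  qed
  have inj: "inj_on \<tau> {a..b}"
    using mono by (metis inj_onI linorder_neqE_linordered_idom order_less_irrefl)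
  define \<sigma> where "\<sigma> = inv_into {a..b} \<tau>"
  have inv: "\<sigma> (\<tau> s) = s" if "s \<in> {a..b}" for s
    unfolding \<sigma>_def using inj that by (rule inv_into_f_f)
  have range: "\<exists>s\<in>{a..b}. \<tau> s = t" if "t \<in> {\<tau> a..\<tau> b}" for t
    using IVT'[of \<tau> a t b] cont \<open>a < b\<close> that by auto
  have cont_inv: "continuous_on (\<tau> ` {a..b}) \<sigma>"
    using cont by (rule continuous_on_inv) (auto simp: inv)
  have "(\<sigma> has_real_derivative inverse (\<tau>' s)) (at (\<tau> s))" if s: "a < s" "s < b" for s
  proof (rule DERIV_inverse_function[where f = \<tau> and a = "\<tau> a" and b = "\<tau> b"])
    show "(\<tau> has_real_derivative \<tau>' s) (at (\<sigma> (\<tau> s)))"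
      using deriv_at[OF s] inv[of s] s by simp
    show "\<tau>' s \<noteq> 0" using pos[of s] s by simp
    show "\<tau> a < \<tau> s" "\<tau> s < \<tau> b" using mono s by auto
    show "\<tau> (\<sigma> t) = t" if "\<tau> a < t" "t < \<tau> b" for t
      using range[of t] inv that by auto
    have "{\<tau> a<..<\<tau> b} \<subseteq> \<tau> ` {a..b}"
    proof
      fix t assume "t \<in> {\<tau> a<..<\<tau> b}"
      then have "\<exists>s\<in>{a..b}. \<tau> s = t" by (intro range) simp
      then show "t \<in> \<tau> ` {a..b}" by blast
    qed
    then have "continuous_on {\<tau> a<..<\<tau> b} \<sigma>" using cont_inv continuous_on_subset by blast
    moreover have "\<tau> s \<in> {\<tau> a<..<\<tau> b}" using mono s by auto
    ultimately show "isCont \<sigma> (\<tau> s)"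
      using continuous_on_eq_continuous_at open_greaterThanLessThan by blast
  qed
  with inv mono cont show ?thesis by (intro that)
qed

lemma local_solution_regular_left:
  fixes A :: "real^'n^'n"
  assumes "0 < h" "\<And>t. t \<in> {0..h} \<Longrightarrow> linear_flow A x t $ k \<le> 0"
  shows "filippov_solution_compact (filippov_set k A c) 0 h (linear_flow A x)"
proof (rule filippov_solution_compactI)
  fix t assume "t \<in> {0..h}"
  then have "A *v linear_flow A x t \<in> filippov_set k A c (linear_flow A x t)"
    using assms(2)[of t] by (auto simp: filippov_set_alt)
  then show "\<exists>v\<in>filippov_set k A c (linear_flow A x t).
      (linear_flow A x has_vector_derivative v) (at t within {0..h})"
    using linear_flow_derivative by blast
qed

text \<open>
  Sliding along the hyperplane. The matrix \<open>B\<close> projects the velocity \<open>A y\<close> onto the hyperplane along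
  \<open>c\<close>, so that sliding is linear up to a change of time: along \<open>\<Psi> s = e\<^bsup>sB\<^esup> x\<close> the velocity is
  \<open>A \<Psi> + l c\<close> with \<open>l = (A \<Psi>)\<^sub>k / \<kappa>\<close>, and division by \<open>1 + l\<close> turns this into a convex
  combination of \<open>A \<Psi>\<close> and \<open>c\<close>. The new time is therefore \<open>\<tau> s = s + \<integral> l\<close>. The assumption \<open>out\<close> says
  that \<open>l\<close> is nonnegative, that is, that the left field does not point away from the hyperplane.
\<close>

lemma local_solution_sliding:
  fixes A B :: "real^'n^'n"
  assumes \<kappa>: "c $ k = - \<kappa>" "0 < \<kappa>"
    and B: "\<And>y. B *v y = A *v y + ((A *v y) $ k / \<kappa>) *\<^sub>R c"
    and "x $ k = 0" "0 < h" and out: "\<And>t. t \<in> {0..h} \<Longrightarrow> 0 \<le> (A *v linear_flow B x t) $ k"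
  shows "\<exists>T>0. \<exists>\<phi>. \<phi> 0 = x \<and> filippov_solution_compact (filippov_set k A c) 0 T \<phi>"
proof -
  define \<Psi> where "\<Psi> = linear_flow B x"
  have Bk: "(B *v y) $ k = 0" for y using \<kappa> by (simp add: B)
  have \<Psi>k: "\<Psi> t $ k = 0" for t
  proof -
    have "((*v) B ^^ n) x $ k = 0" for n
      using \<open>x $ k = 0\<close> Bk by (cases n) auto
    then show ?thesis by (simp add: \<Psi>_def linear_flow_def)
  qed
  \<comment> \<open>Truncation at \<open>0\<close> makes the new time increasing on \<open>[-1, h + 1]\<close>, which has \<open>[0, h]\<close> in its
    interior, so that the inverse function theorem applies at both end points.\<close>
  define l where "l s = max 0 ((A *v \<Psi> s) $ k / \<kappa>)" for s
  have "continuous_on UNIV (\<lambda>s. (A *v \<Psi> s) $ k)"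
    unfolding \<Psi>_def
    by (rule DERIV_continuous_on)
      (rule linear_flow_component_derivative[OF matrix_vector_mul_bounded_linear])
  then have "continuous_on {-1..h + 1} (\<lambda>s. (A *v \<Psi> s) $ k)"
    by (rule continuous_on_subset) simp
  then have "continuous_on {-1..h + 1} (\<lambda>s. max 0 ((A *v \<Psi> s) $ k / \<kappa>))"
    using \<kappa>(2) by (intro continuous_on_max continuous_on_divide continuous_on_const) auto
  then have "continuous_on {-1..h + 1} l" by (simp add: l_def[abs_def])
  then obtain \<Lambda> where \<Lambda>: "\<And>s. s \<in> {-1..h + 1} \<Longrightarrow> (\<Lambda> has_vector_derivative l s) (at s within {-1..h + 1})"
    using antiderivative_continuous by metis
  define \<tau> where "\<tau> s = s + (\<Lambda> s - \<Lambda> 0)" for s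
  have \<tau>: "(\<tau> has_real_derivative 1 + l s) (at s within {-1..h + 1})" if "s \<in> {-1..h + 1}" for s
    unfolding \<tau>_def using \<Lambda>[OF that]
    by (auto intro!: derivative_eq_intros simp: has_real_derivative_iff_has_vector_derivative[symmetric])
  have pos: "0 < 1 + l s" for s unfolding l_def by (simp add: add_pos_nonneg)
  have "-1 < h + 1" using \<open>0 < h\<close> by simp
  obtain \<sigma> where inv: "\<And>s. s \<in> {-1..h + 1} \<Longrightarrow> \<sigma> (\<tau> s) = s"
    and \<sigma>: "\<And>s. -1 < s \<Longrightarrow> s < h + 1 \<Longrightarrow> (\<sigma> has_real_derivative inverse (1 + l s)) (at (\<tau> s))"
    and mono: "\<And>s s'. s \<in> {-1..h + 1} \<Longrightarrow> s' \<in> {-1..h + 1} \<Longrightarrow> s < s' \<Longrightarrow> \<tau> s < \<tau> s'"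
    and cont: "continuous_on {-1..h + 1} \<tau>"
    by (rule strictly_increasing_inverse[OF \<open>-1 < h + 1\<close> \<tau> pos]) (assumption, rule that)
  have \<tau>0: "\<tau> 0 = 0" by (simp add: \<tau>_def)
  have "0 < \<tau> h" using mono[of 0 h] \<tau>0 \<open>0 < h\<close> by simp
  have "filippov_solution_compact (filippov_set k A c) 0 (\<tau> h) (\<Psi> \<circ> \<sigma>)"
  proof (rule filippov_solution_compactI)
    fix t assume t: "t \<in> {0..\<tau> h}"
    have "continuous_on {0..h} \<tau>" using cont by (rule continuous_on_subset) auto
    then obtain s where s: "s \<in> {0..h}" "\<tau> s = t"
      using IVT'[of \<tau> 0 t h] \<tau>0 t \<open>0 < h\<close> by auto
    have \<sigma>t: "\<sigma> t = s" using inv[of s] s by auto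
    define w where "w = l s / (1 + l s)"
    have "0 \<le> l s" unfolding l_def by simp
    then have w: "0 \<le> w" "w \<le> 1" "1 - w = inverse (1 + l s)" by (auto simp: w_def field_simps)
    have "(\<sigma> has_vector_derivative inverse (1 + l s)) (at t)"
      using \<sigma>[of s] s unfolding has_real_derivative_iff_has_vector_derivative by simp
    moreover have "(\<Psi> has_vector_derivative B *v \<Psi> s) (at (\<sigma> t))"
      unfolding \<Psi>_def \<sigma>t by (rule linear_flow_derivative)
    ultimately have "(\<Psi> \<circ> \<sigma> has_vector_derivative inverse (1 + l s) *\<^sub>R (B *v \<Psi> s)) (at t)"
      by (rule vector_diff_chain_at)
    moreover have "inverse (1 + l s) *\<^sub>R (B *v \<Psi> s) = (1 - w) *\<^sub>R (A *v \<Psi> s) + w *\<^sub>R c"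
    proof -
      have "l s = (A *v \<Psi> s) $ k / \<kappa>"
        using out[OF s(1)] \<kappa>(2) by (simp add: l_def \<Psi>_def)
      then have "B *v \<Psi> s = A *v \<Psi> s + l s *\<^sub>R c" by (simp add: B)
      then show ?thesis by (simp add: w(3) scaleR_add_right) (simp add: w_def divide_inverse)
    qed
    moreover have "(1 - w) *\<^sub>R (A *v \<Psi> s) + w *\<^sub>R c \<in> filippov_set k A c ((\<Psi> \<circ> \<sigma>) t)"
      unfolding filippov_set_def comp_def \<sigma>t mem_Collect_eq using w(1,2) \<Psi>k[of s]
      by (intro exI[of _ w] conjI impI refl) auto
    ultimately show "\<exists>v\<in>filippov_set k A c ((\<Psi> \<circ> \<sigma>) t).
        (\<Psi> \<circ> \<sigma> has_vector_derivative v) (at t within {0..\<tau> h})"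
      by (metis has_vector_derivative_at_within)
  qed
  moreover have "(\<Psi> \<circ> \<sigma>) 0 = x"
    using inv[of 0] \<tau>0 \<open>0 < h\<close> by (simp add: \<Psi>_def linear_flow_0)
  ultimately show ?thesis using \<open>0 < \<tau> h\<close> by blast
qed

text \<open>
  Only the case \<open>x\<^sub>k = 0\<close> is delicate, since \<open>A x\<close> may be tangent to the hyperplane to any order. If
  the first nonzero \<open>(A\<^sup>m x)\<^sub>k\<close> is negative, or none exists, the flow of \<open>A\<close> stays on the left for a
  while. If it is positive, then \<open>B\<^sup>i x = A\<^sup>i x\<close> for \<open>i < m\<close>, so the same number is the leading
  derivative of \<open>(A e\<^bsup>tB\<^esup> x)\<^sub>k\<close>, and sliding is possible.
\<close>

lemma local_solution_exists:
  fixes A :: "real^'n^'n"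
  assumes "c $ k < 0"
  shows "\<exists>T>0. \<exists>\<phi>. \<phi> 0 = x \<and> filippov_solution_compact (filippov_set k A c) 0 T \<phi>"
proof -
  define \<kappa> where "\<kappa> = - c $ k"
  have \<kappa>: "c $ k = - \<kappa>" "0 < \<kappa>" using assms by (auto simp: \<kappa>_def)
  define p where "p i = ((*v) A ^^ i) x" for i
  have p_Suc: "p (Suc i) = A *v p i" and p0: "p 0 = x" for i by (auto simp: p_def)
  have regular: ?thesis if zero: "\<And>i. i < m \<Longrightarrow> p i $ k = 0" and neg: "p m $ k < 0" for m
  proof -
    define g where "g i t = (((*v) A ^^ i) (linear_flow A x t)) $ k" for i t
    have "\<exists>h>0. \<forall>t\<in>{0..h}. g 0 t \<le> 0"
    proof (rule eventually_nonpos_of_leading_derivative)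
      show "(g i has_real_derivative g (Suc i) t) (at t)" for i t
        using linear_flow_component_derivative[OF bounded_linear_matrix_power[where A = A and n = i]]
        unfolding g_def[abs_def] by (simp add: funpow_swap1)
      show "g i 0 = 0" if "i < m" for i
        using zero[OF that] by (simp add: g_def linear_flow_0 p_def)
      show "g m 0 < 0" using neg by (simp add: g_def linear_flow_0 p_def)
    qed
    then obtain h where "0 < h" "\<And>t. t \<in> {0..h} \<Longrightarrow> linear_flow A x t $ k \<le> 0"
      by (auto simp: g_def)
    then show ?thesis
      using local_solution_regular_left[of h A x k c] linear_flow_0 by blast
  qed
  consider "0 < x $ k" | "x $ k < 0" | "x $ k = 0" by linarith
  then show ?thesis
  proof cases
    case 1
    define T where "T = x $ k / (2 * \<kappa>)"
    have "0 < T" using 1 \<kappa> by (simp add: T_def)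
    have "filippov_solution_compact (filippov_set k A c) 0 T (\<lambda>t. x + t *\<^sub>R c)"
    proof (rule filippov_solution_compactI)
      fix t assume "t \<in> {0..T}"
      then have "t * \<kappa> \<le> T * \<kappa>" using \<kappa>(2) by (intro mult_right_mono) auto
      also have "\<dots> < x $ k" using 1 \<kappa>(2) by (simp add: T_def)
      finally have "0 < (x + t *\<^sub>R c) $ k" by (simp add: \<kappa>)
      then have "c \<in> filippov_set k A c (x + t *\<^sub>R c)" by (simp add: filippov_set_alt)
      moreover have "((\<lambda>t. x + t *\<^sub>R c) has_vector_derivative c) (at t within {0..T})"
        by (auto intro!: derivative_eq_intros)
      ultimately show "\<exists>v\<in>filippov_set k A c (x + t *\<^sub>R c). ((\<lambda>t. x + t *\<^sub>R c) has_vector_derivative v) (at t within {0..T})"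
        by blast
    qed
    then show ?thesis using \<open>0 < T\<close> by (intro exI[of _ T] conjI exI[of _ "\<lambda>t. x + t *\<^sub>R c"]) auto
  next
    case 2
    then show ?thesis using regular[of 0] by (simp add: p0)
  next
    case 3
    show ?thesis
    proof (cases "\<forall>i. p i $ k = 0")
      case True
      then have "linear_flow A x t $ k = 0" for t by (simp add: linear_flow_def p_def)
      then show ?thesis
        using local_solution_regular_left[of 1 A x k c] linear_flow_0[of A x] zero_less_one
        by (metis order_refl)
    next
      case False
      define m where "m = (LEAST i. p i $ k \<noteq> 0)"
      have m: "p m $ k \<noteq> 0" using False unfolding m_def by (metis (mono_tags, lifting) LeastI)
      have less_m: "p i $ k = 0" if "i < m" for i
        using not_less_Least[of i "\<lambda>i. p i $ k \<noteq> 0"] that unfolding m_def by simp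
      show ?thesis
      proof (cases "p m $ k < 0")
        case True
        then show ?thesis using regular[of m] less_m by simp
      next
        case False
        with m have pos: "0 < p m $ k" by simp
        then obtain m' where m': "m = Suc m'" using 3 p0 by (cases m) auto
        define B :: "real^'n^'n" where "B = (\<chi> i j. A $ i $ j + c $ i * A $ k $ j / \<kappa>)"
        have B: "B *v y = A *v y + ((A *v y) $ k / \<kappa>) *\<^sub>R c" for y
          by (simp add: B_def vec_eq_iff matrix_vector_mult_def algebra_simps sum.distrib
              sum_distrib_left sum_divide_distrib)
        have pB: "((*v) B ^^ i) x = p i" if "i \<le> m'" for i
          using that
        proof (induction i)
          case (Suc i)
          then have "((*v) B ^^ Suc i) x = B *v p i" by simp
          also have "\<dots> = p (Suc i)" using less_m[of "Suc i"] Suc(2) by (simp add: B p_Suc m')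
          finally show ?case .
        qed (simp add: p0)
        define g where "g i t = - (A *v ((*v) B ^^ i) (linear_flow B x t)) $ k" for i t
        have "\<exists>h>0. \<forall>t\<in>{0..h}. g 0 t \<le> 0"
        proof (rule eventually_nonpos_of_leading_derivative)
          show "(g i has_real_derivative g (Suc i) t) (at t)" for i t
          proof -
            have "bounded_linear (\<lambda>y. A *v ((*v) B ^^ i) y)"
              by (intro bounded_linear_compose[OF matrix_vector_mul_bounded_linear]
                  bounded_linear_matrix_power)
            from DERIV_minus[OF linear_flow_component_derivative[OF this, of B x k t UNIV]]
            show ?thesis unfolding g_def[abs_def] by (simp add: funpow_swap1)
          qed
          show "g i 0 = 0" if "i < m'" for i
            using less_m[of "Suc i"] that by (simp add: g_def linear_flow_0 pB p_Suc m')
          show "g m' 0 < 0" using pos by (simp add: g_def linear_flow_0 pB p_Suc m')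
        qed
        then obtain h where "0 < h" "\<And>t. t \<in> {0..h} \<Longrightarrow> 0 \<le> (A *v linear_flow B x t) $ k"
          by (auto simp: g_def)
        then show ?thesis by (rule local_solution_sliding[OF \<kappa> B 3])
      qed
    qed
  qed
qed

section \<open>Maximal solutions\<close>

text \<open>
  Let \<open>S\<close> be the supremum of a bounded interval \<open>I\<close>. A bounded solution has bounded velocity,
  hence extends to \<open>S\<close> as a Lipschitz function, whether or not \<open>S\<close> belongs to \<open>I\<close>. Continuing it with a
  local solution from \<open>S\<close> contradicts maximality.
\<close>

lemma maximal_bounded_solution_global:
  fixes A :: "real^'n^'n"
  assumes "c $ k < 0" and max: "maximal_forward_solution (filippov_set k A c) I \<phi>"
    and bound: "\<And>t. t \<in> I \<Longrightarrow> norm (\<phi> t) \<le> \<rho>"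
  shows "I = {0..}"
proof (rule ccontr)
  let ?G = "filippov_set k A c"
  assume "I \<noteq> {0..}"
  have I: "0 \<in> I" "I \<subseteq> {0..}" and sol: "filippov_solution ?G I \<phi>"
    using max unfolding maximal_forward_solution_def forward_solution_def by blast+
  have interval: "t \<in> I" if "s \<in> I" "0 \<le> t" "t \<le> s" for s t
    using sol I(1) that unfolding filippov_solution_def is_interval_1 by blast
  obtain b where b: "0 \<le> b" "b \<notin> I" using \<open>I \<noteq> {0..}\<close> I(2) by force
  have below: "t < b" if "t \<in> I" for t
    using interval[OF that b(1)] b(2) by force
  define S where "S = Sup I"
  have bdd: "bdd_above I" using below by (meson bdd_above.I less_imp_le)
  have upper: "t \<le> S" if "t \<in> I" for t
    unfolding S_def using that bdd by (rule cSup_upper)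
  have "0 \<le> S" using upper I(1) by simp
  have lower: "t \<in> I" if "0 \<le> t" "t < S" for t
  proof -
    obtain s where "s \<in> I" "t < s"
      using less_cSupE[of t I] \<open>t < S\<close> I(1) unfolding S_def by blast
    then show ?thesis using interval[of s t] \<open>0 \<le> t\<close> by simp
  qed
  obtain a where a: "0 < a" "\<And>x. norm (A *v x) \<le> a * norm x"
    by (rule matrix_vector_bound[of A]) (rule that)
  define L where "L = a * \<rho> + norm c"
  have "0 \<le> \<rho>" using bound[OF I(1)] norm_ge_zero order_trans by blast
  have "0 \<le> L" unfolding L_def using a(1) \<open>0 \<le> \<rho>\<close> by simp
  have "L-lipschitz_on I \<phi>"
  proof (rule lipschitz_on_leI)
    fix s t assume st: "s \<in> I" "t \<in> I" "s \<le> t"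
    then have fsc: "filippov_solution_compact ?G s t \<phi>"
      using filippov_solution_imp_compact[OF sol] by blast
    then obtain E where ac: "abs_continuous_on s t \<phi>" and "negligible E"
      and E: "\<forall>u\<in>{s..t} - E. \<exists>v\<in>?G (\<phi> u). (\<phi> has_vector_derivative v) (at u within {s..t})"
      unfolding filippov_solution_compact_iff by auto
    have "norm (\<phi> t - \<phi> s) \<le> L * (t - s)"
    proof (rule abs_continuous_on_increment_le[OF \<open>s \<le> t\<close> ac \<open>negligible E\<close>])
      fix u assume u: "u \<in> {s..t} - E"
      from bspec[OF E u] obtain v where v: "v \<in> ?G (\<phi> u)"
        "(\<phi> has_vector_derivative v) (at u within {s..t})" by (rule bexE)
      have "u \<in> I" using interval[OF st(2), of u] u st(1) I(2) by force
      then have "a * norm (\<phi> u) \<le> a * \<rho>" using bound a(1) by simp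
      then have "norm v \<le> L"
        using filippov_set_bound[OF a(2) v(1)] unfolding L_def by linarith
      then show "\<exists>v. (\<phi> has_vector_derivative v) (at u within {s..t}) \<and> norm v \<le> L"
        using v(2) by blast
    qed
    then show "dist (\<phi> s) (\<phi> t) \<le> L * dist s t"
      using st(3) by (simp add: dist_norm norm_minus_commute)
  qed (rule \<open>0 \<le> L\<close>)
  then obtain g where lip: "L-lipschitz_on (closure I) g" and g: "\<And>t. t \<in> I \<Longrightarrow> g t = \<phi> t"
    using lipschitz_extend_closure by metis
  have "{0..S} \<subseteq> closure I"
  proof (cases "S = 0")
    case True
    then show ?thesis using I(1) closure_subset by auto
  next
    case False
    then have "{0..<S} \<subseteq> I" "0 < S" using lower \<open>0 \<le> S\<close> by auto
    then show ?thesis using closure_mono[of "{0..<S}" I] by (simp add: closure_atLeastLessThan)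
  qed
  then have "abs_continuous_on 0 S g"
    using lipschitz_imp_abs_continuous_on lipschitz_on_subset lip by blast
  have g_sol: "filippov_solution_compact ?G 0 S g"
  proof -
    \<comment> \<open>If \<open>S\<close> is not in \<open>I\<close>, then \<open>\<phi>\<close> solves the inclusion only on each \<open>[0, q n]\<close>, with its own null set.\<close>
    define q where "q n = S - inverse (real (Suc n))" for n
    have "\<exists>E. negligible E \<and> (0 \<le> q n \<longrightarrow> (\<forall>t\<in>{0..q n} - E. \<exists>v\<in>?G (\<phi> t).
        (\<phi> has_vector_derivative v) (at t within {0..q n})))" for n
    proof (cases "0 \<le> q n")
      case True
      have "q n < S" by (simp add: q_def)
      with True have "filippov_solution_compact ?G 0 (q n) \<phi>"
        using filippov_solution_imp_compact[OF sol I(1) lower[of "q n"]] by simp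
      then show ?thesis unfolding filippov_solution_compact_iff by blast
    qed auto
    then obtain E where E: "\<And>n. negligible (E n)"
      "\<And>n. 0 \<le> q n \<Longrightarrow> \<forall>t\<in>{0..q n} - E n. \<exists>v\<in>?G (\<phi> t). (\<phi> has_vector_derivative v) (at t within {0..q n})"
      by metis
    define F where "F = (\<Union>n. E n) \<union> {0, S}"
    have "negligible F"
      unfolding F_def using E(1) by (intro negligible_Un negligible_Union_nat) auto
    moreover have "\<exists>v\<in>?G (g t). (g has_vector_derivative v) (at t within {0..S})" if t: "t \<in> {0..S} - F" for t
    proof -
      have "0 < t" "t < S" using t by (auto simp: F_def less_le)
      then obtain n where "inverse (real (Suc n)) < S - t" using reals_Archimedean[of "S - t"] by auto
      then have "t < q n" "q n < S" by (auto simp: q_def)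
      then have "0 \<le> q n" "t \<in> {0..q n} - E n" using t \<open>0 < t\<close> by (auto simp: F_def)
      from bspec[OF E(2)[OF this(1)] this(2)] obtain v where v: "v \<in> ?G (\<phi> t)"
        "(\<phi> has_vector_derivative v) (at t within {0..q n})" by (rule bexE)
      have "(g has_vector_derivative v) (at t within {0..S})"
        using v(2) \<open>0 < t\<close> \<open>t < q n\<close>
      proof (rule has_vector_derivative_transfer_interior)
        show "g s = \<phi> s" if "s \<in> {0..q n}" for s
          using g[OF lower[of s]] that \<open>q n < S\<close> by simp
      qed
      then show ?thesis using v(1) g[OF lower[of t]] \<open>0 < t\<close> \<open>t < S\<close> by auto
    qed
    ultimately show ?thesis
      unfolding filippov_solution_compact_iff using \<open>abs_continuous_on 0 S g\<close> by blast
  qed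
  obtain h \<eta> where "0 < h" "\<eta> 0 = g S" and \<eta>: "filippov_solution_compact ?G 0 h \<eta>"
    using local_solution_exists[OF assms(1), of "g S" A] by blast
  define \<psi> where "\<psi> t = (if t \<le> S then g t else \<eta> (t - S))" for t
  have "filippov_solution_compact ?G 0 S \<psi>"
    using g_sol by (rule filippov_solution_compact_cong) (simp add: \<psi>_def)
  moreover have "filippov_solution_compact ?G S (S + h) \<psi>"
  proof (rule filippov_solution_compact_cong)
    show "filippov_solution_compact ?G S (S + h) (\<lambda>t. \<eta> (t - S))"
      using filippov_solution_compact_translate[OF \<eta>, of S] by (simp add: add.commute)
    show "\<psi> t = \<eta> (t - S)" if "t \<in> {S..S + h}" for t
      using that \<open>\<eta> 0 = g S\<close> by (cases "t = S") (auto simp: \<psi>_def)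
  qed
  ultimately have "filippov_solution_compact ?G 0 (S + h) \<psi>"
    using \<open>0 \<le> S\<close> \<open>0 < h\<close> by (intro filippov_solution_compact_concat[of ?G 0 S \<psi> "S + h"]) auto
  then have "forward_solution ?G {0..S + h} \<psi>"
    using \<open>0 \<le> S\<close> \<open>0 < h\<close> by (intro filippov_solution_compact_imp_forward) auto
  moreover have "I \<subset> {0..S + h}"
  proof
    show "I \<subseteq> {0..S + h}" using I(2) upper \<open>0 < h\<close> by force
    have "S + h \<in> {0..S + h}" "S + h \<notin> I" using upper[of "S + h"] \<open>0 < h\<close> \<open>0 \<le> S\<close> by auto
    then show "I \<noteq> {0..S + h}" by blast
  qed
  moreover have "\<forall>t\<in>I. \<psi> t = \<phi> t" using upper g by (simp add: \<psi>_def)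
  ultimately show False using max unfolding maximal_forward_solution_def by blast
qed

text \<open>
  Zorn's lemma for the graphs of forward solutions from \<open>x\<close>, ordered by inclusion. All intervals start
  at \<open>0\<close>, so a compact subinterval of the union of a chain lies in one of its members.
\<close>

lemma maximal_forward_solution_exists:
  fixes x :: "real^'n"
  obtains I \<phi> where "maximal_forward_solution G I \<phi>" "\<phi> 0 = x"
proof -
  define graph where "graph I \<phi> = (\<lambda>t. (t, \<phi> t)) ` I" for I :: "real set" and \<phi> :: "real \<Rightarrow> real^'n"
  define P where "P = {graph I \<phi> | I \<phi>. forward_solution G I \<phi> \<and> \<phi> 0 = x}"
  have graph_mem: "(t, y) \<in> graph I \<phi> \<longleftrightarrow> t \<in> I \<and> y = \<phi> t" for t y I \<phi>
    by (auto simp: graph_def)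
  have "\<exists>U\<in>P. \<forall>X\<in>C. X \<subseteq> U" if C: "C \<in> chains P" for C
  proof (cases "C = {}")
    case True
    have "filippov_solution_compact G 0 0 (\<lambda>_. x)"
      unfolding filippov_solution_compact_iff
    proof (intro conjI exI[of _ "{0}"])
      show "abs_continuous_on 0 0 (\<lambda>_. x)"
        by (rule lipschitz_imp_abs_continuous_on[OF lipschitz_on_constant])
    qed auto
    then have "forward_solution G {0..0} (\<lambda>_. x)"
      by (rule filippov_solution_compact_imp_forward) simp
    then have "graph {0..0} (\<lambda>_. x) \<in> P" unfolding P_def by blast
    then show ?thesis using True by blast
  next
    case False
    have CP: "C \<subseteq> P" using C by (simp add: chains_def)
    define U where "U = \<Union>C"
    have unique: "y = z" if "(t, y) \<in> U" "(t, z) \<in> U" for t y z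
    proof -
      obtain X Y where XY: "X \<in> C" "Y \<in> C" "(t, y) \<in> X" "(t, z) \<in> Y"
        using \<open>(t, y) \<in> U\<close> \<open>(t, z) \<in> U\<close> unfolding U_def by blast
      then have "X \<subseteq> Y \<or> Y \<subseteq> X" using chainsD[OF C] by blast
      then obtain Z where "Z \<in> C" "(t, y) \<in> Z" "(t, z) \<in> Z" using XY by blast
      moreover obtain I \<phi> where "Z = graph I \<phi>" using \<open>Z \<in> C\<close> CP unfolding P_def by blast
      ultimately show ?thesis by (simp add: graph_mem)
    qed
    define \<phi> where "\<phi> t = (THE y. (t, y) \<in> U)" for t
    have \<phi>: "\<phi> t = y" if "(t, y) \<in> U" for t y
      unfolding \<phi>_def using that unique by (intro the_equality) auto
    define I where "I = fst ` U"
    have U: "U = graph I \<phi>"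
      using \<phi> by (force simp: I_def graph_def)
    have piece: "\<exists>J \<eta>. forward_solution G J \<eta> \<and> \<eta> 0 = x \<and> t \<in> J \<and> J \<subseteq> I \<and> (\<forall>s\<in>J. \<phi> s = \<eta> s)"
      if "t \<in> I" for t
    proof -
      have "(t, \<phi> t) \<in> U" using \<open>t \<in> I\<close> U graph_mem by blast
      then obtain X where X: "X \<in> C" "(t, \<phi> t) \<in> X" unfolding U_def by blast
      then obtain J \<eta> where J: "X = graph J \<eta>" "forward_solution G J \<eta>" "\<eta> 0 = x"
        using CP unfolding P_def by blast
      have XU: "graph J \<eta> \<subseteq> U" using X(1) J(1) unfolding U_def by blast
      have "s \<in> I \<and> \<phi> s = \<eta> s" if "s \<in> J" for s
      proof -
        have "(s, \<eta> s) \<in> U" using XU graph_mem that by blast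
        then show ?thesis using \<phi> U graph_mem by blast
      qed
      then show ?thesis using J X(2) graph_mem by blast
    qed
    have "I \<noteq> {}"
    proof -
      obtain X where "X \<in> C" using False by blast
      then obtain J \<eta> where J: "X = graph J \<eta>" "forward_solution G J \<eta>" using CP unfolding P_def by blast
      then have "(0, \<eta> 0) \<in> U"
        using \<open>X \<in> C\<close> graph_mem unfolding U_def forward_solution_def by blast
      then show ?thesis unfolding I_def by blast
    qed
    then obtain J0 \<eta>0 where J0: "forward_solution G J0 \<eta>0" "\<eta>0 0 = x" "J0 \<subseteq> I" "\<forall>s\<in>J0. \<phi> s = \<eta>0 s"
      using piece by blast
    have "0 \<in> J0" using J0(1) unfolding forward_solution_def by blast
    have "0 \<in> I" "\<phi> 0 = x" using \<open>0 \<in> J0\<close> J0 by auto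
    have "I \<subseteq> {0..}"
    proof
      fix t assume "t \<in> I"
      then show "t \<in> {0..}" using piece[of t] unfolding forward_solution_def by blast
    qed
    moreover have "filippov_solution G I \<phi>"
      unfolding filippov_solution_def
    proof (intro conjI allI impI)
      show "is_interval I"
        unfolding is_interval_1
      proof (intro ballI allI impI)
        fix a b t assume "a \<in> I" "b \<in> I" and t: "a \<le> t \<and> t \<le> b"
        obtain J \<eta> where J: "forward_solution G J \<eta>" "b \<in> J" "J \<subseteq> I" using piece[OF \<open>b \<in> I\<close>] by blast
        have "0 \<le> t" using \<open>I \<subseteq> {0..}\<close> \<open>a \<in> I\<close> t by force
        then have "t \<in> J"
          using J(1,2) t unfolding forward_solution_def filippov_solution_def is_interval_1 by blast
        then show "t \<in> I" using J(3) by blast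
      qed
    next
      fix a b assume ab: "a \<le> b \<and> {a..b} \<subseteq> I"
      then have "a \<in> I" "b \<in> I" by auto
      obtain J \<eta> where J: "forward_solution G J \<eta>" "b \<in> J" "J \<subseteq> I" "\<forall>s\<in>J. \<phi> s = \<eta> s"
        using piece[OF \<open>b \<in> I\<close>] by blast
      have mem: "t \<in> J" if "0 \<le> t" "t \<le> b" for t
        using J(1,2) that unfolding forward_solution_def filippov_solution_def is_interval_1 by blast
      have "0 \<le> a" using \<open>I \<subseteq> {0..}\<close> \<open>a \<in> I\<close> by force
      have "filippov_solution_compact G a b \<eta>"
      proof (rule filippov_solution_imp_compact)
        show "filippov_solution G J \<eta>" using J(1) unfolding forward_solution_def by blast
      qed (use mem \<open>0 \<le> a\<close> ab J(2) in auto)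
      then show "filippov_solution_compact G a b \<phi>"
        by (rule filippov_solution_compact_cong) (use mem \<open>0 \<le> a\<close> J(4) in auto)
    qed
    ultimately have "forward_solution G I \<phi>" unfolding forward_solution_def using \<open>0 \<in> I\<close> by blast
    then have "U \<in> P" unfolding U P_def using \<open>\<phi> 0 = x\<close> by blast
    then show ?thesis unfolding U_def by blast
  qed
  then have "\<forall>C\<in>chains P. \<exists>U\<in>P. \<forall>X\<in>C. X \<subseteq> U" by (rule ballI)
  from Zorn_Lemma2[OF this] obtain X where "X \<in> P" and max: "\<forall>Y\<in>P. X \<subseteq> Y \<longrightarrow> Y = X"
    by (elim bexE)
  then obtain I \<phi> where X: "X = graph I \<phi>" and sol: "forward_solution G I \<phi>" "\<phi> 0 = x"
    unfolding P_def by blast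
  have "0 \<in> I" using sol(1) unfolding forward_solution_def by blast
  have "\<not> (\<exists>I' \<psi>. I \<subset> I' \<and> forward_solution G I' \<psi> \<and> (\<forall>t\<in>I. \<psi> t = \<phi> t))"
  proof (intro notI, elim exE conjE)
    fix I' \<psi> assume *: "I \<subset> I'" "forward_solution G I' \<psi>" "\<forall>t\<in>I. \<psi> t = \<phi> t"
    then have "graph I' \<psi> \<in> P" using \<open>0 \<in> I\<close> sol(2) unfolding P_def by blast
    moreover have "X \<subseteq> graph I' \<psi>" unfolding X graph_def using * by auto
    ultimately have "graph I' \<psi> = graph I \<phi>" unfolding X[symmetric] using max by simp
    then have "fst ` graph I' \<psi> = fst ` graph I \<phi>" by simp
    then show False using *(1) by (simp add: graph_def image_image)
  qed
  then show ?thesis using that sol unfolding maximal_forward_solution_def by blast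
qed

section \<open>Exponential decay under perturbation\<close>

lemma exists_exp_decay_below:
  fixes C \<beta> \<epsilon> :: real
  assumes "0 < \<beta>" "0 < \<epsilon>"
  obtains t where "0 < t" "C * exp (- \<beta> * t) < \<epsilon>"
proof -
  define t where "t = (1 + \<bar>C\<bar> / \<epsilon>) / \<beta>"
  have "0 < t" using assms by (simp add: t_def add_pos_nonneg)
  have "\<bar>C\<bar> / \<epsilon> < exp (\<beta> * t)"
    using exp_ge_add_one_self[of "\<beta> * t"] assms by (simp add: t_def)
  then have "\<bar>C\<bar> < \<epsilon> * exp (\<beta> * t)" using assms by (simp add: divide_less_eq mult.commute)
  then have "\<bar>C\<bar> * exp (- \<beta> * t) < \<epsilon> * exp (\<beta> * t) * exp (- \<beta> * t)" by simp
  also have "\<dots> = \<epsilon>" by (simp add: exp_minus)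
  finally have "\<bar>C\<bar> * exp (- \<beta> * t) < \<epsilon>" .
  moreover have "C * exp (- \<beta> * t) \<le> \<bar>C\<bar> * exp (- \<beta> * t)" by (intro mult_right_mono) auto
  ultimately show ?thesis by (intro that[OF \<open>0 < t\<close>]) linarith
qed

lemma exponentially_stable_imp_inward:
  fixes N :: "real^'n \<Rightarrow> real"
  assumes N: "is_norm N" and stable: "exponentially_stable N (filippov_set k A c) 0"
  shows "c $ k < 0"
proof (rule ccontr)
  \<comment> \<open>The ray \<open>x + t c\<close> stays at distance at least \<open>r\<close> from the origin.\<close>
  assume "\<not> c $ k < 0"
  then have "0 \<le> c $ k" by simp
  obtain m M where mM: "0 < m" "0 < M" "\<And>x. m * norm x \<le> N x" "\<And>x. N x \<le> M * norm x"
    by (rule is_norm_equivalent[OF N]) (rule that)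
  obtain \<alpha> \<beta> \<delta> where "0 < \<beta>" "0 < \<delta>" and decay: "\<forall>I \<phi>.
      maximal_forward_solution (filippov_set k A c) I \<phi> \<and> \<phi> 0 \<in> norm_ball N 0 \<delta> \<longrightarrow>
        I = {0..} \<and> (\<forall>t\<ge>0. N (\<phi> t - 0) \<le> \<alpha> * exp (- \<beta> * t) * N (\<phi> 0 - 0))"
    using stable unfolding exponentially_stable_def by blast
  define r where "r = \<delta> / (2 * M)"
  have "0 < r" "M * r < \<delta>" using mM(2) \<open>0 < \<delta>\<close> by (auto simp: r_def)
  define x :: "real^'n" where "x = r *\<^sub>R axis k 1"
  have "norm x = r" using \<open>0 < r\<close> by (simp add: x_def)
  define \<phi> where "\<phi> t = x + t *\<^sub>R c" for t
  have "filippov_solution_compact (filippov_set k A c) a b \<phi>" if "0 \<le> a" for a b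
  proof (rule filippov_solution_compactI)
    fix t assume "t \<in> {a..b}"
    then have "0 < \<phi> t $ k" using \<open>0 < r\<close> \<open>0 \<le> c $ k\<close> that by (simp add: \<phi>_def x_def add_pos_nonneg)
    then have "c \<in> filippov_set k A c (\<phi> t)" by (simp add: filippov_set_alt)
    moreover have "(\<phi> has_vector_derivative c) (at t within {a..b})"
      unfolding \<phi>_def by (auto intro!: derivative_eq_intros)
    ultimately show "\<exists>v\<in>filippov_set k A c (\<phi> t). (\<phi> has_vector_derivative v) (at t within {a..b})"
      by blast
  qed
  then have "forward_solution (filippov_set k A c) {0..} \<phi>"
    unfolding forward_solution_def filippov_solution_def by (auto simp: is_interval_ci)
  then have "maximal_forward_solution (filippov_set k A c) {0..} \<phi>"
    unfolding maximal_forward_solution_def forward_solution_def by blast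
  moreover have "N (0 - x) < \<delta>"
    using mM(4)[of "0 - x"] \<open>norm x = r\<close> \<open>M * r < \<delta>\<close> by simp
  then have "\<phi> 0 \<in> norm_ball N 0 \<delta>" by (simp add: \<phi>_def norm_ball_def)
  ultimately have bound: "N (\<phi> t) \<le> \<alpha> * exp (- \<beta> * t) * N x" if "0 \<le> t" for t
    using decay[rule_format, of "{0..}" \<phi>] that by (simp add: \<phi>_def)
  have "0 < m * r" using mM(1) \<open>0 < r\<close> by simp
  obtain t where "0 < t" and t: "\<alpha> * N x * exp (- \<beta> * t) < m * r"
    by (rule exists_exp_decay_below[OF \<open>0 < \<beta>\<close> \<open>0 < m * r\<close>]) (rule that)
  have "r \<le> \<phi> t $ k" using \<open>0 < t\<close> \<open>0 \<le> c $ k\<close> by (simp add: \<phi>_def x_def)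
  then have "r \<le> norm (\<phi> t)" using component_le_norm_cart[of "\<phi> t" k] by linarith
  then have "m * r \<le> N (\<phi> t)" using mM(1) mM(3)[of "\<phi> t"] mult_left_mono[of r "norm (\<phi> t)" m] by linarith
  also have "\<dots> \<le> \<alpha> * N x * exp (- \<beta> * t)" using bound[of t] \<open>0 < t\<close> by (simp add: mult_ac)
  finally show False using t by simp
qed

text \<open>
  The solution \<open>\<phi>\<close> of the original system has shrunk to a quarter at time \<open>T\<close>, and the comparison
  error is at most \<open>C T \<cdot> \<epsilon>\<close> times the maximum \<open>\<rho>\<close> of \<open>|\<psi>|\<close>. As the comparison asks for smallness
  of \<open>\<phi>\<close> only, no a priori bound on \<open>\<psi>\<close> is needed: evaluating at the maximum of \<open>|\<psi>|\<close> bounds \<open>\<rho>\<close>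
  by \<open>\<alpha> |\<psi> 0| + \<rho> / 2\<close>.
\<close>

lemma perturbed_contraction:
  fixes A :: "real^'n^'n" and c :: "real^'n"
  assumes "c $ k < 0" and "1 \<le> \<alpha>" "0 < \<beta>" "0 < r\<^sub>0"
    and decay: "\<forall>x. norm x < r\<^sub>0 \<longrightarrow> (\<exists>\<phi>. \<phi> 0 = x \<and>
       (\<forall>t\<ge>0. filippov_solution_compact (filippov_set k A c) 0 t \<phi> \<and>
          norm (\<phi> t) \<le> \<alpha> * exp (- \<beta> * t) * norm x))"
  shows "\<exists>\<epsilon>>0. \<exists>r>0. \<exists>T>0. \<forall>A' c'.
       (\<forall>x. norm (A' *v x - A *v x) \<le> \<epsilon> * norm x) \<and> norm (c' - c) \<le> \<epsilon> \<longrightarrow>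
       c' $ k < 0 \<and>
       (\<forall>\<psi> t. filippov_solution_compact (filippov_set k A' c') 0 t \<psi> \<and> norm (\<psi> 0) < r \<and> 0 \<le> t \<and> t \<le> T \<longrightarrow>
          norm (\<psi> t) \<le> 2 * \<alpha> * norm (\<psi> 0) \<and> (t = T \<longrightarrow> norm (\<psi> t) \<le> norm (\<psi> 0) / 2))"
proof -
  define \<kappa> where "\<kappa> = - c $ k"
  have \<kappa>: "c $ k = - \<kappa>" "0 < \<kappa>" using assms(1) by (auto simp: \<kappa>_def)
  obtain a where a: "0 < a" "\<And>x. norm (A *v x) \<le> a * norm x"
    by (rule matrix_vector_bound[of A]) (rule that)
  define K where "K = 2 * (norm c + \<kappa> / 2) / \<kappa>"
  have "0 < K" unfolding K_def using \<kappa>(2) by (intro divide_pos_pos mult_pos_pos) (auto intro: add_nonneg_pos)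
  obtain T where "0 < T" and T: "\<alpha> * exp (- \<beta> * T) < 1 / 4"
    by (rule exists_exp_decay_below[of \<beta> "1 / 4" \<alpha>]) (use \<open>0 < \<beta>\<close> that in auto)
  define C where "C t = exp ((1 + K) * a * t) * (4 * (1 + K) / \<kappa> + (1 + K) * (2 + 2 * a / \<kappa>) * t)" for t
  have pos: "0 < 4 * (1 + K) / \<kappa>" "0 \<le> (1 + K) * (2 + 2 * a / \<kappa>)" "0 \<le> (1 + K) * a"
    using \<open>0 < K\<close> \<kappa>(2) a(1) by auto
  have C_mono: "C s \<le> C t" if "0 \<le> s" "s \<le> t" for s t
  proof -
    have "(1 + K) * a * s \<le> (1 + K) * a * t" using that(2) pos(3) by (rule mult_left_mono)
    moreover have "(1 + K) * (2 + 2 * a / \<kappa>) * s \<le> (1 + K) * (2 + 2 * a / \<kappa>) * t"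
      using that(2) pos(2) by (rule mult_left_mono)
    moreover have "0 \<le> (1 + K) * (2 + 2 * a / \<kappa>) * s" using pos(2) that(1) by (rule mult_nonneg_nonneg)
    ultimately show ?thesis
      unfolding C_def using pos(1) by - (rule mult_mono, simp_all only: exp_le_cancel_iff
          exp_ge_zero add_left_mono add_nonneg_nonneg less_imp_le)
  qed
  have "0 < C T"
    unfolding C_def using pos \<open>0 < T\<close> by (intro mult_pos_pos add_pos_nonneg) auto
  \<comment> \<open>The first bound keeps \<open>c'\<close> pointing inward, the second makes the error at time \<open>T\<close> at most a
    quarter of the initial value.\<close>
  define \<epsilon> where "\<epsilon> = min (\<kappa> / 2) (1 / (8 * \<alpha> * C T))"
  have "0 < \<epsilon>" using \<kappa>(2) \<open>0 < C T\<close> \<open>1 \<le> \<alpha>\<close> by (simp add: \<epsilon>_def)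
  have "C T * \<epsilon> \<le> C T * (1 / (8 * \<alpha> * C T))"
    using \<open>0 < C T\<close> by (intro mult_left_mono) (auto simp: \<epsilon>_def)
  then have C\<epsilon>: "C T * \<epsilon> * \<alpha> \<le> 1 / 8" using \<open>0 < C T\<close> \<open>1 \<le> \<alpha>\<close> by (simp add: field_simps)
  have "C T * \<epsilon> * 1 \<le> C T * \<epsilon> * \<alpha>" using \<open>0 < C T\<close> \<open>0 < \<epsilon>\<close> \<open>1 \<le> \<alpha>\<close> by (intro mult_left_mono) auto
  then have C\<epsilon>_half: "C T * \<epsilon> \<le> 1 / 2" using C\<epsilon> by simp
  \<comment> \<open>Small enough for the decay of \<open>\<phi>\<close> and for the smallness condition of the comparison.\<close>
  define r where "r = min r\<^sub>0 (\<kappa> / (2 * a) / \<alpha>)"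
  have "0 < r" using \<open>0 < r\<^sub>0\<close> \<kappa>(2) a(1) \<open>1 \<le> \<alpha>\<close> by (simp add: r_def)
  have inward: "c' $ k < 0" if "norm (c' - c) \<le> \<epsilon>" for c' :: "real^'n"
  proof -
    have "\<bar>c' $ k - c $ k\<bar> \<le> \<kappa> / 2"
      using that component_le_norm_cart[of "c' - c" k] by (simp add: \<epsilon>_def)
    then show ?thesis using \<kappa> by linarith
  qed
  have contraction: "norm (\<psi> t) \<le> 2 * \<alpha> * norm (\<psi> 0) \<and> (t = T \<longrightarrow> norm (\<psi> t) \<le> norm (\<psi> 0) / 2)"
    if A': "\<And>x. norm (A' *v x - A *v x) \<le> \<epsilon> * norm x" and c': "norm (c' - c) \<le> \<epsilon>"
      and \<psi>: "filippov_solution_compact (filippov_set k A' c') 0 t \<psi>"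
      and small: "norm (\<psi> 0) < r" and t: "0 \<le> t" "t \<le> T"
    for A' :: "real^'n^'n" and c' :: "real^'n" and \<psi> t
  proof -
    obtain \<phi> where "\<phi> 0 = \<psi> 0"
      and \<phi>: "\<And>s. 0 \<le> s \<Longrightarrow> filippov_solution_compact (filippov_set k A c) 0 s \<phi>"
      and \<phi>_decay: "\<And>s. 0 \<le> s \<Longrightarrow> norm (\<phi> s) \<le> \<alpha> * exp (- \<beta> * s) * norm (\<psi> 0)"
      using decay[rule_format, of "\<psi> 0"] small by (auto simp: r_def)
    have \<phi>_bound: "norm (\<phi> s) \<le> \<alpha> * norm (\<psi> 0)" if "0 \<le> s" for s
    proof -
      have "\<alpha> * exp (- \<beta> * s) \<le> \<alpha> * 1" using \<open>1 \<le> \<alpha>\<close> \<open>0 < \<beta>\<close> that by (intro mult_left_mono) auto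
      then show ?thesis
        using \<phi>_decay[OF that] mult_right_mono[of "\<alpha> * exp (- \<beta> * s)" \<alpha> "norm (\<psi> 0)"] by simp
    qed
    have \<phi>_small: "norm (\<phi> s) \<le> \<kappa> / (2 * a)" if "0 \<le> s" for s
    proof -
      have "\<alpha> * norm (\<psi> 0) \<le> \<alpha> * (\<kappa> / (2 * a) / \<alpha>)"
        using small \<open>1 \<le> \<alpha>\<close> by (intro mult_left_mono) (auto simp: r_def)
      then show ?thesis using \<phi>_bound[OF that] \<open>1 \<le> \<alpha>\<close> by simp
    qed
    have "continuous_on {0..t} \<psi>"
      using \<psi> abs_continuous_on_imp_continuous_on unfolding filippov_solution_compact_iff by blast
    then have "continuous_on {0..t} (\<lambda>s. norm (\<psi> s))" by (rule continuous_on_norm)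
    then obtain s0 where s0: "s0 \<in> {0..t}" and s0_max: "\<And>s. s \<in> {0..t} \<Longrightarrow> norm (\<psi> s) \<le> norm (\<psi> s0)"
      using continuous_attains_sup[of "{0..t}" "\<lambda>s. norm (\<psi> s)"] t(1) by auto
    define \<rho> where "\<rho> = norm (\<psi> s0)"
    have close: "norm (\<phi> s - \<psi> s) \<le> C T * \<epsilon> * \<rho>" if s: "s \<in> {0..t}" for s
    proof -
      have "norm (\<phi> s - \<psi> s) \<le> C s * \<epsilon> * \<rho>"
        unfolding C_def
      proof (rule filippov_solution_comparison[OF \<kappa> a _ _ A' c' K_def])
        show "filippov_solution_compact (filippov_set k A' c') 0 s \<psi>"
          using \<psi> s by (auto intro: filippov_solution_compact_subinterval)
        show "norm (\<psi> u) \<le> \<rho>" if "u \<in> {0..s}" for u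
          using s0_max[of u] that s by (simp add: \<rho>_def)
      qed (use \<open>0 < \<epsilon>\<close> s \<phi> \<phi>_small \<open>\<phi> 0 = \<psi> 0\<close> in \<open>auto simp: \<epsilon>_def\<close>)
      also have "\<dots> \<le> C T * \<epsilon> * \<rho>"
        using C_mono[of s T] s t \<open>0 < \<epsilon>\<close> by (intro mult_right_mono) (auto simp: \<rho>_def)
      finally show ?thesis .
    qed
    have \<psi>_le: "norm (\<psi> s) \<le> norm (\<phi> s) + C T * \<epsilon> * \<rho>" if "s \<in> {0..t}" for s
      using close[OF that] norm_triangle_ineq2[of "\<psi> s" "\<phi> s"] by (simp add: norm_minus_commute)
    have "C T * \<epsilon> * \<rho> \<le> 1 / 2 * \<rho>"
      using C\<epsilon>_half by (intro mult_right_mono) (auto simp: \<rho>_def)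
    then have \<rho>: "\<rho> \<le> 2 * \<alpha> * norm (\<psi> 0)"
      using \<psi>_le[OF s0] \<phi>_bound[of s0] s0 unfolding \<rho>_def by simp
    have "norm (\<psi> t) \<le> norm (\<psi> 0) / 2" if "t = T"
    proof -
      have "C T * \<epsilon> * \<rho> \<le> C T * \<epsilon> * (2 * \<alpha> * norm (\<psi> 0))"
        using \<rho> \<open>0 < C T\<close> \<open>0 < \<epsilon>\<close> by (intro mult_left_mono) auto
      also have "\<dots> = 2 * (C T * \<epsilon> * \<alpha>) * norm (\<psi> 0)" by simp
      also have "\<dots> \<le> 2 * (1 / 8) * norm (\<psi> 0)" using C\<epsilon> by (intro mult_right_mono mult_left_mono) auto
      finally have "C T * \<epsilon> * \<rho> \<le> norm (\<psi> 0) / 4" by simp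
      moreover have "norm (\<phi> T) \<le> 1 / 4 * norm (\<psi> 0)"
        using \<phi>_decay[of T] T \<open>0 < T\<close> mult_right_mono[of "\<alpha> * exp (- \<beta> * T)" "1 / 4" "norm (\<psi> 0)"] by simp
      ultimately show ?thesis using \<psi>_le[of t] t(1) that by simp
    qed
    moreover have "norm (\<psi> t) \<le> 2 * \<alpha> * norm (\<psi> 0)"
      using s0_max[of t] t(1) \<rho> by (simp add: \<rho>_def)
    ultimately show ?thesis by blast
  qed
  have "\<forall>A' c'. (\<forall>x. norm (A' *v x - A *v x) \<le> \<epsilon> * norm x) \<and> norm (c' - c) \<le> \<epsilon> \<longrightarrow>
       c' $ k < 0 \<and>
       (\<forall>\<psi> t. filippov_solution_compact (filippov_set k A' c') 0 t \<psi> \<and> norm (\<psi> 0) < r \<and> 0 \<le> t \<and> t \<le> T \<longrightarrow>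
          norm (\<psi> t) \<le> 2 * \<alpha> * norm (\<psi> 0) \<and> (t = T \<longrightarrow> norm (\<psi> t) \<le> norm (\<psi> 0) / 2))"
    (is "?robust \<epsilon> r T")
  proof (intro allI impI, elim conjE, rule conjI, erule inward, intro allI impI, elim conjE)
    fix A' :: "real^'n^'n" and c' \<psi> t
    assume "\<forall>x. norm (A' *v x - A *v x) \<le> \<epsilon> * norm x" "norm (c' - c) \<le> \<epsilon>"
      "filippov_solution_compact (filippov_set k A' c') 0 t \<psi>" "norm (\<psi> 0) < r" "0 \<le> t" "t \<le> T"
    then show "norm (\<psi> t) \<le> 2 * \<alpha> * norm (\<psi> 0) \<and> (t = T \<longrightarrow> norm (\<psi> t) \<le> norm (\<psi> 0) / 2)"
      by (intro contraction[of A' c']) auto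
  qed
  with \<open>0 < T\<close> have "\<exists>T>0. ?robust \<epsilon> r T" by (intro exI[of _ T] conjI)
  with \<open>0 < r\<close> have "\<exists>r>0. \<exists>T>0. ?robust \<epsilon> r T" by blast
  with \<open>0 < \<epsilon>\<close> show ?thesis by blast
qed

text \<open>
  Since \<open>|\<psi>|\<close> halves over each period, every period starts inside the ball of radius \<open>r\<close> again; solutions
  are translated back to time \<open>0\<close>. The factor \<open>2\<close> pays for the last, incomplete period.
\<close>

lemma geometric_decay:
  fixes G :: "real^'n \<Rightarrow> (real^'n) set"
  assumes "0 < T" "0 \<le> b"
    and step: "\<And>\<psi> t. filippov_solution_compact G 0 t \<psi> \<Longrightarrow> norm (\<psi> 0) < r \<Longrightarrow> 0 \<le> t \<Longrightarrow> t \<le> T \<Longrightarrow>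
       norm (\<psi> t) \<le> b * norm (\<psi> 0) \<and> (t = T \<longrightarrow> norm (\<psi> t) \<le> norm (\<psi> 0) / 2)"
    and \<psi>: "filippov_solution_compact G 0 t \<psi>" and small: "norm (\<psi> 0) < r" and "0 \<le> t"
  shows "norm (\<psi> t) \<le> 2 * b * exp (- (ln 2 / T) * t) * norm (\<psi> 0)"
proof -
  have shifted: "filippov_solution_compact G 0 s (\<lambda>u. \<psi> (u + p))" if "0 \<le> p" "p + s \<le> t" for p s
    using filippov_solution_compact_translate[of G p "p + s" \<psi> "- p"]
      filippov_solution_compact_subinterval[OF \<psi>, of p "p + s"] that by simp
  have halves: "norm (\<psi> (n * T)) \<le> norm (\<psi> 0) / 2 ^ n" if "real n * T \<le> t" for n :: nat
    using that
  proof (induction n)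
    case (Suc n)
    have Suc_le: "real n * T + T \<le> t" using Suc.prems by (simp add: algebra_simps)
    then have IH: "norm (\<psi> (n * T)) \<le> norm (\<psi> 0) / 2 ^ n" using Suc.IH \<open>0 < T\<close> by simp
    have "norm (\<psi> 0) / 2 ^ n \<le> norm (\<psi> 0)" by (simp add: divide_le_eq mult_le_cancel_left1)
    then have "norm (\<psi> (n * T)) < r" using IH small by linarith
    then have "norm (\<psi> (T + n * T)) \<le> norm (\<psi> (n * T)) / 2"
      using step[OF shifted[of "n * T" T]] Suc_le \<open>0 < T\<close> by simp
    then show ?case using IH by (simp add: algebra_simps)
  qed simp
  define n where "n = nat \<lfloor>t / T\<rfloor>"
  have n: "real n \<le> t / T" "t / T < real n + 1"
    using \<open>0 \<le> t\<close> \<open>0 < T\<close> by (auto simp: n_def of_nat_nat)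
  then have nT: "real n * T \<le> t" "t \<le> real n * T + T"
    using \<open>0 < T\<close> by (auto simp: field_simps)
  have "norm (\<psi> 0) / 2 ^ n \<le> norm (\<psi> 0)" by (simp add: divide_le_eq mult_le_cancel_left1)
  then have "norm (\<psi> (n * T)) < r" using halves[OF nT(1)] small by linarith
  then have "norm (\<psi> (t - n * T + n * T)) \<le> b * norm (\<psi> (n * T))"
    using step[OF shifted[of "n * T" "t - n * T"]] nT \<open>0 < T\<close> by simp
  then have "norm (\<psi> t) \<le> b * norm (\<psi> (n * T))" by simp
  also have "\<dots> \<le> b * (norm (\<psi> 0) / 2 ^ n)"
    using halves[OF nT(1)] \<open>0 \<le> b\<close> by (rule mult_left_mono)
  also have "\<dots> \<le> b * (norm (\<psi> 0) * (2 * exp (- (ln 2 / T) * t)))"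
  proof -
    have exp_ln2: "exp (real j * ln 2) = (2 :: real) ^ j" for j
      unfolding exp_of_nat_mult by (simp only: exp_ln zero_less_numeral)
    define e where "e = exp (t / T * ln 2)"
    have "t / T * ln 2 \<le> real (Suc n) * ln 2" using n(2) by (intro mult_right_mono) auto
    then have "e \<le> exp (real (Suc n) * ln 2)" unfolding e_def by (simp only: exp_le_cancel_iff)
    then have "e \<le> 2 * 2 ^ n" unfolding exp_ln2 power_Suc .
    moreover have "0 < e" by (simp add: e_def)
    ultimately have "1 / 2 ^ n \<le> 2 * inverse e" by (simp add: field_simps)
    also have "inverse e = exp (- (ln 2 / T) * t)"
      unfolding e_def exp_minus[symmetric] by (simp add: mult.commute)
    finally have "1 / 2 ^ n \<le> 2 * exp (- (ln 2 / T) * t)" .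
    then have "norm (\<psi> 0) * (1 / 2 ^ n) \<le> norm (\<psi> 0) * (2 * exp (- (ln 2 / T) * t))"
      by (rule mult_left_mono) simp
    then show ?thesis using \<open>0 \<le> b\<close> by (intro mult_left_mono) auto
  qed
  finally show ?thesis by (simp add: mult_ac)
qed

lemma is_equilibrium_0: "is_equilibrium (filippov_set k A c) 0"
  unfolding is_equilibrium_def filippov_solution_def
proof (intro conjI allI impI filippov_solution_compactI)
  fix t a b :: real
  have "0 \<in> filippov_set k A c 0" by (simp add: filippov_set_alt)
  moreover have "((\<lambda>t. 0) has_vector_derivative 0) (at t within {a..b})"
    by (rule has_vector_derivative_const)
  ultimately show "\<exists>v\<in>filippov_set k A c 0. ((\<lambda>t. 0) has_vector_derivative v) (at t within {a..b})"
    by blast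
qed simp

theorem theorem2p3:
  fixes N :: "real^'n \<Rightarrow> real"
    and k :: 'n
    and J :: "'j set"
    and A :: "'j \<Rightarrow> real^'n^'n"
    and c :: "'j \<Rightarrow> real^'n"
    and \<mu>\<^sub>0 :: 'j
  assumes "is_norm N"
    and "\<mu>\<^sub>0 \<in> J"
    and "exponentially_stable N (filippov_map N k (pw_field k (A \<mu>\<^sub>0) (c \<mu>\<^sub>0))) 0"
  shows "\<exists>\<delta>>0. \<forall>\<mu>\<in>J.
           induced_norm N (A \<mu> - A \<mu>\<^sub>0) < \<delta> \<and> N (c \<mu> - c \<mu>\<^sub>0) < \<delta> \<longrightarrow>
           exponentially_stable N (filippov_map N k (pw_field k (A \<mu>) (c \<mu>))) 0"
proof -
  let ?G = "\<lambda>\<mu>. filippov_set k (A \<mu>) (c \<mu>)"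
  have map_eq: "filippov_map N k (pw_field k (A \<mu>) (c \<mu>)) = ?G \<mu>" for \<mu>
    using filippov_map_eq[OF assms(1)] by blast
  have stable: "exponentially_stable N (?G \<mu>\<^sub>0) 0" using assms(3) unfolding map_eq .
  obtain m M where mM: "0 < m" "0 < M" "\<And>x. m * norm x \<le> N x" "\<And>x. N x \<le> M * norm x"
    by (rule is_norm_equivalent[OF assms(1)]) (rule that)
  have "m \<le> M" using mM(3)[of "axis k 1"] mM(4)[of "axis k 1"] by simp
  then have "1 \<le> M / m" using mM(1) by simp
  have inward: "c \<mu>\<^sub>0 $ k < 0" using exponentially_stable_imp_inward[OF assms(1) stable] .
  obtain \<alpha> \<beta> \<delta>0 where "1 \<le> \<alpha>" "0 < \<beta>" "0 < \<delta>0" and decay: "\<forall>I \<phi>.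
      maximal_forward_solution (?G \<mu>\<^sub>0) I \<phi> \<and> \<phi> 0 \<in> norm_ball N 0 \<delta>0 \<longrightarrow>
        I = {0..} \<and> (\<forall>t\<ge>0. N (\<phi> t - 0) \<le> \<alpha> * exp (- \<beta> * t) * N (\<phi> 0 - 0))"
    using stable unfolding exponentially_stable_def by blast
  have "1 \<le> \<alpha> * (M / m)" using \<open>1 \<le> \<alpha>\<close> \<open>1 \<le> M / m\<close> mult_mono[of 1 \<alpha> 1 "M / m"] by simp
  have decay': "\<exists>\<phi>. \<phi> 0 = x \<and> (\<forall>t\<ge>0. filippov_solution_compact (?G \<mu>\<^sub>0) 0 t \<phi> \<and>
      norm (\<phi> t) \<le> \<alpha> * (M / m) * exp (- \<beta> * t) * norm x)" if "norm x < \<delta>0 / M" for x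
  proof -
    obtain I \<phi> where max: "maximal_forward_solution (?G \<mu>\<^sub>0) I \<phi>" and "\<phi> 0 = x"
      by (rule maximal_forward_solution_exists[of "?G \<mu>\<^sub>0" x]) (rule that)
    have "N (0 - \<phi> 0) < \<delta>0"
      using mM(4)[of "0 - \<phi> 0"] \<open>norm x < \<delta>0 / M\<close> mM(2) \<open>\<phi> 0 = x\<close> by (simp add: field_simps)
    then have I: "I = {0..}" and bound: "\<And>t. 0 \<le> t \<Longrightarrow> N (\<phi> t) \<le> \<alpha> * exp (- \<beta> * t) * N x"
      using decay[rule_format, of I \<phi>] max \<open>\<phi> 0 = x\<close> by (simp_all add: norm_ball_def)
    have "filippov_solution_compact (?G \<mu>\<^sub>0) 0 t \<phi>" if "0 \<le> t" for t
      using max that filippov_solution_imp_compact[of "?G \<mu>\<^sub>0" I \<phi> 0 t]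
      unfolding maximal_forward_solution_def forward_solution_def I by simp
    moreover have "norm (\<phi> t) \<le> \<alpha> * (M / m) * exp (- \<beta> * t) * norm x" if "0 \<le> t" for t
    proof -
      have "\<alpha> * exp (- \<beta> * t) * N x \<le> \<alpha> * exp (- \<beta> * t) * (M * norm x)"
        using mM(4)[of x] \<open>1 \<le> \<alpha>\<close> by (intro mult_left_mono) auto
      then have "m * norm (\<phi> t) \<le> \<alpha> * exp (- \<beta> * t) * (M * norm x)"
        using mM(3)[of "\<phi> t"] bound[OF that] by linarith
      then show ?thesis using mM(1) by (simp add: field_simps)
    qed
    ultimately show ?thesis using \<open>\<phi> 0 = x\<close> by blast
  qed
  have "0 < \<delta>0 / M" using \<open>0 < \<delta>0\<close> mM(2) by simp
  from perturbed_contraction[OF inward \<open>1 \<le> \<alpha> * (M / m)\<close> \<open>0 < \<beta>\<close> \<open>0 < \<delta>0 / M\<close>] decay'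
  obtain \<epsilon> r T where "0 < \<epsilon>" "0 < r" "0 < T" and contraction: "\<forall>A' c'.
       (\<forall>x. norm (A' *v x - A \<mu>\<^sub>0 *v x) \<le> \<epsilon> * norm x) \<and> norm (c' - c \<mu>\<^sub>0) \<le> \<epsilon> \<longrightarrow>
       c' $ k < 0 \<and>
       (\<forall>\<psi> t. filippov_solution_compact (filippov_set k A' c') 0 t \<psi> \<and> norm (\<psi> 0) < r \<and> 0 \<le> t \<and> t \<le> T \<longrightarrow>
          norm (\<psi> t) \<le> 2 * (\<alpha> * (M / m)) * norm (\<psi> 0) \<and> (t = T \<longrightarrow> norm (\<psi> t) \<le> norm (\<psi> 0) / 2))"
    by metis
  define b where "b = 2 * (\<alpha> * (M / m))"
  have "2 \<le> b" using \<open>1 \<le> \<alpha> * (M / m)\<close> unfolding b_def by linarith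
  define \<delta> where "\<delta> = min (\<epsilon> * m / M) (\<epsilon> * m)"
  have "0 < \<delta>" using \<open>0 < \<epsilon>\<close> mM(1,2) by (simp add: \<delta>_def)
  show ?thesis
  proof (intro exI[of _ \<delta>] conjI ballI impI \<open>0 < \<delta>\<close>)
    fix \<mu> assume near: "induced_norm N (A \<mu> - A \<mu>\<^sub>0) < \<delta> \<and> N (c \<mu> - c \<mu>\<^sub>0) < \<delta>"
    have A': "norm (A \<mu> *v x - A \<mu>\<^sub>0 *v x) \<le> \<epsilon> * norm x" for x
    proof -
      have "0 \<le> N x" using mM(1) by (intro order_trans[OF _ mM(3)]) simp
      have "m * norm ((A \<mu> - A \<mu>\<^sub>0) *v x) \<le> induced_norm N (A \<mu> - A \<mu>\<^sub>0) * N x"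
        using mM(3) induced_norm_bound[OF assms(1)] by (rule order_trans)
      also have "\<dots> \<le> (\<epsilon> * m / M) * (M * norm x)"
        using near \<open>0 \<le> N x\<close> mM \<open>0 < \<epsilon>\<close> by (intro mult_mono) (auto simp: \<delta>_def)
      also have "\<dots> = m * (\<epsilon> * norm x)" using mM(2) by simp
      finally show ?thesis using mM(1) by (simp add: matrix_vector_mult_diff_rdistrib)
    qed
    have "m * norm (c \<mu> - c \<mu>\<^sub>0) \<le> m * \<epsilon>"
      using mM(3)[of "c \<mu> - c \<mu>\<^sub>0"] near by (simp add: \<delta>_def mult.commute)
    then have c': "norm (c \<mu> - c \<mu>\<^sub>0) \<le> \<epsilon>" using mM(1) by simp
    have inward': "c \<mu> $ k < 0"
      and step: "\<And>\<psi> t. filippov_solution_compact (?G \<mu>) 0 t \<psi> \<Longrightarrow> norm (\<psi> 0) < r \<Longrightarrow> 0 \<le> t \<Longrightarrow> t \<le> T \<Longrightarrow>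
          norm (\<psi> t) \<le> b * norm (\<psi> 0) \<and> (t = T \<longrightarrow> norm (\<psi> t) \<le> norm (\<psi> 0) / 2)"
      using contraction[rule_format, of "A \<mu>" "c \<mu>"] A' c' unfolding b_def by blast+
    have global: "I = {0..} \<and> (\<forall>t\<ge>0. norm (\<psi> t) \<le> 2 * b * exp (- (ln 2 / T) * t) * norm (\<psi> 0))"
      if max: "maximal_forward_solution (?G \<mu>) I \<psi>" and small: "norm (\<psi> 0) < r" for I \<psi>
    proof -
      have sol: "filippov_solution (?G \<mu>) I \<psi>" and I: "0 \<in> I" "I \<subseteq> {0..}"
        using max unfolding maximal_forward_solution_def forward_solution_def by blast+
      have bound: "norm (\<psi> t) \<le> 2 * b * exp (- (ln 2 / T) * t) * norm (\<psi> 0)" if "t \<in> I" for t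
      proof (rule geometric_decay[where G = "?G \<mu>" and r = r])
        show "0 \<le> t" using I(2) that by auto
        then show "filippov_solution_compact (?G \<mu>) 0 t \<psi>"
          by (rule filippov_solution_imp_compact[OF sol I(1) that])
      qed (use step small \<open>0 < T\<close> \<open>2 \<le> b\<close> in auto)
      have "norm (\<psi> t) \<le> 2 * b * norm (\<psi> 0)" if "t \<in> I" for t
      proof -
        have "exp (- (ln 2 / T) * t) \<le> 1" using I(2) that \<open>0 < T\<close> by force
        then have "2 * b * exp (- (ln 2 / T) * t) * norm (\<psi> 0) \<le> 2 * b * 1 * norm (\<psi> 0)"
          using \<open>2 \<le> b\<close> by (intro mult_right_mono mult_left_mono) auto
        then show ?thesis using bound[OF that] by simp
      qed
      then have "I = {0..}"
        by (rule maximal_bounded_solution_global[OF inward' max])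
      then show ?thesis using bound by simp
    qed
    have "exponentially_stable N (?G \<mu>) 0"
      unfolding exponentially_stable_def
    proof (intro conjI exI allI impI is_equilibrium_0)
      show "1 \<le> 2 * b * (M / m)"
        using \<open>2 \<le> b\<close> \<open>1 \<le> M / m\<close> mult_mono[of 1 "2 * b" 1 "M / m"] by simp
      show "0 < ln 2 / T" using \<open>0 < T\<close> by simp
      show "0 < m * r" using mM(1) \<open>0 < r\<close> by simp
    next
      fix I \<psi> assume *: "maximal_forward_solution (?G \<mu>) I \<psi> \<and> \<psi> 0 \<in> norm_ball N 0 (m * r)"
      have "m * norm (\<psi> 0) < m * r"
        using * mM(3)[of "0 - \<psi> 0"] by (simp add: norm_ball_def)
      then have small: "norm (\<psi> 0) < r" using mM(1) by simp
      with * global show "I = {0..}" by blast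
      fix t :: real assume "0 \<le> t"
      then have "norm (\<psi> t) \<le> 2 * b * exp (- (ln 2 / T) * t) * norm (\<psi> 0)"
        using * small global by blast
      also have "\<dots> \<le> 2 * b * exp (- (ln 2 / T) * t) * (N (\<psi> 0) / m)"
        using mM(1) mM(3)[of "\<psi> 0"] \<open>2 \<le> b\<close> by (intro mult_left_mono) (auto simp: field_simps)
      finally have "M * norm (\<psi> t) \<le> M * (2 * b * exp (- (ln 2 / T) * t) * (N (\<psi> 0) / m))"
        using mM(2) by (intro mult_left_mono) auto
      then show "N (\<psi> t - 0) \<le> 2 * b * (M / m) * exp (- (ln 2 / T) * t) * N (\<psi> 0 - 0)"
        using mM(4)[of "\<psi> t"] by (simp add: mult_ac)
    qed
    then show "exponentially_stable N (filippov_map N k (pw_field k (A \<mu>) (c \<mu>))) 0"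
      unfolding map_eq .
  qed
qed

end
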